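(* Let $q\in\mathbb C\setminus\{0\}$. If $q$ is not a root of unity, then each irreducible finite dimensional representation of $U'_q(\mathrm{so}_4)$ is equivalent to one of the irreducible representations of the classical type $R_{jj'}$, $j,j'\in\{0,\frac12,1,\frac32,\dots\}$, or to one of the irreducible representations of the nonclassical type $R^{(\varepsilon_1,\varepsilon_2,\varepsilon_3)}_{jj'}$, where $\varepsilon_1,\varepsilon_2,\varepsilon_3\in\{1,-1\}$, $j\ge j'\ge0$, and one of $j,j'$ is an integer while the other belongs to $\frac12+\mathbb Z$ (both families are given by the formulas in the context).
   Context: Fix a square root $q^{1/2}$ of $q$; for $m\in\frac12\mathbb Z$ put $q^m=(q^{1/2})^{2m}$, $[m]=\frac{q^m-q^{-m}}{q-q^{-1}}$, $[m]_+=\frac{q^m+q^{-m}}{q-q^{-1}}$; $\mathrm i=\sqrt{-1}$. The complex unital associative algebra $U'_q(\mathrm{so}_4)$ is generated by $I_{21},I_{32},I_{43}$ with defining relations $$I_{21}I_{32}^2-(q+q^{-1})I_{32}I_{21}I_{32}+I_{32}^2I_{21}=-I_{21},\quad I_{32}I_{21}^2-(q+q^{-1})I_{21}I_{32}I_{21}+I_{21}^2I_{32}=-I_{32},$$ $$I_{32}I_{43}^2-(q+q^{-1})I_{43}I_{32}I_{43}+I_{43}^2I_{32}=-I_{32},\quad I_{43}I_{32}^2-(q+q^{-1})I_{32}I_{43}I_{32}+I_{32}^2I_{43}=-I_{43},$$ $$I_{21}I_{43}=I_{43}I_{21}.$$ In all formulas below vectors with indices outside the stated ranges occur only with zero coefficient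 and are read as $0$. Classical type: $R_{jj'}$ acts on the space with basis $|k,l\rangle$, $k=-j,-j+1,\dots,j$, $l=-j',-j'+1,\dots,j'$, by $$R_{jj'}(I_{21})|k,l\rangle=\mathrm i[k+l]\,|k,l\rangle,\qquad R_{jj'}(I_{43})|k,l\rangle=\mathrm i[k-l]\,|k,l\rangle,$$ $$R_{jj'}(I_{32})|k,l\rangle=\frac{1}{(q^{k+l}+q^{-k-l})(q^{k-l}+q^{-k+l})}\Big\{-(q^{j-l}+q^{-j+l})[j'-l]\,|k,l+1\rangle+(q^{j+l}+q^{-j-l})[j'+l]\,|k,l-1\rangle$$ $$+(q^{j'-k}+q^{-j'+k})[j-k]\,|k+1,l\rangle-(q^{j'+k}+q^{-j'-k})[j+k]\,|k-1,l\rangle\Big\}.$$ Nonclassical type: $R=R^{(\varepsilon_1,\varepsilon_2,\varepsilon_3)}_{jj'}$ acts on the space with basis $|k,l\rangle$, where $k=j,j-1,\dots,\frac12$, $l=j',j'-1,\dots,-j'$ if $j\in\frac12+\mathbb Z$, $j'\in\mathbb Z$; and $k=j,j-1,\dots,-j$, $l=j',j'-1,\dots,\frac12$ if $j\in\mathbb Z$, $j'\in\frac12+\mathbb Z$. In both cases $$R(I_{21})|k,l\rangle=\varepsilon_1[k+l]_+|k,l\rangle,\qquad R(I_{43})|k,l\rangle=\varepsilon_2[k-l]_+|k,l\rangle.$$ For $k\ne\frac12$ (when $j$ is half-integral), respectively $l\neq\frac12$ (when $j'$ is half-integral), $$R(I_{32})|k,l\rangle=\frac{1}{[k+l][k-l](q-q^{-1})}\Big\{-\mathrm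 i[j'-l][j-l]\,|k,l+1\rangle+\mathrm i[j'+l][j+l]\,|k,l-1\rangle-\mathrm i[j'-k][j-k]\,|k+1,l\rangle+\mathrm i[j'+k][j+k]\,|k-1,l\rangle\Big\}.$$ If $j$ is half-integral, $$R(I_{32})|\tfrac12,l\rangle=\frac{-1}{[l+\frac12][l-\frac12](q-q^{-1})}\Big\{-\mathrm i[j-l][j'-l]\,|\tfrac12,l+1\rangle+\mathrm i[j+l][j'+l]\,|\tfrac12,l-1\rangle-\mathrm i[j'-\tfrac12][j-\tfrac12]\,|\tfrac32,l\rangle+\mathrm i\,\varepsilon_3(-1)^l[j'+\tfrac12][j+\tfrac12]\,|\tfrac12,-l\rangle\Big\}.$$ If $j'$ is half-integral, $$R(I_{32})|k,\tfrac12\rangle=\frac{1}{[k+\frac12][k-\frac12](q-q^{-1})}\Big\{-\mathrm i[j-\tfrac12][j'-\tfrac12]\,|k,\tfrac32\rangle+\mathrm i\,\varepsilon_3(-1)^k[j+\tfrac12][j'+\tfrac12]\,|-k,\tfrac12\rangle-\mathrm i[j'-k][j-k]\,|k+1,\tfrac12\rangle+\mathrm i[j'+k][j+k]\,|k-1,\tfrac12\rangle\Big\}.$$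
   Formalization: In the formulas for R(I_32)|1/2,l> and R(I_32)|k,1/2> the factor i on the ε_3 term is dropped: as printed they violate the defining relations (e.g. j=1/2, j'=0), and the genuine 1-dimensional nonclassical irreducibles would be missing. *)

theory Defs
  imports Complex_Main "HOL-Library.Poly_Mapping" "HOL-Algebra.QuotRing"
begin

section \<open>The algebra $U'_q(\mathrm{so}_4)$\<close>

datatype so4_gen = I21 | I32 | I43

text \<open>
  The free unital associative algebra on the generators is the monoid algebra of the free monoid
  of words.  Since \<open>\<Rightarrow>\<^sub>0\<close> takes its convolution product from an additively written monoid of
  exponents, words are wrapped in a type on which \<open>+\<close> is concatenation.
\<close>

datatype 'a word = Word "'a list"

instantiation word :: (type) monoid_add
begin

definition zero_word :: "'a word" where
  "zero_word = Word []"

fun plus_word :: "'a word \<Rightarrow> 'a word \<Rightarrow> 'a word" where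
  "plus_word (Word u) (Word v) = Word (u @ v)"

instance
proof
  fix a b c :: "'a word"
  show "a + b + c = a + (b + c)"
    by (cases a; cases b; cases c) simp
  show "0 + a = a"
    by (cases a) (simp add: zero_word_def)
  show "a + 0 = a"
    by (cases a) (simp add: zero_word_def)
qed

end

type_synonym free_alg = "so4_gen word \<Rightarrow>\<^sub>0 complex"

definition scalar :: "complex \<Rightarrow> free_alg" where
  "scalar c = Poly_Mapping.single 0 c"

definition gen :: "so4_gen \<Rightarrow> free_alg" where
  "gen g = Poly_Mapping.single (Word [g]) 1"

definition free_ring :: "free_alg ring" where
  "free_ring = \<lparr>carrier = UNIV, monoid.mult = (*), one = 1, zero = 0, add = (+)\<rparr>"

lemma ring_free_ring: "ring free_ring"
proof (intro ringI abelian_groupI monoidI)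
  fix x :: free_alg
  have "- x + x = 0"
    by simp
  then show "\<exists>y\<in>carrier free_ring. y \<oplus>\<^bsub>free_ring\<^esub> x = \<zero>\<^bsub>free_ring\<^esub>"
    by (auto simp: free_ring_def intro: exI[of _ "- x"])
qed (simp_all add: free_ring_def algebra_simps)

text \<open>The defining relation $XY^2 - (q+q^{-1})YXY + Y^2X = -X$, brought to one side.\<close>

definition serre_relator :: "complex \<Rightarrow> so4_gen \<Rightarrow> so4_gen \<Rightarrow> free_alg" where
  "serre_relator q x y =
     gen x * gen y ^ 2 - scalar (q + inverse q) * gen y * gen x * gen y + gen y ^ 2 * gen x + gen x"

definition so4_relators :: "complex \<Rightarrow> free_alg set" where
  "so4_relators q =
     {serre_relator q I21 I32, serre_relator q I32 I21,
      serre_relator q I32 I43, serre_relator q I43 I32,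
      gen I21 * gen I43 - gen I43 * gen I21}"

definition so4_ideal :: "complex \<Rightarrow> free_alg set" where
  "so4_ideal q = genideal free_ring (so4_relators q)"

lemma ideal_so4_ideal: "ideal (so4_ideal q) free_ring"
  unfolding so4_ideal_def
  by (rule ring.genideal_ideal[OF ring_free_ring]) (simp add: free_ring_def)

definition Uq_so4 :: "complex \<Rightarrow> free_alg set ring" where
  "Uq_so4 q = free_ring Quot so4_ideal q"

definition cls :: "complex \<Rightarrow> free_alg \<Rightarrow> free_alg set" where
  "cls q x = a_r_coset free_ring (so4_ideal q) x"

lemma ring_Uq_so4: "ring (Uq_so4 q)"
  unfolding Uq_so4_def by (rule ideal.quotient_is_ring[OF ideal_so4_ideal])

lemma carrier_Uq_so4: "carrier (Uq_so4 q) = range (cls q)"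
  by (auto simp: Uq_so4_def FactRing_def A_RCOSETS_def' cls_def free_ring_def)

section \<open>Representations\<close>

text \<open>
  A representation on the subspace \<open>V\<close> of an ambient complex vector space: a unital homomorphism of
  complex algebras into the linear endomorphisms of \<open>V\<close>.  Nothing is required of \<open>\<rho> a v\<close> when
  \<open>a\<close> is not in the algebra or \<open>v\<close> is not in \<open>V\<close>.
  Scalar multiplication by \<open>c\<close> in the quotient is multiplication by the class of \<open>scalar c\<close>.
\<close>

locale so4_rep = vector_space scale
  for scale :: "complex \<Rightarrow> 'v::ab_group_add \<Rightarrow> 'v" +
  fixes q :: complex and V :: "'v set" and \<rho> :: "free_alg set \<Rightarrow> 'v \<Rightarrow> 'v"
  assumes subspace_V: "subspace V"
    and maps_to: "\<And>a v. \<lbrakk>a \<in> carrier (Uq_so4 q); v \<in> V\<rbrakk> \<Longrightarrow> \<rho> a v \<in> V"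
    and op_add: "\<And>a v w. \<lbrakk>a \<in> carrier (Uq_so4 q); v \<in> V; w \<in> V\<rbrakk>
                   \<Longrightarrow> \<rho> a (v + w) = \<rho> a v + \<rho> a w"
    and op_scale: "\<And>a c v. \<lbrakk>a \<in> carrier (Uq_so4 q); v \<in> V\<rbrakk> \<Longrightarrow> \<rho> a (scale c v) = scale c (\<rho> a v)"
    and rep_one: "\<And>v. v \<in> V \<Longrightarrow> \<rho> \<one>\<^bsub>Uq_so4 q\<^esub> v = v"
    and rep_add: "\<And>a b v. \<lbrakk>a \<in> carrier (Uq_so4 q); b \<in> carrier (Uq_so4 q); v \<in> V\<rbrakk>
                   \<Longrightarrow> \<rho> (a \<oplus>\<^bsub>Uq_so4 q\<^esub> b) v = \<rho> a v + \<rho> b v"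
    and rep_mult: "\<And>a b v. \<lbrakk>a \<in> carrier (Uq_so4 q); b \<in> carrier (Uq_so4 q); v \<in> V\<rbrakk>
                   \<Longrightarrow> \<rho> (a \<otimes>\<^bsub>Uq_so4 q\<^esub> b) v = \<rho> a (\<rho> b v)"
    and rep_scale: "\<And>c a v. \<lbrakk>a \<in> carrier (Uq_so4 q); v \<in> V\<rbrakk>
                   \<Longrightarrow> \<rho> (cls q (scalar c) \<otimes>\<^bsub>Uq_so4 q\<^esub> a) v = scale c (\<rho> a v)"

definition finite_dim_space :: "(complex \<Rightarrow> 'v::ab_group_add \<Rightarrow> 'v) \<Rightarrow> 'v set \<Rightarrow> bool" where
  "finite_dim_space scale V \<longleftrightarrow> (\<exists>B. finite B \<and> module.span scale B = V)"

definition irreducible_so4_rep ::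
  "(complex \<Rightarrow> 'v::ab_group_add \<Rightarrow> 'v) \<Rightarrow> complex \<Rightarrow> 'v set \<Rightarrow> (free_alg set \<Rightarrow> 'v \<Rightarrow> 'v) \<Rightarrow> bool" where
  "irreducible_so4_rep scale q V \<rho> \<longleftrightarrow>
     so4_rep scale q V \<rho> \<and> V \<noteq> {0} \<and>
     (\<forall>W. module.subspace scale W \<and> W \<subseteq> V \<and> (\<forall>a\<in>carrier (Uq_so4 q). \<rho> a ` W \<subseteq> W)
            \<longrightarrow> W = {0} \<or> W = V)"

definition equivalent_so4_rep ::
  "complex \<Rightarrow>
   (complex \<Rightarrow> 'v::ab_group_add \<Rightarrow> 'v) \<Rightarrow> 'v set \<Rightarrow> (free_alg set \<Rightarrow> 'v \<Rightarrow> 'v) \<Rightarrow>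
   (complex \<Rightarrow> 'w::ab_group_add \<Rightarrow> 'w) \<Rightarrow> 'w set \<Rightarrow> (free_alg set \<Rightarrow> 'w \<Rightarrow> 'w) \<Rightarrow> bool" where
  "equivalent_so4_rep q scale V \<rho> scale' V' \<rho>' \<longleftrightarrow>
     (\<exists>T. bij_betw T V V' \<and>
          (\<forall>v\<in>V. \<forall>w\<in>V. T (v + w) = T v + T w) \<and>
          (\<forall>c. \<forall>v\<in>V. T (scale c v) = scale' c (T v)) \<and>
          (\<forall>a\<in>carrier (Uq_so4 q). \<forall>v\<in>V. T (\<rho> a v) = \<rho>' a (T v)))"

section \<open>The numbers $[m]$ and $[m]_+$\<close>

text \<open>
  Throughout, \<open>s\<close> is the chosen square root $q^{1/2}$ and \<open>qpow s m\<close> is $q^m = s^{2m}$.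
  It is meant only for \<open>m\<close> with \<open>2 * m\<close> an integer, where the floor is exact.
\<close>

definition qpow :: "complex \<Rightarrow> rat \<Rightarrow> complex" where
  "qpow s m = s powi \<lfloor>2 * m\<rfloor>"

definition qnum :: "complex \<Rightarrow> rat \<Rightarrow> complex" where
  "qnum s m = (qpow s m - qpow s (- m)) / (qpow s 1 - qpow s (- 1))"

definition qnum_plus :: "complex \<Rightarrow> rat \<Rightarrow> complex" where
  "qnum_plus s m = (qpow s m + qpow s (- m)) / (qpow s 1 - qpow s (- 1))"

section \<open>The representations of classical and nonclassical type\<close>

text \<open>
  \<open>ket k l\<close> is the basis vector $|k,l\rangle$.  The kets with arbitrary rational labels form a basis
  of one ambient space; a particular representation lives on the span of the kets in its index set.
  In the action formulas, kets outside the index set have coefficient zero.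
\<close>

type_synonym ket_space = "(rat \<times> rat) \<Rightarrow>\<^sub>0 complex"

definition ket :: "rat \<Rightarrow> rat \<Rightarrow> ket_space" where
  "ket k l = Poly_Mapping.single (k, l) 1"

definition ket_scale :: "complex \<Rightarrow> ket_space \<Rightarrow> ket_space"  (infixr \<open>*\<^sub>k\<close> 75) where
  "c *\<^sub>k v = Poly_Mapping.map ((*) c) v"

lemma lookup_ket_scale: "Poly_Mapping.lookup (c *\<^sub>k v) x = c * Poly_Mapping.lookup v x"
  by (simp add: ket_scale_def map.rep_eq when_def in_keys_iff)

lemma vector_space_ket_scale: "vector_space ket_scale"
  by unfold_locales
    (auto intro!: poly_mapping_eqI simp: lookup_ket_scale lookup_add algebra_simps)

definition ket_span :: "(rat \<times> rat) set \<Rightarrow> ket_space set" where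
  "ket_span A = module.span ket_scale ((\<lambda>(k, l). ket k l) ` A)"

definition given_on_basis ::
  "complex \<Rightarrow> (rat \<times> rat) set \<Rightarrow> (so4_gen \<Rightarrow> rat \<Rightarrow> rat \<Rightarrow> ket_space) \<Rightarrow>
   (free_alg set \<Rightarrow> ket_space \<Rightarrow> ket_space) \<Rightarrow> bool" where
  "given_on_basis q A act R \<longleftrightarrow>
     so4_rep ket_scale q (ket_span A) R \<and>
     (\<forall>g. \<forall>(k, l)\<in>A. R (cls q (gen g)) (ket k l) = act g k l)"

definition classical_index :: "rat \<Rightarrow> rat \<Rightarrow> (rat \<times> rat) set" where
  "classical_index j j' =
     {k. - j \<le> k \<and> k \<le> j \<and> j - k \<in> \<int>} \<times> {l. - j' \<le> l \<and> l \<le> j' \<and> j' - l \<in> \<int>}"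

fun classical_action ::
  "complex \<Rightarrow> rat \<Rightarrow> rat \<Rightarrow> so4_gen \<Rightarrow> rat \<Rightarrow> rat \<Rightarrow> ket_space" where
  "classical_action s j j' I21 k l = (\<i> * qnum s (k + l)) *\<^sub>k ket k l"
| "classical_action s j j' I43 k l = (\<i> * qnum s (k - l)) *\<^sub>k ket k l"
| "classical_action s j j' I32 k l =
     (1 / ((qpow s (k + l) + qpow s (- k - l)) * (qpow s (k - l) + qpow s (- k + l)))) *\<^sub>k
     ( (- (qpow s (j - l) + qpow s (- j + l)) * qnum s (j' - l)) *\<^sub>k ket k (l + 1)
     + ((qpow s (j + l) + qpow s (- j - l)) * qnum s (j' + l)) *\<^sub>k ket k (l - 1)
     + ((qpow s (j' - k) + qpow s (- j' + k)) * qnum s (j - k)) *\<^sub>k ket (k + 1) l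
     + (- (qpow s (j' + k) + qpow s (- j' - k)) * qnum s (j + k)) *\<^sub>k ket (k - 1) l)"

text \<open>\<open>R\<close> is the representation $R_{jj'}$ of $U'_q(\mathrm{so}_4)$, $q = s^2$.\<close>

definition classical_rep ::
  "complex \<Rightarrow> rat \<Rightarrow> rat \<Rightarrow> (free_alg set \<Rightarrow> ket_space \<Rightarrow> ket_space) \<Rightarrow> bool" where
  "classical_rep s j j' R \<longleftrightarrow>
     given_on_basis (s ^ 2) (classical_index j j') (classical_action s j j') R"

text \<open>Exactly one of \<open>j\<close>, \<open>j'\<close> is meant to be an integer, the other one half-integral.\<close>

definition nonclassical_index :: "rat \<Rightarrow> rat \<Rightarrow> (rat \<times> rat) set" where
  "nonclassical_index j j' =
     (if j \<notin> \<int>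
      then {k. 1 / 2 \<le> k \<and> k \<le> j \<and> j - k \<in> \<int>} \<times> {l. - j' \<le> l \<and> l \<le> j' \<and> j' - l \<in> \<int>}
      else {k. - j \<le> k \<and> k \<le> j \<and> j - k \<in> \<int>} \<times> {l. 1 / 2 \<le> l \<and> l \<le> j' \<and> j' - l \<in> \<int>})"

text \<open>
  In the two boundary cases of \<open>I32\<close>, the term with \<open>\<epsilon>3\<close> carries no factor \<open>\<i>\<close>: with such a factor
  the operators would violate the defining relations.  For \<open>j = 1/2\<close>, \<open>j' = 0\<close>,
  for instance, the relation $I_{21}I_{32}^2 - (q+q^{-1})I_{32}I_{21}I_{32} + I_{32}^2I_{21} = -I_{21}$
  forces $I_{32}^2 = (q^{1/2} - q^{-1/2})^{-2}$, so
  $I_{32} = \pm(q^{1/2} - q^{-1/2})^{-1} = \pm 1/([1/2](q - q^{-1}))$.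
\<close>

fun nonclassical_action ::
  "complex \<Rightarrow> rat \<Rightarrow> rat \<Rightarrow> complex \<Rightarrow> complex \<Rightarrow> complex \<Rightarrow> so4_gen \<Rightarrow> rat \<Rightarrow> rat \<Rightarrow> ket_space" where
  "nonclassical_action s j j' \<epsilon>1 \<epsilon>2 \<epsilon>3 I21 k l = (\<epsilon>1 * qnum_plus s (k + l)) *\<^sub>k ket k l"
| "nonclassical_action s j j' \<epsilon>1 \<epsilon>2 \<epsilon>3 I43 k l = (\<epsilon>2 * qnum_plus s (k - l)) *\<^sub>k ket k l"
| "nonclassical_action s j j' \<epsilon>1 \<epsilon>2 \<epsilon>3 I32 k l =
     (if j \<notin> \<int> \<and> k = 1 / 2 then
        (- 1 / (qnum s (l + 1 / 2) * qnum s (l - 1 / 2) * (qpow s 1 - qpow s (- 1)))) *\<^sub>k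
        ( (- \<i> * qnum s (j - l) * qnum s (j' - l)) *\<^sub>k ket (1 / 2) (l + 1)
        + (\<i> * qnum s (j + l) * qnum s (j' + l)) *\<^sub>k ket (1 / 2) (l - 1)
        + (- \<i> * qnum s (j' - 1 / 2) * qnum s (j - 1 / 2)) *\<^sub>k ket (3 / 2) l
        + (\<epsilon>3 * (- 1) powi \<lfloor>l\<rfloor> * qnum s (j' + 1 / 2) * qnum s (j + 1 / 2)) *\<^sub>k ket (1 / 2) (- l))
      else if j' \<notin> \<int> \<and> l = 1 / 2 then
        (1 / (qnum s (k + 1 / 2) * qnum s (k - 1 / 2) * (qpow s 1 - qpow s (- 1)))) *\<^sub>k
        ( (- \<i> * qnum s (j - 1 / 2) * qnum s (j' - 1 / 2)) *\<^sub>k ket k (3 / 2)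
        + (\<epsilon>3 * (- 1) powi \<lfloor>k\<rfloor> * qnum s (j + 1 / 2) * qnum s (j' + 1 / 2)) *\<^sub>k ket (- k) (1 / 2)
        + (- \<i> * qnum s (j' - k) * qnum s (j - k)) *\<^sub>k ket (k + 1) (1 / 2)
        + (\<i> * qnum s (j' + k) * qnum s (j + k)) *\<^sub>k ket (k - 1) (1 / 2))
      else
        (1 / (qnum s (k + l) * qnum s (k - l) * (qpow s 1 - qpow s (- 1)))) *\<^sub>k
        ( (- \<i> * qnum s (j' - l) * qnum s (j - l)) *\<^sub>k ket k (l + 1)
        + (\<i> * qnum s (j' + l) * qnum s (j + l)) *\<^sub>k ket k (l - 1)
        + (- \<i> * qnum s (j' - k) * qnum s (j - k)) *\<^sub>k ket (k + 1) l
        + (\<i> * qnum s (j' + k) * qnum s (j + k)) *\<^sub>k ket (k - 1) l))"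

text \<open>\<open>R\<close> is the representation $R^{(\epsilon_1,\epsilon_2,\epsilon_3)}_{jj'}$ of
  $U'_q(\mathrm{so}_4)$, $q = s^2$.\<close>

definition nonclassical_rep ::
  "complex \<Rightarrow> rat \<Rightarrow> rat \<Rightarrow> complex \<Rightarrow> complex \<Rightarrow> complex \<Rightarrow>
   (free_alg set \<Rightarrow> ket_space \<Rightarrow> ket_space) \<Rightarrow> bool" where
  "nonclassical_rep s j j' \<epsilon>1 \<epsilon>2 \<epsilon>3 R \<longleftrightarrow>
     given_on_basis (s ^ 2) (nonclassical_index j j') (nonclassical_action s j j' \<epsilon>1 \<epsilon>2 \<epsilon>3) R"

definition half_integral :: "rat \<Rightarrow> bool" where
  "half_integral x \<longleftrightarrow> x - 1 / 2 \<in> \<int>"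

end

theory Submission
  imports Defs "HOL-Computational_Algebra.Fundamental_Theorem_Algebra"
begin

text \<open>
  Write \<open>A\<close>, \<open>B\<close>, \<open>C\<close> for the operators of $I_{21}$, $I_{32}$, $I_{43}$.  Each of the pairs
  \<open>(A, B)\<close>, \<open>(C, B)\<close> represents $U'_q(\mathrm{so}_3)$.  Neither \<open>A\<close> nor \<open>C\<close> has an eigenvalue
  $\pm[n]_+$ with $n$ an integer: below a top eigenvector $v$ with such an eigenvalue, the minimal polynomial of \<open>B\<close> at $v$ is odd, so
  \<open>B\<close> has a kernel on the span of the $B^m v$; climbing from there with the roles of \<open>A\<close> and \<open>B\<close> exchanged,
  and then back again, yields a kernel of \<open>A\<close> in this span, where \<open>A\<close> has nonzero eigenvalues only.

  Hence \<open>B\<close> splits, on common eigenvectors of \<open>A\<close> and \<open>C\<close>, into four components which shift the two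
  weights by $q^{\pm1}$.  The relations between these components determine the action of all three operators on
  the lattice of vectors obtained by lowering a top vector, up to the two weights of the top vector, and
  finite dimension quantizes these to $q^{j+j'}$, $q^{j-j'}$ up to fourth roots of unity.
  In the classical case the lattice vectors have distinct weights.  In the nonclassical case the two
  halves of the lattice have the same weights; choosing the top vector as an eigenvector of the operator
  which lowers to the opposite corner, the halves become proportional, and the factor of
  proportionality is $\epsilon_3$ up to a fourth root of unity.
\<close>

section \<open>Finite-dimensional linear algebra\<close>

text \<open>Labels with x^2 = -q^(2N) are the obstacle. A power of \<open>q\<close> moves such a
  label to one with x^2 = -1, whose neighbours \<open>q * x\<close> and \<open>x / q\<close> carry
  the same weight, and there B v cannot be split by eigenprojections. Away from these labels the
  cubic relations become quadratic ones between the components of \<open>B\<close>. Raising after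
  lowering is then the solution of two linear equations, one from each so3 pair, whose determinant
  is a multiple of q + 1/q and of nonzero values of \<open>up\<close>; this is why closed formulas
  for the whole lattice follow by induction from a single top vector. The lattice spans an invariant
  subspace, so irreducibility makes it all of \<open>V\<close>. The explicit formulas are never
  tested against the defining relations: the module structure of \<open>V\<close> is transported to
  the span of the kets, and only the action of the generators on basis vectors is compared. The
  ambiguity of labels is also a tool: replacing \<open>y0\<close> by -1/y0 exchanges the two chain
  lengths, and in the nonclassical case it reflects the lattice in its centre.\<close>

definition pact :: "(complex \<Rightarrow> 'v \<Rightarrow> 'v::ab_group_add) \<Rightarrow> ('v \<Rightarrow> 'v) \<Rightarrow> complex poly \<Rightarrow> 'v \<Rightarrow> 'v" where
  "pact sc f p v = (\<Sum>i\<le>degree p. sc (coeff p i) ((f ^^ i) v))"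

text \<open>Linearity is required on the whole type, not only on the representation space. Operators
  coming from a representation on \<open>V\<close> are later extended by a linear projection onto
  \<open>V\<close>.\<close>

definition linear_op :: "(complex \<Rightarrow> 'v \<Rightarrow> 'v::ab_group_add) \<Rightarrow> ('v \<Rightarrow> 'v) \<Rightarrow> bool" where
  "linear_op sc f \<longleftrightarrow> (\<forall>v w. f (v + w) = f v + f w) \<and> (\<forall>c v. f (sc c v) = sc c (f v))"

locale cvs = vector_space sc for sc :: "complex \<Rightarrow> 'v::ab_group_add \<Rightarrow> 'v"  (infixr "\<cdot>" 75)
begin

lemma linear_opD:
  assumes "linear_op sc f"
  shows "f (v + w) = f v + f w" "f (c \<cdot> v) = c \<cdot> f v" "f 0 = 0" "f (- v) = - f v" "f (v - w) = f v - f w"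
    "f (sum g S) = (\<Sum>i\<in>S. f (g i))"
proof -
  show add: "f (v + w) = f v + f w" and scl: "f (c \<cdot> v) = c \<cdot> f v" for v w c
    using assms by (auto simp: linear_op_def)
  show z: "f 0 = 0" using scl[of 0 0] by simp
  show m: "f (- v) = - f v" for v using scl[of "-1" v] by simp
  show "f (v - w) = f v - f w" using add[of v "-w"] m[of w] by simp
  show "f (sum g S) = (\<Sum>i\<in>S. f (g i))"
    by (induction S rule: infinite_finite_induct) (auto simp: z add)
qed

lemma pact_bound:
  assumes "degree p \<le> n"
  shows "pact sc f p v = (\<Sum>i\<le>n. coeff p i \<cdot> (f ^^ i) v)"
  unfolding pact_def
  by (rule sum.mono_neutral_left) (use assms in \<open>auto simp: coeff_eq_0\<close>)

lemma pact_0 [simp]: "pact sc f 0 v = 0"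
  by (simp add: pact_def)

lemma pact_add: "pact sc f (p + r) v = pact sc f p v + pact sc f r v"
proof -
  define n where "n = max (degree p) (degree r)"
  have "degree (p + r) \<le> n" "degree p \<le> n" "degree r \<le> n"
    by (auto simp: n_def degree_add_le_max)
  then show ?thesis by (simp add: pact_bound[of _ n] scale_left_distrib sum.distrib)
qed

lemma pact_smult: "pact sc f (smult c p) v = c \<cdot> pact sc f p v"
  by (simp add: pact_bound[of "smult c p" "degree p"] pact_bound[of p "degree p"] scale_sum_right degree_smult_le)

lemma pact_diff: "pact sc f (p - r) v = pact sc f p v - pact sc f r v"
  using pact_add[of f p "smult (-1) r" v] pact_smult[of f "-1" r v] by simp

lemma pact_sum: "pact sc f (sum p S) v = (\<Sum>i\<in>S. pact sc f (p i) v)"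
  by (induction S rule: infinite_finite_induct) (auto simp: pact_add)

lemma pact_pCons_0: "pact sc f (pCons 0 p) v = pact sc f p (f v)"
  by (simp add: pact_bound[of "pCons 0 p" "Suc (degree p)"] degree_pCons_le pact_def
      sum.atMost_Suc_shift funpow_swap1 del: sum.atMost_Suc)

lemma pact_const [simp]: "pact sc f [:c:] v = c \<cdot> v"
  by (simp add: pact_def)

lemma pact_linear:
  assumes f: "linear_op sc f"
  shows "linear_op sc (pact sc f p)"
proof -
  have "linear_op sc (f ^^ i)" for i
    using f by (induction i) (auto simp: linear_op_def)
  note h = linear_opD[OF this]
  show ?thesis
    unfolding linear_op_def pact_def by (auto simp: h scale_right_distrib sum.distrib scale_sum_right mult.commute)
qed

lemma pact_commute:
  assumes f: "linear_op sc f"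
  shows "pact sc f p (f v) = f (pact sc f p v)"
  unfolding pact_def using f by (simp add: linear_opD funpow_swap1)

lemma pact_pCons_0': "linear_op sc f \<Longrightarrow> pact sc f (pCons 0 p) v = f (pact sc f p v)"
  by (simp add: pact_pCons_0 pact_commute)

lemma pact_mult:
  assumes f: "linear_op sc f"
  shows "pact sc f (p * r) v = pact sc f p (pact sc f r v)"
proof (induction p arbitrary: v)
  case 0
  then show ?case by simp
next
  case (pCons a p)
  have "pact sc f (pCons a p) w = a \<cdot> w + pact sc f p (f w)" for w
    using pact_add[of f "[:a:]" "pCons 0 p" w] by (simp add: pact_pCons_0)
  then show ?case
    by (simp add: pact_add pact_smult pact_pCons_0 pCons pact_commute[OF f])
qed

lemma pact_in:
  assumes "subspace U" "\<And>u. u \<in> U \<Longrightarrow> f u \<in> U" "v \<in> U"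
  shows "pact sc f p v \<in> U"
proof -
  have "(f ^^ i) v \<in> U" for i
    by (induction i) (auto simp: assms)
  then show ?thesis unfolding pact_def
    by (intro subspace_sum subspace_scale assms)
qed

text \<open>Indexed by naturals so that repetitions count as dependences: a repetition gives the
  difference of two unit coefficient vectors, and otherwise card S + 1 distinct vectors lie in the
  span of \<open>S\<close>.\<close>

lemma finite_dim_dependence:
  fixes w :: "nat \<Rightarrow> 'v"
  assumes S: "finite S" and w: "\<And>i. w i \<in> span S"
  shows "\<exists>c. (\<exists>i\<le>card S. c i \<noteq> 0) \<and> (\<Sum>i\<le>card S. c i \<cdot> w i) = 0"
proof (cases "inj_on w {..card S}")
  case False
  then obtain i j where ij: "i \<le> card S" "j \<le> card S" "i \<noteq> j" "w i = w j"
    by (auto simp: inj_on_def)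
  define c where "c = (\<lambda>k. if k = i then 1 else if k = j then - 1 else (0::complex))"
  have "(\<Sum>k\<le>card S. c k \<cdot> w k) = (\<Sum>k\<in>{i,j}. c k \<cdot> w k)"
    by (rule sum.mono_neutral_right) (use ij in \<open>auto simp: c_def\<close>)
  also have "\<dots> = 0" using ij by (simp add: c_def)
  finally show ?thesis using ij by (intro exI[of _ c]) (auto simp: c_def)
next
  case True
  let ?W = "w ` {..card S}"
  have "card ?W = Suc (card S)" using card_image[OF True] by simp
  then have "dependent ?W"
    using independent_span_bound[OF S, of ?W] w by fastforce
  then obtain u where u: "\<exists>v\<in>?W. u v \<noteq> 0" "(\<Sum>v\<in>?W. u v \<cdot> v) = 0"
    by (subst (asm) dependent_finite) auto
  have "(\<Sum>i\<le>card S. u (w i) \<cdot> w i) = 0"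
    using u(2) by (subst (asm) sum.reindex[OF True]) simp
  then show ?thesis using u(1) by (intro exI[of _ "\<lambda>i. u (w i)"]) auto
qed

lemma annihilating_poly:
  assumes S: "finite S" and U: "subspace U" "U \<subseteq> span S" and f: "\<And>u. u \<in> U \<Longrightarrow> f u \<in> U" and v: "v \<in> U"
  shows "\<exists>p. p \<noteq> 0 \<and> pact sc f p v = 0"
proof -
  have "(f ^^ i) v \<in> U" for i
    by (induction i) (auto simp: v f)
  then obtain c where c: "\<exists>i\<le>card S. c i \<noteq> 0" "(\<Sum>i\<le>card S. c i \<cdot> (f ^^ i) v) = 0"
    using finite_dim_dependence[OF S, of "\<lambda>i. (f ^^ i) v"] U by blast
  define p where "p = (\<Sum>i\<le>card S. monom (c i) i)"
  have cf: "coeff p i = (if i \<le> card S then c i else 0)" for i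
    by (auto simp: p_def coeff_sum sum.delta)
  have "degree p \<le> card S"
    by (rule degree_le) (simp add: cf)
  then have "pact sc f p v = 0"
    using c(2) by (simp add: pact_bound[of _ "card S"] cf)
  moreover have "p \<noteq> 0" using c(1) cf by (metis coeff_0)
  ultimately show ?thesis by blast
qed

text \<open>Over the complex numbers a linear factor with root z splits off: either f v = z v, or f
  v - z v is a nonzero vector annihilated by the quotient, which has smaller degree.\<close>

lemma eigenvector_of_poly:
  assumes f: "linear_op sc f" and U: "subspace U" and fU: "\<And>u. u \<in> U \<Longrightarrow> f u \<in> U"
    and "v \<in> U" "v \<noteq> 0" "p \<noteq> 0" "pact sc f p v = 0"
  shows "\<exists>w\<in>U. w \<noteq> 0 \<and> (\<exists>c. f w = c \<cdot> w)"
  using assms(4-)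
proof (induction "degree p" arbitrary: p v)
  case 0
  then obtain c where "p = [:c:]" by (metis degree_eq_zeroE)
  with 0 show ?case by simp
next
  case (Suc n)
  then have "\<not> constant (poly p)" by (simp add: constant_degree)
  then obtain z where "poly p z = 0" using fundamental_theorem_of_algebra by blast
  then obtain r where r: "p = [:- z, 1:] * r" by (metis dvdE poly_eq_0_iff_dvd)
  then have r0: "r \<noteq> 0" and dr: "n = degree r"
    using Suc.hyps(2) Suc.prems(3) degree_mult_eq[of "[:- z, 1:]" r] by (auto simp del: mult_pCons_left)
  have "p = pCons 0 r - smult z r" using r by (simp add: algebra_simps)
  then have "pact sc f p v = pact sc f r (f v) - z \<cdot> pact sc f r v"
    by (simp add: pact_diff pact_pCons_0 pact_smult)
  also have "\<dots> = pact sc f r (f v - z \<cdot> v)"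
    by (simp add: linear_opD[OF pact_linear[OF f]])
  finally have *: "pact sc f r (f v - z \<cdot> v) = 0" using Suc by simp
  show ?case
  proof (cases "f v - z \<cdot> v = 0")
    case True
    then show ?thesis using Suc by (auto intro!: bexI[of _ v])
  next
    case False
    show ?thesis
      using Suc.hyps(1)[OF dr _ False r0 *] U fU \<open>v \<in> U\<close> by (auto simp: subspace_diff subspace_scale)
  qed
qed

lemma eigenvector_exists:
  assumes "finite S" "subspace U" "U \<subseteq> span S" "U \<noteq> {0}"
    and "linear_op sc f" "\<And>u. u \<in> U \<Longrightarrow> f u \<in> U"
  shows "\<exists>w\<in>U. w \<noteq> 0 \<and> (\<exists>c. f w = c \<cdot> w)"
proof -
  obtain v where "v \<in> U" "v \<noteq> 0" using assms subspace_0 by blast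
  moreover obtain p where "p \<noteq> 0" "pact sc f p v = 0"
    using annihilating_poly[of S U f v] assms \<open>v \<in> U\<close> by blast
  ultimately show ?thesis using eigenvector_of_poly[of f U v p] assms by blast
qed

text \<open>Applying \<open>A\<close> minus its j-th eigenvalue, or \<open>C\<close> minus its own,
  removes the j-th term and multiplies each other coefficient by a difference of eigenvalues. For
  every other index at least one of the two differences is nonzero.\<close>

lemma joint_eigenvectors_independent:
  assumes A: "linear_op sc A" and C: "linear_op sc C"
    and I: "finite I"
    and ev: "\<And>i. i \<in> I \<Longrightarrow> A (f i) = \<alpha> i \<cdot> f i" "\<And>i. i \<in> I \<Longrightarrow> C (f i) = \<gamma> i \<cdot> f i" "\<And>i. i \<in> I \<Longrightarrow> f i \<noteq> 0"
    and inj: "inj_on (\<lambda>i. (\<alpha> i, \<gamma> i)) I"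
    and "(\<Sum>i\<in>I. c i \<cdot> f i) = 0" "i \<in> I"
  shows "c i = 0"
  using I ev inj assms(8-)
proof (induction I arbitrary: c i rule: finite_induct)
  case empty
  then show ?case by simp
next
  case (insert j I)
  have ne: "\<alpha> i \<noteq> \<alpha> j \<or> \<gamma> i \<noteq> \<gamma> j" if "i \<in> I" for i
    using insert.prems(4) insert.hyps(2) that by (auto simp: inj_on_def)
  have s0: "c j \<cdot> f j + (\<Sum>i\<in>I. c i \<cdot> f i) = 0" using insert by simp
  have s1: "A (c j \<cdot> f j + (\<Sum>i\<in>I. c i \<cdot> f i)) - \<alpha> j \<cdot> (c j \<cdot> f j + (\<Sum>i\<in>I. c i \<cdot> f i)) = 0"
    "C (c j \<cdot> f j + (\<Sum>i\<in>I. c i \<cdot> f i)) - \<gamma> j \<cdot> (c j \<cdot> f j + (\<Sum>i\<in>I. c i \<cdot> f i)) = 0"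
    unfolding s0 by (simp_all add: linear_opD[OF A] linear_opD[OF C])
  have sA: "(\<Sum>i\<in>I. (c i * (\<alpha> i - \<alpha> j)) \<cdot> f i) = 0"
    using s1(1) insert.prems(1)
    by (simp add: linear_opD[OF A] scale_right_distrib scale_sum_right algebra_simps sum_subtractf)
  have sC: "(\<Sum>i\<in>I. (c i * (\<gamma> i - \<gamma> j)) \<cdot> f i) = 0"
    using s1(2) insert.prems(2)
    by (simp add: linear_opD[OF C] scale_right_distrib scale_sum_right algebra_simps sum_subtractf)
  have inj: "inj_on (\<lambda>i. (\<alpha> i, \<gamma> i)) I" using insert.prems(4) by (simp add: inj_on_def)
  have "c i = 0" if i: "i \<in> I" for i
  proof -
    have "c i * (\<alpha> i - \<alpha> j) = 0" "c i * (\<gamma> i - \<gamma> j) = 0"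
      using insert.IH[OF _ _ _ inj sA i] insert.IH[OF _ _ _ inj sC i] insert.prems by auto
    with ne[OF i] show ?thesis by auto
  qed
  moreover from this have "c j = 0" using s0 insert.prems(3)[of j] by simp
  ultimately show ?case using insert.prems by auto
qed

lemma finitely_many_eigenvalues:
  assumes S: "finite S" and A: "linear_op sc A"
    and ev: "\<And>i::nat. w i \<in> span S" "\<And>i. w i \<noteq> 0" "\<And>i. A (w i) = \<alpha> i \<cdot> w i" and inj: "inj \<alpha>"
  shows False
proof -
  obtain c where c': "\<exists>i\<le>card S. c i \<noteq> 0" "(\<Sum>i\<le>card S. c i \<cdot> w i) = 0"
    using finite_dim_dependence[of S w, OF S ev(1)] by metis
  then obtain i where c: "i \<le> card S" "c i \<noteq> 0" by metis
  have "c i = 0"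
    by (rule joint_eigenvectors_independent[OF A A, where I = "{..card S}" and f = w and \<alpha> = \<alpha> and \<gamma> = \<alpha>])
      (use c c' ev inj in \<open>auto simp: inj_on_def\<close>)
  with c show False by simp
qed

end

section \<open>Representations of the subalgebra of type so3\<close>

text \<open>
  \<open>wt q (q\<^sup>m)\<close> is $\mathrm{i}[m]$, and \<open>wt q (\<iota> q\<^sup>m)\<close> with $\iota^2=-1$ is $(\mathrm{i}\iota)\,[m]_+$.
  The label \<open>x\<close> of a weight is determined up to $x \mapsto -1/x$.
\<close>

definition wt :: "complex \<Rightarrow> complex \<Rightarrow> complex" where
  "wt q x = \<i> * (x - 1 / x) / (q - 1 / q)"

text \<open>At q^m this is the numerator of [m]_+; at \<iota> q^m with \<iota>^2 = -1 it is \<iota>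
  (q - 1/q) [m] instead. By \<open>wt_diff\<close> its zeros are the labels whose two neighbours
  share a weight.\<close>

definition up :: "complex \<Rightarrow> complex" where
  "up x = x + 1 / x"

section \<open>Weights and labels when q is not a root of unity\<close>

locale generic_q =
  fixes q :: complex
  assumes q_nonzero: "q \<noteq> 0" and not_root: "\<And>n::nat. n > 0 \<Longrightarrow> q ^ n \<noteq> 1"
begin

lemma q_powi_eq_1: "q powi k = 1 \<longleftrightarrow> k = 0"
proof
  assume h: "q powi k = 1"
  show "k = 0"
  proof (rule ccontr)
    assume "k \<noteq> 0"
    then have "nat \<bar>k\<bar> > 0" by simp
    moreover have "q ^ nat \<bar>k\<bar> = 1"
    proof (cases "k \<ge> 0")
      case True
      then have "q powi k = q ^ nat \<bar>k\<bar>" by (simp add: power_int_def)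
      with h show ?thesis by simp
    next
      case False
      then have "q powi k = inverse q ^ nat \<bar>k\<bar>" by (simp add: power_int_def)
      with h show ?thesis by (simp add: power_inverse)
    qed
    ultimately show False using not_root by blast
  qed
qed simp

lemma q_powi_neq_m1: "q powi k \<noteq> - 1"
proof
  assume h: "q powi k = - 1"
  then have "q powi (k * 2) = 1"
    by (simp add: power_int_mult)
  then have "k = 0" by (simp add: q_powi_eq_1)
  with h show False by simp
qed

lemma q_powi_inj: "q powi k = q powi l \<longleftrightarrow> k = l"
proof
  assume h: "q powi k = q powi l"
  have "q powi (k - l) = q powi k / q powi l"
    by (rule power_int_diff) (use q_nonzero in auto)
  also have "\<dots> = 1" unfolding h using q_nonzero by simp
  finally show "k = l" unfolding q_powi_eq_1 by simp
qed simp

lemma q_powi_neq_minus: "q powi k \<noteq> - (q powi l)"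
proof
  assume h: "q powi k = - (q powi l)"
  have nz: "q powi l \<noteq> 0" using q_nonzero by (simp add: power_int_not_zero)
  have "q powi (k - l) = q powi k / q powi l"
    by (rule power_int_diff) (use q_nonzero in auto)
  also have "\<dots> = - 1" unfolding h using nz by (metis divide_minus_left divide_self)
  finally show False using q_powi_neq_m1 by blast
qed

lemma q_sq_neq_1: "q * q \<noteq> 1"
  using not_root[OF pos2] unfolding power2_eq_square .

lemma q_sq_neq_m1: "q * q \<noteq> -1"
proof -
  have "q * q = q powi 2" by (simp add: power2_eq_square)
  then show ?thesis using q_powi_neq_m1 by metis
qed

lemma theta_nonzero: "q - 1 / q \<noteq> 0"
proof
  assume "q - 1 / q = 0"
  then have "q * q = 1" using q_nonzero by (simp add: field_simps)
  with q_sq_neq_1 show False by blast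
qed

lemma wt_eq_iff:
  assumes "x \<noteq> 0" "y \<noteq> 0"
  shows "wt q x = wt q y \<longleftrightarrow> x = y \<or> x * y = - 1"
proof -
  have "wt q x = wt q y \<longleftrightarrow> x - 1 / x = y - 1 / y"
  proof -
    define h where "h = q - 1 / q"
    have "h \<noteq> 0" using theta_nonzero unfolding h_def .
    then show ?thesis unfolding wt_def h_def[symmetric] by simp
  qed
  also have "\<dots> \<longleftrightarrow> (x - 1 / x) - (y - 1 / y) = 0" by simp
  also have "(x - 1 / x) - (y - 1 / y) = (x - y) * (x * y + 1) / (x * y)"
    using assms by (simp add: divide_simps) (simp add: algebra_simps)
  also have "\<dots> = 0 \<longleftrightarrow> (x - y) * (x * y + 1) = 0"
    using assms by simp
  finally show ?thesis by (auto simp: eq_neg_iff_add_eq_0)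
qed

lemma wt_minus_inverse: "wt q (- 1 / x) = wt q x"
proof -
  have "- 1 / x - 1 / (- 1 / x) = x - 1 / x" by (simp add: divide_inverse)
  then show ?thesis by (simp only: wt_def)
qed

text \<open>Together with \<open>wt_mult\<close> this says that the weights of \<open>q * x\<close>
  and \<open>x / q\<close> are the roots of T^2 - (q + 1/q) w T + w^2 + 1, where w is the weight of
  \<open>x\<close>. The relation \<open>rel_BA\<close> on an eigenvector of \<open>A\<close>
  produces exactly this quadratic, see \<open>A_on_Bv\<close>.\<close>

lemma wt_add: 
  assumes x: "x \<noteq> 0"
  shows "wt q (q * x) + wt q (x / q) = (q + 1 / q) * wt q x"
proof -
  have "(q * x - 1 / (q * x)) + (x / q - 1 / (x / q)) = (q + 1 / q) * (x - 1 / x)"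
    using x q_nonzero by (simp add: field_simps)
  moreover have "wt q (q * x) + wt q (x / q) = \<i> * ((q * x - 1 / (q * x)) + (x / q - 1 / (x / q))) / (q - 1 / q)"
    by (simp only: wt_def add_divide_distrib distrib_left)
  ultimately show ?thesis by (simp only: wt_def) (simp only: mult_ac times_divide_eq_right)
qed

lemma wt_mult: "x \<noteq> 0 \<Longrightarrow> wt q (q * x) * wt q (x / q) = wt q x ^ 2 + 1"
proof -
  assume x: "x \<noteq> 0"
  define t where "t = q - 1 / q"
  have t: "t \<noteq> 0" using theta_nonzero unfolding t_def .
  have prod: "wt q a * wt q b = - ((a - 1 / a) * (b - 1 / b)) / t ^ 2" for a b
  proof -
    have "wt q a * wt q b = (\<i> * \<i>) * ((a - 1 / a) * (b - 1 / b)) / (t * t)"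
      unfolding wt_def t_def[symmetric] by (simp only: times_divide_times_eq mult_ac)
    then show ?thesis unfolding power2_eq_square by simp
  qed
  have "wt q x ^ 2 + 1 = (t ^ 2 - (x - 1 / x) ^ 2) / t ^ 2"
    unfolding power2_eq_square[of "wt q x"] prod using t
    by (simp add: diff_divide_distrib power2_eq_square)
  also have "t ^ 2 - (x - 1 / x) ^ 2 = - ((q * x - 1 / (q * x)) * (x / q - 1 / (x / q)))"
    using x q_nonzero by (simp add: t_def power2_eq_square field_simps)
  finally show ?thesis unfolding prod by simp
qed

lemma wt_diff:
  assumes x: "x \<noteq> 0"
  shows "wt q (q * x) - wt q (x / q) = \<i> * up x"
proof -
  have "(q * x - 1 / (q * x)) - (x / q - 1 / (x / q)) = (q - 1 / q) * up x"
    using x q_nonzero by (simp add: up_def field_simps)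
  moreover have "wt q (q * x) - wt q (x / q) = \<i> * ((q * x - 1 / (q * x)) - (x / q - 1 / (x / q))) / (q - 1 / q)"
    by (simp only: wt_def diff_divide_distrib right_diff_distrib)
  ultimately have "wt q (q * x) - wt q (x / q) = (q - 1 / q) * (\<i> * up x) / (q - 1 / q)"
    by (simp only: mult.left_commute[of \<i>])
  then show ?thesis by (simp only: nonzero_mult_div_cancel_left[OF theta_nonzero])
qed

text \<open>x - 1/x = t is the quadratic x^2 - t x - 1 = 0, whose roots have product -1 and so are
  nonzero. Thus every eigenvalue can be labelled.\<close>

lemma wt_inj_exists: "\<exists>x. x \<noteq> 0 \<and> wt q x = c"
proof -
  define h where "h = q - 1 / q"
  have h: "h \<noteq> 0" using theta_nonzero unfolding h_def .
  define t where "t = - \<i> * c * h"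
  obtain r where r: "r ^ 2 = t ^ 2 + 4" by (metis power2_csqrt)
  define x where "x = (t + r) / 2"
  have xx: "x * x = t * x + 1"
    using r by (simp add: x_def power2_eq_square field_simps)
  then have x0: "x \<noteq> 0" by auto
  then have "x - 1 / x = (x * x - 1) / x" by (simp add: diff_divide_distrib)
  also have "\<dots> = t" unfolding xx using x0 by simp
  finally have "x - 1 / x = t" .
  then have "wt q x = \<i> * t / h" by (simp only: wt_def h_def)
  also have "\<dots> = c" using h by (simp add: t_def)
  finally have "wt q x = c" .
  with x0 show ?thesis by blast
qed

end

section \<open>Eigenvectors of one generator of an so3 pair\<close>

locale so3_pair = cvs sc + generic_q q
  for sc :: "complex \<Rightarrow> 'v::ab_group_add \<Rightarrow> 'v"  (infixr "\<cdot>" 75) and q +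
  fixes A B :: "'v \<Rightarrow> 'v"
  assumes lin_A: "linear_op sc A" and lin_B: "linear_op sc B"
    and rel_AB: "A (B (B v)) - (q + 1 / q) \<cdot> B (A (B v)) + B (B (A v)) = - A v"
    and rel_BA: "B (A (A v)) - (q + 1 / q) \<cdot> A (B (A v)) + A (A (B v)) = - B v"
begin

lemma swap: "so3_pair sc q B A"
  by unfold_locales (fact lin_B lin_A rel_AB rel_BA)+

lemmas A_simps = linear_opD[OF lin_A]
lemmas B_simps = linear_opD[OF lin_B]

lemma A_on_Bv:
  assumes x: "x \<noteq> 0" and v: "A v = wt q x \<cdot> v"
  shows "A (A (B v)) - (wt q (q * x) + wt q (x / q)) \<cdot> A (B v) + (wt q (q * x) * wt q (x / q)) \<cdot> B v = 0"
proof -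
  have "A (A (B v)) = - B v - B (A (A v)) + (q + 1 / q) \<cdot> A (B (A v))"
    using rel_BA[of v] by (simp add: algebra_simps)
  then show ?thesis
    unfolding wt_add[OF x] wt_mult[OF x]
    by (simp add: v A_simps B_simps scale_left_distrib power2_eq_square)
qed

text \<open>Otherwise every label x q^r would carry an eigenvector. Two of these weights agree only
  if the labels agree or have product -1, and the latter happens for at most one value of r + r'.
  Beyond it the weights are pairwise distinct, which finite dimension forbids.\<close>

lemma climb:
  assumes S: "finite S" and V: "V \<subseteq> span S" and x: "x \<noteq> 0" and v: "v \<in> V" "v \<noteq> 0" "A v = wt q x \<cdot> v"
  obtains r v' where "v' \<in> V" "v' \<noteq> 0" "A v' = wt q (x * q ^ r) \<cdot> v'"
    "\<And>u. u \<in> V \<Longrightarrow> A u = wt q (q * (x * q ^ r)) \<cdot> u \<Longrightarrow> u = 0"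
proof (rule ccontr)
  assume neg: "\<not> thesis"
  have "\<exists>w. w \<in> V \<and> w \<noteq> 0 \<and> A w = wt q (x * q ^ r) \<cdot> w" for r
  proof (induction r)
    case 0
    then show ?case using v by auto
  next
    case (Suc r)
    then obtain w where "w \<in> V" "w \<noteq> 0" "A w = wt q (x * q ^ r) \<cdot> w" by blast
    with neg that[of w r] obtain u where "u \<in> V" "u \<noteq> 0" "A u = wt q (q * (x * q ^ r)) \<cdot> u" by blast
    then show ?case by (auto simp: mult_ac)
  qed
  then obtain w where w: "\<And>r. w r \<in> V \<and> w r \<noteq> 0 \<and> A (w r) = wt q (x * q ^ r) \<cdot> w r" by metis
  have "\<exists>R. \<forall>r\<ge>R. \<forall>r'\<ge>R. x * q ^ r * (x * q ^ r') \<noteq> - 1"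
  proof (cases "\<exists>K. x ^ 2 * q ^ K = - 1")
    case False
    then have "x ^ 2 * q ^ (r + r') \<noteq> - 1" for r r' by blast
    then show ?thesis by (intro exI[of _ 0]) (simp add: power_add power2_eq_square mult_ac)
  next
    case True
    then obtain K where K: "x ^ 2 * q ^ K = - 1" by blast
    have "x * q ^ r * (x * q ^ r') \<noteq> - 1" if "r \<ge> Suc K" for r r'
    proof
      assume "x * q ^ r * (x * q ^ r') = - 1"
      then have "x ^ 2 * q ^ (r + r') = x ^ 2 * q ^ K"
        using K by (simp add: power_add power2_eq_square mult_ac)
      moreover have "q ^ (r + r') = q ^ K * q ^ (r + r' - K)" using that by (simp flip: power_add)
      ultimately have "q ^ (r + r' - K) = 1" using x q_nonzero by simp
      with not_root[of "r + r' - K"] that show False by simp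
    qed
    then show ?thesis by blast
  qed
  then obtain R where R: "\<And>r r'. r \<ge> R \<Longrightarrow> r' \<ge> R \<Longrightarrow> x * q ^ r * (x * q ^ r') \<noteq> - 1" by blast
  have "inj (\<lambda>i. wt q (x * q ^ (R + i)))"
  proof (rule injI)
    fix i j assume "wt q (x * q ^ (R + i)) = wt q (x * q ^ (R + j))"
    then have "q ^ (R + i) = q ^ (R + j)"
      using R[of "R + i" "R + j"] x q_nonzero by (subst (asm) wt_eq_iff) auto
    then have "q powi (int (R + i)) = q powi (int (R + j))" by (simp only: power_int_of_nat)
    then show "i = j" unfolding q_powi_inj by simp
  qed
  then show False
    using finitely_many_eigenvalues[OF S lin_A, of "\<lambda>i. w (R + i)" "\<lambda>i. wt q (x * q ^ (R + i))"] w V by blast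
qed

text \<open>By \<open>A_on_Bv\<close> the difference of the two sides satisfies the eigenvector
  equation for the label q x, hence it is zero. Nothing is divided by the difference of the
  neighbouring weights, so labels where they coincide are covered.\<close>

lemma top_component:
  assumes V: "subspace V" "\<And>u. u \<in> V \<Longrightarrow> A u \<in> V" "\<And>u. u \<in> V \<Longrightarrow> B u \<in> V"
    and x: "x \<noteq> 0" and v: "v \<in> V" "A v = wt q x \<cdot> v"
    and top: "\<And>u. u \<in> V \<Longrightarrow> A u = wt q (q * x) \<cdot> u \<Longrightarrow> u = 0"
  shows "A (B v) = wt q (x / q) \<cdot> B v"
proof -
  have "A (B v) - wt q (x / q) \<cdot> B v = 0"
  proof (rule top)
    show "A (B v) - wt q (x / q) \<cdot> B v \<in> V" using V v by (simp add: subspace_diff subspace_scale)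
    show "A (A (B v) - wt q (x / q) \<cdot> B v) = wt q (q * x) \<cdot> (A (B v) - wt q (x / q) \<cdot> B v)"
      using A_on_Bv[OF x v(2)] by (simp add: A_simps algebra_simps)
  qed
  then show ?thesis by simp
qed

text \<open>For a top vector v, A (B^m v) is a polynomial in \<open>B\<close> applied to v, and
  \<open>tp x m\<close> is that polynomial. The recursion is \<open>rel_AB\<close> applied to B^m v,
  see \<open>A_on_powers\<close>.\<close>

fun tp :: "complex \<Rightarrow> nat \<Rightarrow> complex poly" where
  "tp x 0 = [:wt q x:]"
| "tp x (Suc 0) = [:0, wt q (x / q):]"
| "tp x (Suc (Suc m)) = pCons 0 (smult (q + 1 / q) (tp x (Suc m))) - pCons 0 (pCons 0 (tp x m)) - tp x m"

lemma coeff_tp_Suc_Suc: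
  "coeff (tp x (Suc (Suc m))) i =
    (if i = 0 then 0 else (q + 1 / q) * coeff (tp x (Suc m)) (i - 1))
    - (if i < 2 then 0 else coeff (tp x m) (i - 2)) - coeff (tp x m) i"
  by (cases i; cases "i - 1") (auto simp: numeral_2_eq_2)

declare tp.simps(3) [simp del]

lemma coeff_tp_0: "m < i \<or> odd (m + i) \<Longrightarrow> coeff (tp x m) i = 0"
proof (induction m arbitrary: i rule: induct_nat_012)
  case 0
  then show ?case by (cases i) auto
next
  case 1
  then show ?case by (cases i; cases "i - 1") auto
next
  case (ge2 m)
  have "coeff (tp x m) i = 0" by (rule ge2.IH(1)) (use ge2.prems in auto)
  moreover have "coeff (tp x (Suc m)) (i - 1) = 0" if "i \<noteq> 0" 
    by (rule ge2.IH(2)) (use ge2.prems that in \<open>cases i; auto\<close>)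
  moreover have "coeff (tp x m) (i - 2) = 0" if "\<not> i < 2"
    by (rule ge2.IH(1)) (use ge2.prems that in auto)
  ultimately show ?case by (cases "i = 1") (simp_all add: coeff_tp_Suc_Suc)
qed

lemma coeff_tp_lead:
  assumes "x \<noteq> 0"
  shows "coeff (tp x m) m = wt q (x / q ^ m)"
proof (induction m rule: induct_nat_012)
  case (ge2 m)
  have shift: "q * (x / q ^ Suc m) = x / q ^ m" "x / q ^ Suc m / q = x / q ^ Suc (Suc m)"
    using q_nonzero by simp_all
  have "wt q (x / q ^ m) + wt q (x / q ^ Suc (Suc m)) = (q + 1 / q) * wt q (x / q ^ Suc m)"
    using wt_add[of "x / q ^ Suc m"] assms q_nonzero unfolding shift by simp
  from this[symmetric] show ?case
    by (simp add: coeff_tp_Suc_Suc coeff_tp_0 ge2 del: power_Suc)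
qed simp_all

text \<open>
  The coefficient of $X^{m-2}$ in \<open>tp x m\<close>.
\<close>

definition av :: "complex \<Rightarrow> nat \<Rightarrow> complex" where
  "av x m = - \<i> / (q - 1 / q) ^ 2 * ((q ^ m - 1 / q ^ m) / (q - 1 / q) * up x - of_nat m * up (x * q / q ^ m))"

text \<open>The inhomogeneous term wt (x / q^m) solves the homogeneous recurrence itself, by
  \<open>wt_add\<close>. This resonance is the origin of the factor m in \<open>av\<close>.\<close>

lemma av_rec:
  assumes "x \<noteq> 0"
  shows "(q + 1 / q) * av x (Suc m) - av x m - wt q (x / q ^ m) = av x (Suc (Suc m))"
proof -
  define t where "t = q - 1 / q"
  have t: "t \<noteq> 0" using theta_nonzero by (simp add: t_def)
  define a where "a = q ^ m"
  have a: "a \<noteq> 0" using q_nonzero by (simp add: a_def)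
  define n where "n = (of_nat m :: complex)"
  have w: "wt q (x / a) = - \<i> / t ^ 2 * (- t * (x / a - a / x))"
    using t by (simp add: wt_def power2_eq_square flip: t_def)
  have e: "av x (Suc m) = - \<i> / t ^ 2 * ((q * a - 1 / (q * a)) / t * up x - (n + 1) * up (x / a))"
    "av x m = - \<i> / t ^ 2 * ((a - 1 / a) / t * up x - n * up (x * q / a))"
    "av x (Suc (Suc m)) = - \<i> / t ^ 2 * ((q * q * a - 1 / (q * q * a)) / t * up x - (n + 2) * up (x / (q * a)))"
    using q_nonzero by (simp_all add: av_def n_def a_def algebra_simps flip: t_def)
  have lin: "(q + 1 / q) * (c * e1) - c * e2 - c * e3 = c * e4"
    if "(q + 1 / q) * e1 - e2 - e3 = e4" for c e1 e2 e3 e4 :: complex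
  proof -
    have "(q + 1 / q) * (c * e1) - c * e2 - c * e3 = c * ((q + 1 / q) * e1 - e2 - e3)"
      by (simp only: right_diff_distrib mult.left_commute)
    then show ?thesis unfolding that .
  qed
  \<comment> \<open>The part proportional to \<open>up x\<close> and the part carrying m satisfy
    separate identities.\<close>
  have i1: "(q + 1 / q) * (q * a - 1 / (q * a)) - (a - 1 / a) = q * q * a - 1 / (q * q * a)"
    using a q_nonzero by (simp add: field_simps)
  have i2: "(q + 1 / q) * ((n + 1) * up (x / a)) - n * up (x * q / a) - t * (x / a - a / x) = (n + 2) * up (x / (q * a))"
    using a q_nonzero assms by (simp add: up_def t_def field_simps)
  have "(q + 1 / q) * ((q * a - 1 / (q * a)) / t * up x) - (a - 1 / a) / t * up x = (q * q * a - 1 / (q * q * a)) / t * up x"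
    unfolding i1[symmetric] by (simp add: algebra_simps diff_divide_distrib add_divide_distrib)
  then have "(q + 1 / q) * ((q * a - 1 / (q * a)) / t * up x - (n + 1) * up (x / a))
      - ((a - 1 / a) / t * up x - n * up (x * q / a)) - (- t * (x / a - a / x))
      = (q * q * a - 1 / (q * q * a)) / t * up x - (n + 2) * up (x / (q * a))"
    unfolding i2[symmetric] by (simp add: algebra_simps)
  from lin[OF this] show ?thesis
    unfolding e w a_def[symmetric] .
qed

lemma A_on_powers:
  assumes v: "A v = wt q x \<cdot> v" "A (B v) = wt q (x / q) \<cdot> B v"
  shows "A ((B ^^ m) v) = pact sc B (tp x m) v"
proof (induction m rule: induct_nat_012)
  case 0
  then show ?case by (simp add: v)
next
  case 1
  then show ?case by (simp add: v pact_pCons_0)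
next
  case (ge2 m)
  have "A ((B ^^ Suc (Suc m)) v) = (q + 1 / q) \<cdot> B (A ((B ^^ Suc m) v)) - B (B (A ((B ^^ m) v))) - A ((B ^^ m) v)"
    using rel_AB[of "(B ^^ m) v"] by (simp add: algebra_simps)
  also have "\<dots> = pact sc B (tp x (Suc (Suc m))) v"
    unfolding ge2 tp.simps(3) by (simp add: pact_diff pact_pCons_0'[OF lin_B] pact_smult B_simps)
  finally show ?case .
qed

text \<open>This operator on polynomials describes \<open>A\<close> on the space of all p(B) v. It
  is triangular in the monomials, preserves parity, and has the diagonal entries wt (x /
  q^m).\<close>

definition Th :: "complex \<Rightarrow> complex poly \<Rightarrow> complex poly" where
  "Th x p = (\<Sum>m\<le>degree p. smult (coeff p m) (tp x m))"

lemma A_on_pact: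
  assumes v: "A v = wt q x \<cdot> v" "A (B v) = wt q (x / q) \<cdot> B v"
  shows "A (pact sc B p v) = pact sc B (Th x p) v"
  unfolding Th_def pact_sum pact_smult A_on_powers[OF v, symmetric]
  by (simp add: pact_def A_simps)

lemma coeff_Th:
  assumes "degree p \<le> n"
  shows "coeff (Th x p) i = (\<Sum>m\<in>{m. i \<le> m \<and> m \<le> n \<and> even (m + i)}. coeff p m * coeff (tp x m) i)"
proof -
  have "coeff (Th x p) i = (\<Sum>m\<le>degree p. coeff p m * coeff (tp x m) i)"
    by (simp add: Th_def coeff_sum)
  also have "\<dots> = (\<Sum>m\<le>n. coeff p m * coeff (tp x m) i)"
    by (rule sum.mono_neutral_left) (use assms in \<open>auto simp: coeff_eq_0\<close>)
  also have "\<dots> = (\<Sum>m\<in>{m. i \<le> m \<and> m \<le> n \<and> even (m + i)}. coeff p m * coeff (tp x m) i)"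
  proof (rule sum.mono_neutral_right)
    show "\<forall>m\<in>{..n} - {m. i \<le> m \<and> m \<le> n \<and> even (m + i)}. coeff p m * coeff (tp x m) i = 0"
    proof
      fix m assume "m \<in> {..n} - {m. i \<le> m \<and> m \<le> n \<and> even (m + i)}"
      then have "m < i \<or> odd (m + i)" by auto
      then show "coeff p m * coeff (tp x m) i = 0" by (simp only: coeff_tp_0 mult_zero_right)
    qed
  qed auto
  finally show ?thesis .
qed

lemma degree_Th: "degree (Th x p) \<le> degree p"
proof (rule degree_le, intro allI impI)
  fix i assume "degree p < i"
  then have "{m. i \<le> m \<and> m \<le> degree p \<and> even (m + i)} = {}" by auto
  then show "coeff (Th x p) i = 0" by (simp only: coeff_Th[OF order_refl] sum.empty)
qed

lemma coeff_Th_lead: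
  assumes "x \<noteq> 0" "degree p \<le> n"
  shows "coeff (Th x p) n = coeff p n * wt q (x / q ^ n)"
proof -
  have "{m. n \<le> m \<and> m \<le> n \<and> even (m + n)} = {n}" by auto
  then show ?thesis using assms by (simp add: coeff_Th[of p n] coeff_tp_lead)
qed

lemma av_0: "av x 0 = 0" and av_1: "av x (Suc 0) = 0"
  using q_nonzero theta_nonzero by (simp_all add: av_def)

lemma coeff_tp_sub:
  assumes x: "x \<noteq> 0"
  shows "coeff (tp x (Suc (Suc m))) m = av x (Suc (Suc m))"
proof -
  \<comment> \<open>Multiplication by X^2 extends the coefficient of X^(m-2) by zero to m < 2, where
    \<open>av\<close> vanishes as well; so one recursion serves from 0 on.\<close>
  define c where "c m = coeff (pCons 0 (pCons 0 (tp x m))) m" for m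
  have c: "c 0 = 0" "c (Suc 0) = 0" "c (Suc (Suc m)) = coeff (tp x (Suc (Suc m))) m" for m
    by (simp_all add: c_def)
  have "c m = av x m" for m
  proof (induction m rule: induct_nat_012)
    case (ge2 m)
    have "c (Suc (Suc m)) = (q + 1 / q) * c (Suc m) - c m - wt q (x / q ^ m)"
      unfolding c(3) tp.simps(3) by (cases m) (simp_all add: c_def coeff_tp_lead[OF x])
    then show ?case using av_rec[OF x, of m] ge2 by simp
  qed (simp_all add: c av_0 av_1)
  then show ?thesis using c(3) by metis
qed

text \<open>The terms proportional to m cancel, and what remains is an equation for y = x^2 q and b
  = q^(2m) which factors as (b - 1)(y^2 - b) = 0. The first factor is nonzero since \<open>q\<close>
  is not a root of unity. In \<open>top_kernel\<close> this determines the degree of the minimal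
  polynomial.\<close>

lemma av_singular:
  assumes x: "x \<noteq> 0" and m: "m > 0"
    and eq: "av x (Suc m) * up (x * q / q ^ m) = av x m * up (x / q ^ m)"
  shows "(x ^ 2 * q) ^ 2 = (q ^ m) ^ 2"
proof -
  define t where "t = q - 1 / q"
  have t: "t \<noteq> 0" using theta_nonzero unfolding t_def .
  define a where "a = q ^ m"
  have a: "a \<noteq> 0" using q_nonzero by (simp add: a_def)
  define n where "n = (of_nat m :: complex)"
  have e: "av x (Suc m) = - \<i> / t ^ 2 * ((q * a - 1 / (q * a)) / t * up x - (n + 1) * up (x / a))"
    "av x m = - \<i> / t ^ 2 * ((a - 1 / a) / t * up x - n * up (x * q / a))"
    using q_nonzero by (simp_all add: av_def n_def a_def algebra_simps flip: t_def)
  have "- \<i> / t ^ 2 \<noteq> 0" using t by simp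
  moreover have "- \<i> / t ^ 2 * (((q * a - 1 / (q * a)) / t * up x - (n + 1) * up (x / a)) * up (x * q / a))
     = - \<i> / t ^ 2 * (((a - 1 / a) / t * up x - n * up (x * q / a)) * up (x / a))"
    using eq unfolding e a_def[symmetric] mult.assoc .
  ultimately have "((q * a - 1 / (q * a)) / t * up x - (n + 1) * up (x / a)) * up (x * q / a)
     = ((a - 1 / a) / t * up x - n * up (x * q / a)) * up (x / a)"
    by (simp only: mult_cancel_left) simp
  then have "((q * a - 1 / (q * a)) * up (x * q / a) - (a - 1 / a) * up (x / a)) / t * up x = up (x / a) * up (x * q / a)"
    by (simp add: algebra_simps diff_divide_distrib add_divide_distrib)
  moreover have "(q * a - 1 / (q * a)) * up (x * q / a) - (a - 1 / a) * up (x / a) = t * up (x * q)"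
    using x a q_nonzero by (simp add: up_def t_def field_simps)
  ultimately have "up (x * q) * up x = up (x / a) * up (x * q / a)" using t by simp
  moreover have "up (x * q) * up x = x\<^sup>2 * q + 1 / (x\<^sup>2 * q) + (q + 1 / q)"
    using x q_nonzero by (simp add: up_def power2_eq_square field_simps)
  moreover have "up (x / a) * up (x * q / a) = x\<^sup>2 * q / a\<^sup>2 + a\<^sup>2 / (x\<^sup>2 * q) + (q + 1 / q)"
    using x a q_nonzero by (simp add: up_def power2_eq_square field_simps)
  ultimately have E: "x\<^sup>2 * q + 1 / (x\<^sup>2 * q) = x\<^sup>2 * q / a\<^sup>2 + a\<^sup>2 / (x\<^sup>2 * q)" by simp
  define y where "y = x\<^sup>2 * q"
  define b where "b = a\<^sup>2"
  have yb: "y \<noteq> 0" "b \<noteq> 0" using x a q_nonzero by (auto simp: y_def b_def)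
  have "y + 1 / y - y / b - b / y = 0" using E by (simp add: y_def b_def)
  moreover have "y + 1 / y - y / b - b / y = (b - 1) * (y * y - b) / (y * b)"
    using yb by (simp add: field_simps)
  ultimately have "b = 1 \<or> y * y = b" using yb by simp
  moreover have "b \<noteq> 1" using not_root[of "m * 2"] m by (simp add: b_def a_def power_mult)
  ultimately show ?thesis by (simp add: y_def b_def a_def power2_eq_square[of "x\<^sup>2 * q"])
qed

text \<open>Equal weights mean e = e' or x^2 = -q^(e + e'). The latter clashes with parity, because
  x^2 is up to sign an even power of \<open>q\<close>.\<close>

lemma wt_neq_of_parity:
  assumes x: "x \<noteq> 0" and hx: "x ^ 2 = \<sigma> * q powi (2 * N)" "\<sigma> = 1 \<or> \<sigma> = - 1" and odd: "odd (e + e')"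
  shows "wt q (x / q ^ e) \<noteq> wt q (x / q ^ e')"
proof
  assume "wt q (x / q ^ e) = wt q (x / q ^ e')"
  then have "x / q ^ e = x / q ^ e' \<or> x / q ^ e * (x / q ^ e') = - 1"
    by (subst (asm) wt_eq_iff) (use x q_nonzero in auto)
  then show False
  proof
    assume "x / q ^ e = x / q ^ e'"
    then have "q ^ e = q ^ e'" using x q_nonzero by (simp add: frac_eq_eq)
    then have "q powi int e = q powi int e'" by (simp only: power_int_of_nat)
    then have "e = e'" unfolding q_powi_inj by simp
    with odd show False by simp
  next
    assume "x / q ^ e * (x / q ^ e') = - 1"
    then have "x ^ 2 / q ^ (e + e') = - 1" by (simp add: power_add power2_eq_square)
    then have "x ^ 2 = - (q ^ (e + e'))" using q_nonzero by (simp add: divide_eq_eq)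
    then have "\<sigma> * q powi (2 * N) = - (q powi int (e + e'))" unfolding hx power_int_of_nat .
    with hx(2) have "q powi (2 * N) = - (q powi int (e + e')) \<or> q powi (2 * N) = q powi int (e + e')"
      by (elim disjE) simp_all
    then have "2 * N = int (e + e')" using q_powi_neq_minus q_powi_inj by blast
    with odd show False by presburger
  qed
qed

text \<open>Let P be the minimal polynomial of \<open>B\<close> at v, of degree d. Both P and X P
  are eigenvectors of \<open>Th x\<close>, so the coefficient of X^(d-2) in P satisfies two linear
  equations. Their compatibility is the hypothesis of \<open>av_singular\<close> and yields q^(2d) =
  (x^2 q)^2 = q^(4N + 2), so d is odd. As P contains only powers of one parity, P(0) = 0, and P / X
  applied to v is the kernel vector. The sign \<sigma> is -1 in the first application and 1 in the
  one with \<open>A\<close> and \<open>B\<close> exchanged.\<close>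

lemma top_kernel:
  assumes S: "finite S" and V: "subspace V" "V \<subseteq> span S" "\<And>u. u \<in> V \<Longrightarrow> A u \<in> V" "\<And>u. u \<in> V \<Longrightarrow> B u \<in> V"
    and x: "x \<noteq> 0" and hx: "x ^ 2 = \<sigma> * q powi (2 * N)" "\<sigma> = 1 \<or> \<sigma> = - 1"
    and v: "v \<in> V" "v \<noteq> 0" "A v = wt q x \<cdot> v" "A (B v) = wt q (x / q) \<cdot> B v"
  shows "\<exists>M. subspace M \<and> M \<subseteq> V \<and> (\<forall>u\<in>M. A u \<in> M \<and> B u \<in> M) \<and> (\<exists>z\<in>M. z \<noteq> 0 \<and> B z = 0)
    \<and> (\<forall>w\<in>M. \<forall>\<mu>. w \<noteq> 0 \<longrightarrow> A w = \<mu> \<cdot> w \<longrightarrow> (\<exists>e::nat. \<mu> = wt q (x / q ^ e)))"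
proof -
  define ann where "ann p \<longleftrightarrow> p \<noteq> 0 \<and> pact sc B p v = 0" for p
  have ex: "\<exists>d p. degree p = d \<and> ann p"
    using annihilating_poly[OF S V(1,2), of B v] V(4) v(1) by (auto simp: ann_def)
  define d where "d = (LEAST d. \<exists>p. degree p = d \<and> ann p)"
  obtain P where P: "degree P = d" "ann P" using LeastI_ex[OF ex] unfolding d_def by blast
  have Pv: "pact sc B P v = 0" and P0: "P \<noteq> 0" using P by (auto simp: ann_def)
  have min: "Q = 0" if "pact sc B Q v = 0" "degree Q < d" for Q
    using not_less_Least[of "degree Q" "\<lambda>d. \<exists>p. degree p = d \<and> ann p"] that by (auto simp: d_def ann_def)
  define L where "L = coeff P d"
  have L: "L \<noteq> 0" using P0 P(1) by (auto simp: L_def)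
  have uniq: "Q = smult (coeff Q d / L) P" if "pact sc B Q v = 0" "degree Q \<le> d" for Q
  proof -
    let ?R = "Q - smult (coeff Q d / L) P"
    have "pact sc B ?R v = 0" by (simp add: pact_diff pact_smult that Pv)
    moreover have "degree ?R \<le> d"
      by (rule degree_diff_le) (use that P in \<open>auto intro: order_trans[OF degree_smult_le]\<close>)
    moreover have "coeff ?R d = 0" using L by (simp add: L_def)
    then have "degree ?R \<noteq> d \<or> ?R = 0" by (metis leading_coeff_0_iff)
    ultimately have "?R = 0" using min[of ?R] by (auto simp: le_less)
    then show ?thesis by simp
  qed
  have "d \<noteq> 0"
  proof
    assume "d = 0"
    then obtain c where "P = [:c:]" using P(1) by (metis degree_eq_zeroE)
    with Pv v(2) P0 show False by simp
  qed
  then obtain k where k: "d = Suc k" by (cases d) auto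
  have w_ne: "wt q (x / q ^ e) \<noteq> wt q (x / q ^ e')" if "odd (e + e')" for e e'
    by (rule wt_neq_of_parity[OF x hx that])

  have ThP: "Th x P = smult (wt q (x / q ^ d)) P"
  proof -
    have "pact sc B (Th x P) v = 0"
      using A_on_pact[OF v(3,4), of P] by (simp add: Pv A_simps)
    moreover have "degree (Th x P) \<le> d" using degree_Th[of x P] P(1) by simp
    ultimately have "Th x P = smult (coeff (Th x P) d / L) P" by (rule uniq)
    then show ?thesis using L P(1) by (simp add: coeff_Th_lead[OF x] flip: L_def)
  qed
  \<comment> \<open>Downward induction: as \<open>Th x\<close> preserves parity, the coefficients
    between e and d that could contribute are already known to vanish. What remains compares the
    diagonal entries at d and e, which differ.\<close>
  have parity: "coeff P e = 0" if "odd (d + e)" for e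
    using that
  proof (induction "d - e" arbitrary: e rule: less_induct)
    case less
    show ?case
    proof (cases "d < e")
      case True
      then show ?thesis using P(1) by (simp add: coeff_eq_0)
    next
      case False
      let ?M = "{m. e \<le> m \<and> m \<le> d \<and> even (m + e)}"
      have "coeff (Th x P) e = (\<Sum>m\<in>?M. coeff P m * coeff (tp x m) e)"
        by (rule coeff_Th) (simp add: P(1))
      also have "\<dots> = (\<Sum>m\<in>{e}. coeff P m * coeff (tp x m) e)"
      proof (rule sum.mono_neutral_right)
        show "\<forall>m\<in>?M - {e}. coeff P m * coeff (tp x m) e = 0"
        proof
          fix m assume m: "m \<in> ?M - {e}"
          have "coeff P m = 0"
            by (rule less.hyps) (use m less.prems in \<open>auto simp: even_add\<close>)
          then show "coeff P m * coeff (tp x m) e = 0" by simp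
        qed
      qed (use False in auto)
      finally have "wt q (x / q ^ d) * coeff P e = coeff P e * wt q (x / q ^ e)"
        by (simp add: ThP coeff_tp_lead[OF x])
      with w_ne[OF less.prems] show ?thesis by simp
    qed
  qed

  define P' where "P' = pCons 0 P"
  have dP': "degree P' = Suc d" using P0 P(1) by (simp add: P'_def)
  \<comment> \<open>This is the coefficient of X^(d-2) in P, read off from X P so that d = 1 gives
    0. The coefficients two below the top in the eigenvalue equations of X P and P give
    \<open>E1\<close> and \<open>E2\<close>.\<close>
  define p where "p = coeff P' k"
  have cP'd: "coeff P' d = 0" using parity[of k] by (simp add: P'_def k)
  \<comment> \<open>X P also annihilates v, so \<open>Th x\<close> maps it to a multiple of itself
    plus a multiple of P. The latter vanishes, as P has the other parity.\<close>
  have ThP': "Th x P' = smult (wt q (x / q ^ Suc d)) P'"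
  proof -
    define R where "R = Th x P' - smult (wt q (x / q ^ Suc d)) P'"
    have "pact sc B P' v = 0" using Pv by (simp add: P'_def pact_pCons_0'[OF lin_B] B_simps)
    then have "pact sc B R v = 0"
      using A_on_pact[OF v(3,4), of P'] by (simp add: R_def pact_diff pact_smult A_simps)
    moreover have "degree R \<le> d"
    proof -
      have "degree R \<le> Suc d" unfolding R_def
        by (rule degree_diff_le) (use dP' degree_Th[of x P'] in \<open>auto intro: order_trans[OF degree_smult_le]\<close>)
      moreover have "coeff R (Suc d) = 0" using dP' by (simp add: R_def coeff_Th_lead[OF x] del: power_Suc)
      ultimately show ?thesis
        by (metis le_Suc_eq leading_coeff_0_iff degree_0 le0)
    qed
    ultimately have "R = smult (coeff R d / L) P" by (rule uniq)
    moreover have "coeff R d = 0"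
    proof -
      have "{m. d \<le> m \<and> m \<le> Suc d \<and> even (m + d)} = {d}"
        by (auto simp: le_Suc_eq)
      then have "coeff (Th x P') d = 0" using coeff_Th[of P' "Suc d" x d] dP' cP'd by simp
      then show ?thesis by (simp add: R_def cP'd)
    qed
    ultimately have "R = 0" by simp
    then show ?thesis by (simp add: R_def)
  qed
  have sets: "{m. i \<le> m \<and> m \<le> Suc (Suc i) \<and> even (m + i)} = {i, Suc (Suc i)}" for i
    by (auto simp: le_Suc_eq)
  have E1: "L * av x (Suc d) = p * (wt q (x / q ^ Suc d) - wt q (x / q ^ k))"
  proof -
    have "coeff (Th x P') k = coeff P' k * coeff (tp x k) k + coeff P' (Suc (Suc k)) * coeff (tp x (Suc (Suc k))) k"
      using coeff_Th[of P' "Suc (Suc k)" x k] dP' unfolding sets by (simp add: k)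
    moreover have "coeff (Th x P') k = wt q (x / q ^ Suc d) * p" by (simp only: ThP' coeff_smult p_def)
    moreover have "coeff P' (Suc (Suc k)) = L" by (simp add: P'_def L_def k)
    ultimately have "wt q (x / q ^ Suc d) * p = p * wt q (x / q ^ k) + L * av x (Suc d)"
      by (simp only: coeff_tp_sub[OF x] coeff_tp_lead[OF x] p_def k)
    then show ?thesis by (simp add: algebra_simps)
  qed
  have E2: "L * av x d = p * (wt q (x / q ^ d) - wt q (x * q / q ^ k))"
  proof (cases k)
    case 0
    then show ?thesis by (simp add: k p_def P'_def av_1)
  next
    case (Suc l)
    have pl: "p = coeff P l" by (simp add: p_def P'_def Suc)
    have "coeff (Th x P) l = coeff P l * coeff (tp x l) l + coeff P (Suc (Suc l)) * coeff (tp x (Suc (Suc l))) l"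
      using coeff_Th[of P "Suc (Suc l)" x l] P(1) unfolding sets by (simp add: k Suc)
    moreover have "coeff (Th x P) l = wt q (x / q ^ d) * p" by (simp only: ThP coeff_smult pl)
    moreover have "coeff P (Suc (Suc l)) = L" by (simp add: L_def k Suc)
    ultimately have "wt q (x / q ^ d) * p = p * wt q (x / q ^ l) + L * av x d"
      by (simp only: coeff_tp_sub[OF x] coeff_tp_lead[OF x] pl k Suc)
    moreover have "x / q ^ l = x * q / q ^ k" using q_nonzero by (simp add: Suc)
    ultimately show ?thesis by (simp add: algebra_simps)
  qed
  have D1: "wt q (x / q ^ Suc d) - wt q (x / q ^ k) = - (\<i> * up (x / q ^ d))"
  proof -
    have "q * (x / q ^ d) = x / q ^ k" "x / q ^ d / q = x / q ^ Suc d" using q_nonzero by (simp_all add: k)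
    then show ?thesis using wt_diff[of "x / q ^ d"] x q_nonzero by (simp add: algebra_simps)
  qed
  have D2: "wt q (x / q ^ d) - wt q (x * q / q ^ k) = - (\<i> * up (x * q / q ^ d))"
  proof -
    have "q * (x / q ^ k) = x * q / q ^ k" "x / q ^ k / q = x / q ^ d" "x * q / q ^ d = x / q ^ k"
      using q_nonzero by (simp_all add: k)
    then show ?thesis using wt_diff[of "x / q ^ k"] x q_nonzero by (simp add: algebra_simps)
  qed
  have "L * (av x (Suc d) * up (x * q / q ^ d)) = L * (av x d * up (x / q ^ d))"
    unfolding mult.assoc[symmetric] E1 E2 D1 D2 by (simp only: mult_ac mult_minus_left mult_minus_right)
  then have "av x (Suc d) * up (x * q / q ^ d) = av x d * up (x / q ^ d)" using L by simp
  from av_singular[OF x _ this] have "(x ^ 2 * q) ^ 2 = (q ^ d) ^ 2" by (simp add: k)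
  moreover have "(x ^ 2 * q) ^ 2 = q powi (4 * N + 2)"
  proof -
    have "\<sigma> ^ 2 = 1" using hx(2) by auto
    moreover have "(q powi (2 * N)) ^ 2 = q powi (2 * N * 2)" 
      unfolding power_int_mult[of q "2 * N" 2] by simp
    ultimately have "(x ^ 2 * q) ^ 2 = q powi (2 * N * 2) * q powi 2"
      unfolding hx(1) power_mult_distrib by simp
    also have "\<dots> = q powi (2 * N * 2 + 2)" by (rule power_int_add[symmetric]) (use q_nonzero in auto)
    finally show ?thesis by (simp add: mult.commute)
  qed
  moreover have "(q ^ d) ^ 2 = q powi (int (d * 2))"
    unfolding power_int_of_nat power_mult ..
  ultimately have "4 * N + 2 = int (d * 2)" using q_powi_inj by metis
  then have "odd d" by presburger
  then have "coeff P 0 = 0" using parity[of 0] by simp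
  then obtain P1 where P1: "P = pCons 0 P1" by (cases P) auto
  define z where "z = pact sc B P1 v"
  have z: "B z = 0" using Pv by (simp add: P1 z_def pact_pCons_0'[OF lin_B])
  have "z \<noteq> 0"
  proof
    assume "z = 0"
    moreover have "degree P1 < d" using P(1) P0 by (simp add: P1 split: if_splits)
    ultimately have "P1 = 0" using min unfolding z_def by blast
    with P0 P1 show False by simp
  qed
  define M where "M = range (\<lambda>p. pact sc B p v)"
  have "subspace M"
    unfolding subspace_def M_def
  proof (intro conjI ballI allI)
    show "0 \<in> range (\<lambda>p. pact sc B p v)" by (rule range_eqI[of _ _ 0]) simp
  next
    fix a b assume "a \<in> range (\<lambda>p. pact sc B p v)" "b \<in> range (\<lambda>p. pact sc B p v)"
    then obtain p r where "a = pact sc B p v" "b = pact sc B r v" by blast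
    then show "a + b \<in> range (\<lambda>p. pact sc B p v)"
      by (intro range_eqI[of _ _ "p + r"]) (simp add: pact_add)
  next
    fix c a assume "a \<in> range (\<lambda>p. pact sc B p v)"
    then obtain p where "a = pact sc B p v" by blast
    then show "c \<cdot> a \<in> range (\<lambda>p. pact sc B p v)"
      by (intro range_eqI[of _ _ "smult c p"]) (simp add: pact_smult)
  qed
  moreover have "M \<subseteq> V"
    unfolding M_def using pact_in[OF V(1), of B v] V(4) v(1) by blast
  moreover have "\<forall>u\<in>M. A u \<in> M \<and> B u \<in> M"
    unfolding M_def using A_on_pact[OF v(3,4)] pact_pCons_0'[OF lin_B, of _ v, symmetric] by auto
  moreover have "z \<in> M" by (simp add: M_def z_def)
  \<comment> \<open>Reduce modulo P: below degree d the polynomial representing a vector is unique,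
    so it is an eigenvector of the triangular \<open>Th x\<close>, and its eigenvalue is a diagonal
    entry.\<close>
  moreover have "\<exists>e::nat. \<mu> = wt q (x / q ^ e)" if w: "w \<in> M" "w \<noteq> 0" "A w = \<mu> \<cdot> w" for w \<mu>
  proof -
    obtain r where r: "w = pact sc B r v" using w(1) by (auto simp: M_def)
    define r' where "r' = r mod P"
    have "r = (r div P) * P + r'" by (simp add: r'_def)
    then have r': "w = pact sc B r' v"
      unfolding r by (metis pact_add pact_mult[OF lin_B] Pv pact_linear[OF lin_B] linear_opD(3) add_0)
    have deg: "degree r' < d"
      using degree_mod_less'[of P r] P0 w(2) r' P(1) by (cases "r' = 0") (auto simp: r'_def k)
    have "pact sc B (Th x r' - smult \<mu> r') v = 0"
      using A_on_pact[OF v(3,4), of r'] w(3) r' by (simp add: pact_diff pact_smult)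
    moreover have "degree (Th x r' - smult \<mu> r') < d"
      by (rule le_less_trans[OF degree_diff_le[of _ "degree r'"] deg])
        (use degree_Th[of x r'] in \<open>auto intro: order_trans[OF degree_smult_le]\<close>)
    ultimately have "Th x r' - smult \<mu> r' = 0" by (rule min)
    then have "coeff (Th x r') (degree r') = \<mu> * coeff r' (degree r')" by simp
    moreover have "coeff r' (degree r') \<noteq> 0" using r' w(2) by auto
    ultimately have "\<mu> = wt q (x / q ^ degree r')" by (simp add: coeff_Th_lead[OF x])
    then show ?thesis by blast
  qed
  ultimately show ?thesis using \<open>z \<noteq> 0\<close> z by blast
qed

lemma no_integral_nonclassical_eigenvalue:
  assumes S: "finite S" and V: "subspace V" "V \<subseteq> span S" "\<And>u. u \<in> V \<Longrightarrow> A u \<in> V" "\<And>u. u \<in> V \<Longrightarrow> B u \<in> V"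
    and v: "v \<in> V" "v \<noteq> 0" "A v = wt q x \<cdot> v" and x: "x \<noteq> 0"
  shows "x ^ 2 \<noteq> - (q powi (2 * N))"
proof
  assume bad: "x ^ 2 = - (q powi (2 * N))"
  obtain r v' where v': "v' \<in> V" "v' \<noteq> 0" "A v' = wt q (x * q ^ r) \<cdot> v'"
    "\<And>u. u \<in> V \<Longrightarrow> A u = wt q (q * (x * q ^ r)) \<cdot> u \<Longrightarrow> u = 0"
    using climb[OF S V(2) x v] by blast
  define y where "y = x * q ^ r"
  have y: "y \<noteq> 0" using x q_nonzero by (simp add: y_def)
  have "q powi (2 * (N + int r)) = q powi (2 * N + int (r * 2))" by (simp add: algebra_simps)
  also have "\<dots> = q powi (2 * N) * q powi (int (r * 2))" by (rule power_int_add) (use q_nonzero in auto)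
  also have "q powi (int (r * 2)) = (q ^ r) ^ 2" unfolding power_int_of_nat power_mult ..
  finally have "q powi (2 * (N + int r)) = q powi (2 * N) * (q ^ r) ^ 2" .
  then have hy: "y ^ 2 = - 1 * q powi (2 * (N + int r))"
    by (simp add: y_def power_mult_distrib bad)
  have "A (B v') = wt q (y / q) \<cdot> B v'"
    by (rule top_component[OF V(1,3,4) y]) (use v' in \<open>auto simp: y_def\<close>)
  from top_kernel[OF S V y hy disjI2[OF refl] v'(1,2) v'(3)[folded y_def] this]
  obtain M z where M: "subspace M" "M \<subseteq> V" "\<And>u. u \<in> M \<Longrightarrow> A u \<in> M" "\<And>u. u \<in> M \<Longrightarrow> B u \<in> M"
    and z: "z \<in> M" "z \<noteq> 0" "B z = 0"
    and spec: "\<And>w \<mu>. w \<in> M \<Longrightarrow> w \<noteq> 0 \<Longrightarrow> A w = \<mu> \<cdot> w \<Longrightarrow> \<exists>e::nat. \<mu> = wt q (y / q ^ e)"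
    by blast
  have MS: "M \<subseteq> span S" using M(2) V(2) by blast
  interpret BA: so3_pair sc q B A by (rule swap)
  \<comment> \<open>Zero is the weight of the label 1, so the kernel vector starts a climb for the
    pair \<open>B\<close>, \<open>A\<close> whose labels are powers of \<open>q\<close>.\<close>
  have "B z = wt q 1 \<cdot> z" using z by (simp add: wt_def)
  then obtain r' z' where z': "z' \<in> M" "z' \<noteq> 0" "B z' = wt q (1 * q ^ r') \<cdot> z'"
    "\<And>u. u \<in> M \<Longrightarrow> B u = wt q (q * (1 * q ^ r')) \<cdot> u \<Longrightarrow> u = 0"
    using BA.climb[OF S MS one_neq_zero z(1,2)] by blast
  define t where "t = 1 * q ^ r'"
  have t: "t \<noteq> 0" using q_nonzero by (simp add: t_def)
  have ht: "t ^ 2 = 1 * q powi (2 * int r')"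
  proof -
    have "q powi (2 * int r') = q powi (int (r' * 2))" by (simp add: mult.commute)
    also have "\<dots> = (q ^ r') ^ 2" unfolding power_int_of_nat power_mult ..
    finally show ?thesis by (simp add: t_def)
  qed
  have "B (A z') = wt q (t / q) \<cdot> A z'"
    by (rule BA.top_component[OF M(1,4,3) t]) (use z' in \<open>auto simp: t_def\<close>)
  \<comment> \<open>Working inside \<open>M\<close> rather than \<open>V\<close> keeps the list of
    possible eigenvalues of \<open>A\<close>. Zero would have to be the weight of some y / q^e,
    giving y^2 = q^(2e), whereas y^2 is minus a power of \<open>q\<close>.\<close>
  from BA.top_kernel[OF S M(1) MS M(4,3) t ht disjI1[OF refl] z'(1,2) z'(3)[folded t_def] this]
  obtain z'' where "z'' \<in> M" "z'' \<noteq> 0" "A z'' = 0" by blast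
  with spec[of z'' 0] obtain e :: nat where "wt q (y / q ^ e) = 0" by auto
  then have "wt q (y / q ^ e) = wt q 1" by (simp add: wt_def)
  then have "y / q ^ e = 1 \<or> y / q ^ e * 1 = - 1"
    by (subst (asm) wt_eq_iff) (use y q_nonzero in auto)
  then have "(y / q ^ e) ^ 2 = 1" by auto
  then have "y ^ 2 = (q ^ e) ^ 2" using q_nonzero by (simp add: power_divide)
  also have "\<dots> = q powi (int (e * 2))" unfolding power_int_of_nat power_mult ..
  finally have "q powi (int (e * 2)) = - (q powi (2 * (N + int r)))" unfolding hy by simp
  with q_powi_neq_minus show False by blast
qed

end

section \<open>Weight spaces and the four components of the middle generator\<close>

locale so4_ops = cvs sc + generic_q q
  for sc :: "complex \<Rightarrow> 'v::ab_group_add \<Rightarrow> 'v"  (infixr "\<cdot>" 75) and q +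
  fixes A B C :: "'v \<Rightarrow> 'v" and V S :: "'v set"
  assumes pair_AB: "so3_pair sc q A B" and pair_CB: "so3_pair sc q C B"
    and AC: "A (C v) = C (A v)"
    and finite_S: "finite S" and subspace_V: "subspace V" and V_span: "V \<subseteq> span S"
    and A_V: "u \<in> V \<Longrightarrow> A u \<in> V" and B_V: "u \<in> V \<Longrightarrow> B u \<in> V" and C_V: "u \<in> V \<Longrightarrow> C u \<in> V"
begin

lemma swap_so4: "so4_ops sc q C B A V S"
  by (intro so4_ops.intro so4_ops_axioms.intro cvs_axioms generic_q_axioms pair_AB pair_CB AC[symmetric]
      finite_S subspace_V V_span A_V B_V C_V)

sublocale AB: so3_pair sc q A B by (rule pair_AB)
sublocale CB: so3_pair sc q C B by (rule pair_CB)

lemmas A_simps = AB.A_simps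
lemmas B_simps = AB.B_simps
lemmas C_simps = CB.A_simps

text \<open>
  Weights with these labels only occur by the previous section; their neighbours $q x$ and $x/q$ have
  different weights, so that the projections \<open>pr\<close> below do not divide by zero.
\<close>

definition good :: "complex \<Rightarrow> bool" where
  "good x \<longleftrightarrow> x \<noteq> 0 \<and> (\<forall>N::int. x ^ 2 \<noteq> - (q powi (2 * N)))"

lemma good_nz: "good x \<Longrightarrow> x \<noteq> 0"
  by (simp add: good_def)

lemma good_q: "good x \<Longrightarrow> good (q * x)"
  unfolding good_def
proof (intro conjI allI notI; elim conjE)
  fix N assume x: "x \<noteq> 0" and h: "\<forall>N. x\<^sup>2 \<noteq> - (q powi (2 * N))"
  show "q * x = 0 \<Longrightarrow> False" using x q_nonzero by simp
  assume "(q * x)\<^sup>2 = - (q powi (2 * N))"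
  moreover have "x\<^sup>2 = (q * x)\<^sup>2 / q powi 2"
    using q_nonzero by (simp add: power_mult_distrib)
  ultimately have "x\<^sup>2 = - (q powi (2 * N)) / q powi 2" by simp
  also have "\<dots> = - (q powi (2 * N - 2))"
    by (subst power_int_diff) (use q_nonzero in auto)
  also have "2 * N - 2 = 2 * (N - 1)" by simp
  finally show False using h by blast
qed

lemma good_inverse_q: "good x \<Longrightarrow> good (x / q)"
  unfolding good_def
proof (intro conjI allI notI; elim conjE)
  fix N assume x: "x \<noteq> 0" and h: "\<forall>N. x\<^sup>2 \<noteq> - (q powi (2 * N))"
  show "x / q = 0 \<Longrightarrow> False" using x q_nonzero by simp
  assume "(x / q)\<^sup>2 = - (q powi (2 * N))"
  moreover have "x\<^sup>2 = (x / q)\<^sup>2 * q powi 2"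
    using q_nonzero by (simp add: power_divide)
  ultimately have "x\<^sup>2 = - (q powi (2 * N) * q powi 2)" by simp
  also have "\<dots> = - (q powi (2 * N + 2))"
    by (subst power_int_add) (use q_nonzero in auto)
  also have "2 * N + 2 = 2 * (N + 1)" by simp
  finally show False using h by blast
qed

lemma good_inverse_q': "good x \<Longrightarrow> good (1 / q * x)"
  using good_inverse_q[of x] by simp

lemma good_power: "good x \<Longrightarrow> good (x * q ^ n)"
proof (induction n)
  case (Suc n)
  show ?case using good_q[OF Suc(1)[OF Suc(2)]] by (simp add: mult_ac)
qed simp

lemma good_inverse_power: "good x \<Longrightarrow> good (x / q ^ n)"
proof (induction n)
  case (Suc n)
  show ?case using good_inverse_q[OF Suc(1)[OF Suc(2)]] by (simp add: mult_ac)
qed simp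

lemma good_up: assumes "good x" shows "up x \<noteq> 0"
proof
  assume "up x = 0"
  then have "(x ^ 2 + 1) / x = 0" using assms by (simp add: up_def good_def add_divide_distrib power2_eq_square)
  then have "x ^ 2 = - (q powi (2 * 0))" using assms by (simp add: good_def eq_neg_iff_add_eq_0)
  then show False using assms unfolding good_def by blast
qed

lemma good_wt_neq: assumes "good x" shows "wt q (q * x) \<noteq> wt q (x / q)"
proof
  assume "wt q (q * x) = wt q (x / q)"
  then have "\<i> * up x = 0" using wt_diff[OF good_nz[OF assms]] by simp
  with good_up[OF assms] show False by simp
qed

text \<open>Two applications of \<open>B\<close> shift a label by q^2, 1 or 1/q^2. These three
  weights are told apart when a relation quadratic in \<open>B\<close> is split by weight.\<close>

lemma good_wt_neq2:
  assumes "good x"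
  shows "wt q (q * (q * x)) \<noteq> wt q x" "wt q (x / q / q) \<noteq> wt q x" "wt q (q * (q * x)) \<noteq> wt q (x / q / q)"
proof -
  show "wt q (q * (q * x)) \<noteq> wt q x"
    using good_wt_neq[OF good_q[OF assms]] q_nonzero by simp
  show "wt q (x / q / q) \<noteq> wt q x"
  proof -
    have "q * (x / q) = x" using q_nonzero by simp
    then show ?thesis using good_wt_neq[OF good_inverse_q[OF assms]] by metis
  qed
  show "wt q (q * (q * x)) \<noteq> wt q (x / q / q)"
  proof
    assume "wt q (q * (q * x)) = wt q (x / q / q)"
    then have "q * (q * x) = x / q / q \<or> q * (q * x) * (x / q / q) = - 1"
      by (subst (asm) wt_eq_iff) (use q_nonzero good_nz[OF assms] in auto)
    moreover have "q * (q * x) \<noteq> x / q / q"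
    proof
      assume "q * (q * x) = x / q / q"
      then have "x * q ^ 4 = x" using q_nonzero by (simp add: eq_divide_eq power4_eq_xxxx mult_ac)
      then have "q ^ 4 = 1" using good_nz[OF assms] by simp
      with not_root[of 4] show False by simp
    qed
    moreover have "q * (q * x) * (x / q / q) = x ^ 2" using q_nonzero by (simp add: power2_eq_square)
    ultimately have "x ^ 2 = - (q powi (2 * 0))" by simp
    then show False using assms unfolding good_def by blast
  qed
qed

definition ws :: "complex \<Rightarrow> complex \<Rightarrow> 'v set" where
  "ws x y = {v \<in> V. A v = wt q x \<cdot> v \<and> C v = wt q y \<cdot> v}"

lemma subspace_ws: "subspace (ws x y)"
  unfolding ws_def
  by (rule subspaceI) (use subspace_V in \<open>auto simp: subspace_0 subspace_add subspace_scale A_simps C_simps scale_right_distrib mult.commute\<close>)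

lemma wsD: "v \<in> ws x y \<Longrightarrow> v \<in> V" "v \<in> ws x y \<Longrightarrow> A v = wt q x \<cdot> v" "v \<in> ws x y \<Longrightarrow> C v = wt q y \<cdot> v"
  by (auto simp: ws_def)

lemma eigenvalue_good:
  assumes "v \<in> V" "v \<noteq> 0" "x \<noteq> 0" "A v = wt q x \<cdot> v \<or> C v = wt q x \<cdot> v"
  shows "good x"
  using assms AB.no_integral_nonclassical_eigenvalue[OF finite_S subspace_V V_span A_V B_V]
    CB.no_integral_nonclassical_eigenvalue[OF finite_S subspace_V V_span C_V B_V]
  unfolding good_def by blast

text \<open>Lagrange interpolation: on the sum of the eigenspaces of f for a and b this is the
  projection onto the eigenspace of a.\<close>

definition pr :: "('v \<Rightarrow> 'v) \<Rightarrow> complex \<Rightarrow> complex \<Rightarrow> 'v \<Rightarrow> 'v" where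
  "pr f a b w = (1 / (a - b)) \<cdot> (f w - b \<cdot> w)"

lemma pr_sum:
  assumes "a \<noteq> b"
  shows "pr f a b w + pr f b a w = w"
proof -
  have "1 / (b - a) = - (1 / (a - b))" using minus_divide_right[of 1 "a - b"] by simp
  then have "pr f a b w + pr f b a w = (1 / (a - b)) \<cdot> ((f w - b \<cdot> w) - (f w - a \<cdot> w))"
    unfolding pr_def by (simp only: scale_minus_left scale_right_diff_distrib) simp
  also have "(f w - b \<cdot> w) - (f w - a \<cdot> w) = (a - b) \<cdot> w" by (simp add: algebra_simps)
  finally show ?thesis using assms by simp
qed

lemma pr_eigen:
  assumes "linear_op sc f" "f (f w) - (a + b) \<cdot> f w + (a * b) \<cdot> w = 0"
  shows "f (pr f a b w) = a \<cdot> pr f a b w"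
proof -
  have "f (f w) - b \<cdot> f w = a \<cdot> (f w - b \<cdot> w)"
    using assms(2) by (simp add: algebra_simps)
  then have "f (f w - b \<cdot> w) = a \<cdot> (f w - b \<cdot> w)" by (simp add: linear_opD[OF assms(1)])
  then show ?thesis
    unfolding pr_def by (simp only: linear_opD(2)[OF assms(1)] scale_left_commute)
qed

lemma pr_commute:
  assumes "linear_op sc f" "linear_op sc g" "\<And>v. f (g v) = g (f v)"
  shows "g (pr f a b w) = pr f a b (g w)"
  by (simp add: pr_def linear_opD[OF assms(2)] assms(3))

lemma pr_V: "w \<in> V \<Longrightarrow> f w \<in> V \<Longrightarrow> pr f a b w \<in> V"
  unfolding pr_def using subspace_V by (simp add: subspace_scale subspace_diff)

text \<open>
  For \<open>p\<close>, \<open>r\<close> in $\{q, q^{-1}\}$: the component of \<open>B\<close> that maps weight \<open>(x, y)\<close> to weight \<open>(p x, r y)\<close>.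
\<close>

definition X :: "complex \<Rightarrow> complex \<Rightarrow> complex \<Rightarrow> complex \<Rightarrow> 'v \<Rightarrow> 'v" where
  "X p r x y v = pr A (wt q (p * x)) (wt q (x / p)) (pr C (wt q (r * y)) (wt q (y / r)) (B v))"

lemma linear_X: "linear_op sc (X p r x y)"
  unfolding linear_op_def X_def pr_def
  by (simp add: A_simps B_simps C_simps scale_right_distrib scale_right_diff_distrib mult_ac)

lemmas X_simps = linear_opD[OF linear_X]

text \<open>\<open>X\<close> depends on its labels only through weights, which are invariant under x
  -> -1/x, and q x corresponds to (1/q)(-1/x). Hence raising from a mirrored label is lowering from
  the original one.\<close>

lemma X_mirror: "X (1 / p) (1 / r) (- 1 / x) (- 1 / y) v = X p r x y v"
proof -
  have h: "wt q (1 / p * (- 1 / x)) = wt q (p * x)" "wt q (- 1 / x / (1 / p)) = wt q (x / p)" for p x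
    using wt_minus_inverse[of "p * x"] wt_minus_inverse[of "x / p"] by simp_all
  show ?thesis unfolding X_def h ..
qed

lemma
  assumes v: "v \<in> ws x y" and x: "good x" and y: "good y" and p: "p = q \<or> p = 1 / q" and r: "r = q \<or> r = 1 / q"
  shows X_ws: "X p r x y v \<in> ws (p * x) (r * y)"
proof -
  have e: "A (A (B v)) - (wt q (p * x) + wt q (x / p)) \<cdot> A (B v) + (wt q (p * x) * wt q (x / p)) \<cdot> B v = 0"
    "C (C (B v)) - (wt q (r * y) + wt q (y / r)) \<cdot> C (B v) + (wt q (r * y) * wt q (y / r)) \<cdot> B v = 0"
    using AB.A_on_Bv[OF good_nz[OF x] wsD(2)[OF v]] CB.A_on_Bv[OF good_nz[OF y] wsD(3)[OF v]] p r
    by (auto simp: mult.commute add.commute)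
  let ?u = "pr C (wt q (r * y)) (wt q (y / r)) (B v)"
  have C: "C ?u = wt q (r * y) \<cdot> ?u" by (rule pr_eigen[OF CB.lin_A e(2)])
  have A: "A ?u = pr C (wt q (r * y)) (wt q (y / r)) (A (B v))" for w
    by (rule pr_commute[OF CB.lin_A AB.lin_A AC[symmetric]])
  have A2: "A (A ?u) = pr C (wt q (r * y)) (wt q (y / r)) (A (A (B v)))"
    unfolding A by (rule pr_commute[OF CB.lin_A AB.lin_A AC[symmetric]])
  \<comment> \<open>The projection for \<open>C\<close> commutes with \<open>A\<close>, so the
    quadratic equation of \<open>A\<close> on B v passes to the projected vector.\<close>
  have "A (A ?u) - (wt q (p * x) + wt q (x / p)) \<cdot> A ?u + (wt q (p * x) * wt q (x / p)) \<cdot> ?u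
     = pr C (wt q (r * y)) (wt q (y / r)) (A (A (B v)) - (wt q (p * x) + wt q (x / p)) \<cdot> A (B v) + (wt q (p * x) * wt q (x / p)) \<cdot> B v)"
    unfolding A2 A unfolding pr_def
    by (simp add: A_simps C_simps AC scale_right_distrib scale_right_diff_distrib scale_left_commute mult_ac)
  also have "\<dots> = 0" unfolding e(1) by (simp add: pr_def C_simps)
  finally have "A (X p r x y v) = wt q (p * x) \<cdot> X p r x y v"
    unfolding X_def by (rule pr_eigen[OF AB.lin_A])
  moreover have "C (X p r x y v) = wt q (r * y) \<cdot> X p r x y v"
    unfolding X_def pr_commute[OF AB.lin_A CB.lin_A AC] C
    by (simp add: pr_def A_simps scale_right_diff_distrib mult_ac)
  moreover have "X p r x y v \<in> V"
    unfolding X_def by (intro pr_V A_V C_V B_V wsD(1)[OF v])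
  ultimately show ?thesis by (simp add: ws_def)
qed

text \<open>The two projections attached to each of \<open>A\<close> and \<open>C\<close> add up to
  the identity on every vector; goodness keeps their denominators nonzero.\<close>

lemma B_decomp:
  assumes x: "good x" and y: "good y"
  shows "B v = X q q x y v + X q (1 / q) x y v + X (1 / q) q x y v + X (1 / q) (1 / q) x y v"
proof -
  have *: "pr A (wt q (q * x)) (wt q (x / q)) w + pr A (wt q (x / q)) (wt q (q * x)) w = w"
     "pr C (wt q (q * y)) (wt q (y / q)) w + pr C (wt q (y / q)) (wt q (q * y)) w = w" for w
    using good_wt_neq[OF x] good_wt_neq[OF y] by (simp_all add: pr_sum)
  have add: "pr A a b w + pr A a b w' = pr A a b (w + w')" for a b w w'
    by (simp add: pr_def A_simps algebra_simps)
  have "X q q x y v + X q (1 / q) x y v + X (1 / q) q x y v + X (1 / q) (1 / q) x y v = 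
    (X q q x y v + X q (1 / q) x y v) + (X (1 / q) q x y v + X (1 / q) (1 / q) x y v)" by (simp add: add.assoc)
  also have "\<dots> = B v" unfolding X_def add using * by (simp add: mult.commute)
  finally show ?thesis ..
qed

lemma X_swap: "so4_ops.X sc q C B A r p y x v = X p r x y v"
proof -
  interpret sw: so4_ops sc q C B A V S by (rule swap_so4)
  show ?thesis unfolding X_def sw.X_def
    by (simp add: pr_def A_simps C_simps AC scale_right_diff_distrib scale_left_commute algebra_simps)
qed

end

section \<open>Quadratic relations between the four components\<close>

context so4_ops begin

lemma three_eigen_aux:
  assumes "C a = \<alpha> \<cdot> a" "C b = \<beta> \<cdot> b" "C c = \<gamma> \<cdot> c" "\<alpha> \<noteq> \<beta>" "\<alpha> \<noteq> \<gamma>" "a + b + c = 0"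
  shows "a = 0"
proof -
  define P where "P w = C (C w) - (\<beta> + \<gamma>) \<cdot> C w + (\<beta> * \<gamma>) \<cdot> w" for w
  have "P (a + b + c) = P a + P b + P c" by (simp add: P_def C_simps algebra_simps)
  moreover have "P b = 0" "P c = 0" using assms by (simp_all add: P_def C_simps algebra_simps)
  moreover have "P a = ((\<alpha> - \<beta>) * (\<alpha> - \<gamma>)) \<cdot> a" using assms(1) by (simp add: P_def C_simps algebra_simps)
  moreover have "P (a + b + c) = 0" unfolding assms(6) by (simp add: P_def C_simps)
  ultimately have "((\<alpha> - \<beta>) * (\<alpha> - \<gamma>)) \<cdot> a = 0" by simp
  then show ?thesis using assms(4,5) by simp
qed

lemma three_eigen:
  assumes "C a = \<alpha> \<cdot> a" "C b = \<beta> \<cdot> b" "C c = \<gamma> \<cdot> c" "\<alpha> \<noteq> \<beta>" "\<alpha> \<noteq> \<gamma>" "\<beta> \<noteq> \<gamma>" "a + b + c = 0"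
  shows "a = 0" "b = 0" "c = 0"
proof -
  show "a = 0" by (rule three_eigen_aux[OF assms(1-5,7)])
  show "b = 0" by (rule three_eigen_aux[OF assms(2,1,3)]) (use assms in \<open>auto simp: add_ac\<close>)
  show "c = 0" by (rule three_eigen_aux[OF assms(3,1,2)]) (use assms in \<open>auto simp: add_ac\<close>)
qed

text \<open>Expand \<open>rel_AB\<close> on v into sixteen two-step paths. Paths that move the label
  of \<open>A\<close> twice in the same direction cancel by \<open>wt_add\<close>. The others return
  to \<open>x\<close>, and their labels for \<open>C\<close> are q^2 y, y or y/q^2. These weights
  are distinct, so the three groups satisfy separate relations: two exchange rules, and one relation
  with an inhomogeneous term coming from A v.\<close>

lemma
  assumes v: "v \<in> ws x y" and x: "good x" and y: "good y"
  shows mix_plus: "up (q * x) \<cdot> X (1 / q) q (q * x) (q * y) (X q q x y v)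
      = up (x / q) \<cdot> X q q (1 / q * x) (q * y) (X (1 / q) q x y v)" (is ?mix1)
    and mix_minus: "up (q * x) \<cdot> X (1 / q) (1 / q) (q * x) (1 / q * y) (X q (1 / q) x y v)
      = up (x / q) \<cdot> X q (1 / q) (1 / q * x) (1 / q * y) (X (1 / q) (1 / q) x y v)" (is ?mix2)
    and weight_zero_A: "up (x / q) \<cdot> (X q q (1 / q * x) (1 / q * y) (X (1 / q) (1 / q) x y v)
        + X q (1 / q) (1 / q * x) (q * y) (X (1 / q) q x y v))
      - up (q * x) \<cdot> (X (1 / q) (1 / q) (q * x) (q * y) (X q q x y v)
        + X (1 / q) q (q * x) (1 / q * y) (X q (1 / q) x y v)) = (\<i> * wt q x) \<cdot> v" (is ?zero)
proof -
  \<comment> \<open>The total coefficient of a path through q x, respectively x/q, back to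
    \<open>x\<close>. By \<open>wt_add\<close> each is a difference of weights two steps apart,
    which \<open>wt_diff\<close> turns into a multiple of \<open>up\<close>.\<close>
  define g where "g = 2 * wt q x - (q + 1 / q) * wt q (q * x)"
  define g' where "g' = 2 * wt q x - (q + 1 / q) * wt q (1 / q * x)"
  have x0: "x \<noteq> 0" and y0: "y \<noteq> 0" using x y by (auto simp: good_nz)
  have s1: "wt q (q * (q * x)) + wt q x = (q + 1 / q) * wt q (q * x)"
    using wt_add[of "q * x"] x0 q_nonzero by simp
  have s2: "wt q x + wt q (1 / q * (1 / q * x)) = (q + 1 / q) * wt q (1 / q * x)"
    using wt_add[of "x / q"] x0 q_nonzero by simp
  have g: "g = - \<i> * up (q * x)"
    unfolding g_def s1[symmetric] using wt_diff[of "q * x"] x0 q_nonzero minus_diff_eq[of "wt q (q * (q * x))" "wt q x"] by simp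
  have g': "g' = \<i> * up (x / q)"
    unfolding g'_def s2[symmetric] using wt_diff[of "x / q"] x0 q_nonzero by simp
  define kp where "kp = X q q x y v"
  define lp where "lp = X q (1 / q) x y v"
  define lm where "lm = X (1 / q) q x y v"
  define km where "km = X (1 / q) (1 / q) x y v"
  note gx = good_q[OF x] good_inverse_q'[OF x] good_q[OF y] good_inverse_q'[OF y]
  have kp: "kp \<in> ws (q * x) (q * y)" and lp: "lp \<in> ws (q * x) (1 / q * y)"
    and lm: "lm \<in> ws (1 / q * x) (q * y)" and km: "km \<in> ws (1 / q * x) (1 / q * y)"
    unfolding kp_def lp_def lm_def km_def by (intro X_ws v x y; simp)+
  have wXA: "A (X p r x' y' w) = wt q z \<cdot> X p r x' y' w"
    if "w \<in> ws x' y'" "good x'" "good y'" "p = q \<or> p = 1 / q" "r = q \<or> r = 1 / q" "p * x' = z" for p r x' y' w z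
    using X_ws[OF that(1-5)] that(6) by (auto dest: wsD)
  have wXC: "C (X p r x' y' w) = wt q z \<cdot> X p r x' y' w"
    if "w \<in> ws x' y'" "good x'" "good y'" "p = q \<or> p = 1 / q" "r = q \<or> r = 1 / q" "r * y' = z" for p r x' y' w z
    using X_ws[OF that(1-5)] that(6) by (auto dest: wsD)
  define kpkp where "kpkp = X q q (q * x) (q * y) kp"
  define kplp where "kplp = X q (1 / q) (q * x) (q * y) kp"
  define kplm where "kplm = X (1 / q) q (q * x) (q * y) kp"
  define kpkm where "kpkm = X (1 / q) (1 / q) (q * x) (q * y) kp"
  define lpkp where "lpkp = X q q (q * x) (1 / q * y) lp"
  define lplp where "lplp = X q (1 / q) (q * x) (1 / q * y) lp"
  define lplm where "lplm = X (1 / q) q (q * x) (1 / q * y) lp"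
  define lpkm where "lpkm = X (1 / q) (1 / q) (q * x) (1 / q * y) lp"
  define lmkp where "lmkp = X q q (1 / q * x) (q * y) lm"
  define lmlp where "lmlp = X q (1 / q) (1 / q * x) (q * y) lm"
  define lmlm where "lmlm = X (1 / q) q (1 / q * x) (q * y) lm"
  define lmkm where "lmkm = X (1 / q) (1 / q) (1 / q * x) (q * y) lm"
  define kmkp where "kmkp = X q q (1 / q * x) (1 / q * y) km"
  define kmlp where "kmlp = X q (1 / q) (1 / q * x) (1 / q * y) km"
  define kmlm where "kmlm = X (1 / q) q (1 / q * x) (1 / q * y) km"
  define kmkm where "kmkm = X (1 / q) (1 / q) (1 / q * x) (1 / q * y) km"
  have Bv: "B v = kp + lp + lm + km"
    unfolding kp_def lp_def lm_def km_def by (rule B_decomp[OF x y])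
  have BB: "B kp = kpkp + kplp + kplm + kpkm" "B lp = lpkp + lplp + lplm + lpkm"
     "B lm = lmkp + lmlp + lmlm + lmkm" "B km = kmkp + kmlp + kmlm + kmkm"
    unfolding kpkp_def kplp_def kplm_def kpkm_def lpkp_def lplp_def lplm_def lpkm_def
      lmkp_def lmlp_def lmlm_def lmkm_def kmkp_def kmlp_def kmlm_def kmkm_def
    by (intro B_decomp gx)+
  have AA: "A kpkp = wt q (q * (q * x)) \<cdot> kpkp" "A kplp = wt q (q * (q * x)) \<cdot> kplp"
    "A kplm = wt q x \<cdot> kplm" "A kpkm = wt q x \<cdot> kpkm"
    "A lpkp = wt q (q * (q * x)) \<cdot> lpkp" "A lplp = wt q (q * (q * x)) \<cdot> lplp"
    "A lplm = wt q x \<cdot> lplm" "A lpkm = wt q x \<cdot> lpkm"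
    "A lmkp = wt q x \<cdot> lmkp" "A lmlp = wt q x \<cdot> lmlp"
    "A lmlm = wt q (1 / q * (1 / q * x)) \<cdot> lmlm" "A lmkm = wt q (1 / q * (1 / q * x)) \<cdot> lmkm"
    "A kmkp = wt q x \<cdot> kmkp" "A kmlp = wt q x \<cdot> kmlp"
    "A kmlm = wt q (1 / q * (1 / q * x)) \<cdot> kmlm" "A kmkm = wt q (1 / q * (1 / q * x)) \<cdot> kmkm"
    unfolding kpkp_def kplp_def kplm_def kpkm_def lpkp_def lplp_def lplm_def lpkm_def
      lmkp_def lmlp_def lmlm_def lmkm_def kmkp_def kmlp_def kmlm_def kmkm_def
    by (rule wXA[OF kp gx(1,3)] wXA[OF lp gx(1,4)] wXA[OF lm gx(2,3)] wXA[OF km gx(2,4)]; simp add: q_nonzero)+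
  have CC: "C kplm = wt q (q * (q * y)) \<cdot> kplm" "C lmkp = wt q (q * (q * y)) \<cdot> lmkp"
    "C kpkm = wt q y \<cdot> kpkm" "C lplm = wt q y \<cdot> lplm" "C lmlp = wt q y \<cdot> lmlp" "C kmkp = wt q y \<cdot> kmkp"
    "C lpkm = wt q (1 / q * (1 / q * y)) \<cdot> lpkm" "C kmlp = wt q (1 / q * (1 / q * y)) \<cdot> kmlp"
    unfolding kplm_def kpkm_def lplm_def lpkm_def lmkp_def lmlp_def kmkp_def kmlp_def
    by (rule wXC[OF kp gx(1,3)] wXC[OF lp gx(1,4)] wXC[OF lm gx(2,3)] wXC[OF km gx(2,4)]; simp add: q_nonzero)+
  have AB: "A kp = wt q (q * x) \<cdot> kp" "A lp = wt q (q * x) \<cdot> lp"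
    "A lm = wt q (1 / q * x) \<cdot> lm" "A km = wt q (1 / q * x) \<cdot> km"
    using kp lp lm km by (auto dest: wsD)
  let ?l = "wt q x"
  have "A (B (B v)) - (q + 1 / q) \<cdot> B (A (B v)) + B (B (A v)) + A v = 0"
    using AB.rel_AB[of v] by simp
  then have R: "A (B kp + B lp + B lm + B km)
     - (((q + 1 / q) * wt q (q * x)) \<cdot> (B kp + B lp) + ((q + 1 / q) * wt q (1 / q * x)) \<cdot> (B lm + B km))
     + ?l \<cdot> (B kp + B lp + B lm + B km) + ?l \<cdot> v = 0"
    unfolding wsD(2)[OF v] Bv B_simps A_simps AB by (simp add: scale_right_distrib add_ac)
  have "(g \<cdot> kplm + g' \<cdot> lmkp) + (g \<cdot> (kpkm + lplm) + g' \<cdot> (lmlp + kmkp) + ?l \<cdot> v) + (g \<cdot> lpkm + g' \<cdot> kmlp) = 0"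
    using R unfolding BB g_def g'_def A_simps AA s1[symmetric] s2[symmetric]
    by (simp add: scale_right_distrib scale_left_distrib scale_left_diff_distrib algebra_simps)
  note three = three_eigen[OF _ _ _ _ _ _ this]
  have E: "g \<cdot> kplm + g' \<cdot> lmkp = 0" "g \<cdot> (kpkm + lplm) + g' \<cdot> (lmlp + kmkp) + ?l \<cdot> v = 0" "g \<cdot> lpkm + g' \<cdot> kmlp = 0"
    by (rule three[of "wt q (q * (q * y))" "wt q y" "wt q (1 / q * (1 / q * y))"];
      (insert good_wt_neq2[OF y] wsD(3)[OF v], simp add: C_simps CC scale_right_distrib mult.commute))+
  have fl: "g \<cdot> w = (- \<i>) \<cdot> (up (q * x) \<cdot> w)" "g' \<cdot> w = \<i> \<cdot> (up (x / q) \<cdot> w)" for w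
    by (simp_all add: g g')
  have cancel: "w = w'" if "(- \<i>) \<cdot> w + \<i> \<cdot> w' = 0" for w w'
    using that by simp
  show ?mix1 using cancel[OF E(1)[unfolded fl]] unfolding kplm_def lmkp_def kp_def lm_def .
  show ?mix2 using cancel[OF E(3)[unfolded fl]] unfolding lpkm_def kmlp_def lp_def km_def .
  have "(- \<i>) \<cdot> (g \<cdot> (kpkm + lplm) + g' \<cdot> (lmlp + kmkp) + ?l \<cdot> v) = 0" unfolding E(2) by simp
  then have "up (x / q) \<cdot> (kmkp + lmlp) - up (q * x) \<cdot> (kpkm + lplm) = (\<i> * ?l) \<cdot> v"
    unfolding fl by (simp add: scale_right_distrib algebra_simps)
  then show ?zero
    unfolding kpkm_def lplm_def lmlp_def kmkp_def kp_def lp_def lm_def km_def .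
qed

text \<open>These are \<open>mix_minus\<close> and \<open>weight_zero_A\<close> after exchanging
  \<open>A\<close> and \<open>C\<close>, which swaps the two labels and the two shifts of every
  component.\<close>

lemma
  assumes v: "v \<in> ws x y" and x: "good x" and y: "good y"
  shows lower_commute: "up (q * y) \<cdot> X (1 / q) (1 / q) (1 / q * x) (q * y) (X (1 / q) q x y v)
      = up (y / q) \<cdot> X (1 / q) q (1 / q * x) (1 / q * y) (X (1 / q) (1 / q) x y v)"
    and weight_zero_C: "up (y / q) \<cdot> (X q q (1 / q * x) (1 / q * y) (X (1 / q) (1 / q) x y v)
        + X (1 / q) q (q * x) (1 / q * y) (X q (1 / q) x y v))
      - up (q * y) \<cdot> (X (1 / q) (1 / q) (q * x) (q * y) (X q q x y v)
        + X q (1 / q) (1 / q * x) (q * y) (X (1 / q) q x y v)) = (\<i> * wt q y) \<cdot> v"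
proof -
  interpret sw: so4_ops sc q C B A V S by (rule swap_so4)
  have v': "v \<in> sw.ws y x" using v by (auto simp: ws_def sw.ws_def)
  have good: "sw.good y" "sw.good x" using x y by (auto simp: good_def sw.good_def)
  show "up (q * y) \<cdot> X (1 / q) (1 / q) (1 / q * x) (q * y) (X (1 / q) q x y v)
      = up (y / q) \<cdot> X (1 / q) q (1 / q * x) (1 / q * y) (X (1 / q) (1 / q) x y v)"
    using sw.mix_minus[OF v' good] unfolding X_swap .
  show "up (y / q) \<cdot> (X q q (1 / q * x) (1 / q * y) (X (1 / q) (1 / q) x y v)
        + X (1 / q) q (q * x) (1 / q * y) (X q (1 / q) x y v))
      - up (q * y) \<cdot> (X (1 / q) (1 / q) (q * x) (q * y) (X q q x y v)
        + X q (1 / q) (1 / q * x) (q * y) (X (1 / q) q x y v)) = (\<i> * wt q y) \<cdot> v"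
    using sw.weight_zero_A[OF v' good] unfolding X_swap .
qed

end

section \<open>The lattice of weight vectors below a top vector\<close>

text \<open>At q^m this is [m]. Taking the power as argument admits labels that are not powers of
  \<open>q\<close>.\<close>

definition br :: "complex \<Rightarrow> complex \<Rightarrow> complex" where
  "br q z = (z - 1 / z) / (q - 1 / q)"

section \<open>Scalar identities for the lattice coefficients\<close>

context generic_q begin

lemma up_mult: "s \<noteq> 0 \<Longrightarrow> t \<noteq> 0 \<Longrightarrow> up s * up t = up (s * t) + up (s / t)"
  by (simp add: up_def field_simps)

lemma br_mult: "s \<noteq> 0 \<Longrightarrow> t \<noteq> 0 \<Longrightarrow> br q s * br q t = (up (s * t) - up (s / t)) / (q - 1 / q) ^ 2"
proof -
  assume "s \<noteq> 0" "t \<noteq> 0"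
  then have "(s - 1 / s) * (t - 1 / t) = up (s * t) - up (s / t)"
    by (simp add: up_def field_simps)
  then show ?thesis unfolding br_def power2_eq_square times_divide_times_eq by simp
qed

lemma up_minus: "up (1 / z) = up z"
  by (simp add: up_def)

text \<open>This verifies the ansatz of \<open>raising_step\<close>. F and G over t^2 are the
  products of \<open>up\<close> and \<open>br\<close> factors belonging to a step in the first and
  second lattice direction, rewritten by \<open>up_mult\<close> and \<open>br_mult\<close>. The key
  is F z - G w = (z + w) (c - c' - z + w), where z + w is a product of two values of
  \<open>up\<close> and cancels denominators; afterwards c - c' drops out.\<close>

lemma zero_weight_scalar_A:
  fixes c c' :: complex
  assumes x: "x \<noteq> 0" and y: "y \<noteq> 0"
    and nz: "up x \<noteq> 0" "up y \<noteq> 0" "up (q * x) \<noteq> 0" "up (x / q) \<noteq> 0" "up (q * y) \<noteq> 0" "up (y / q) \<noteq> 0"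
  defines "F z \<equiv> (z + c') * (c - z)" and "G w \<equiv> (c + w) * (c' - w)" and "t \<equiv> q - 1 / q"
  shows "up (x / q) * (- F (up (x * y / q)) / t ^ 2 / (up x * up y * up (x / q) * up (y / q))
        + - G (up (x / (q * y))) / t ^ 2 / (up x * up y * up (x / q) * up (q * y)))
      - up (q * x) * (- F (up (q * x * y)) / t ^ 2 / (up x * up y * up (q * x) * up (q * y))
        + - G (up (q * x / y)) / t ^ 2 / (up x * up y * up (q * x) * up (y / q))) = \<i> * wt q x" (is "?L = _")
proof -
  have t: "t \<noteq> 0" using theta_nonzero unfolding t_def .
  define za zq wa wq where "za = up (q * x * y)" and "zq = up (x * y / q)" and "wa = up (q * x / y)" and "wq = up (x / (q * y))"
  have cancel: "- t * d * up y / (t ^ 2 * up y) = - d / t" for d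
    using nz t by (simp add: power2_eq_square)
  have FG: "F z - G w = (z + w) * (c - c' - z + w)" for z w
    unfolding F_def G_def by (simp add: algebra_simps)
  have e1: "za + wq = up x * up (q * y)"
    using x y q_nonzero by (simp add: za_def wq_def up_mult mult_ac)
  have e2: "zq + wa = up x * up (y / q)"
    using x y q_nonzero by (simp add: zq_def wa_def up_mult mult_ac)
  have split: "\<alpha> * (- f / t2 / (X * Y * \<alpha> * b) + - g / t2 / (X * Y * \<alpha> * b'))
     - \<alpha>' * (- f' / t2 / (X * Y * \<alpha>' * b') + - g' / t2 / (X * Y * \<alpha>' * b))
     = ((f' - g) / b' - (f - g') / b) / (t2 * X * Y)"
    if "\<alpha> \<noteq> 0" "\<alpha>' \<noteq> 0" "b \<noteq> 0" "b' \<noteq> 0" "X \<noteq> 0" "Y \<noteq> 0" "t2 \<noteq> 0" for \<alpha> \<alpha>' b b' X Y t2 f g f' g' :: complex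
    using that by (simp add: field_simps)
  have "?L = ((F za - G wq) / up (q * y) - (F zq - G wa) / up (y / q)) / (t ^ 2 * up x * up y)"
    unfolding za_def[symmetric] zq_def[symmetric] wa_def[symmetric] wq_def[symmetric]
    by (rule split) (use nz t in auto)
  also have "\<dots> = ((c - c' - za + wq) - (c - c' - zq + wa)) / (t ^ 2 * up y)"
    unfolding FG e1 e2 using nz t by (simp add: field_simps)
  also have "(c - c' - za + wq) - (c - c' - zq + wa) = - t * (x - 1 / x) * up y"
    using x y q_nonzero unfolding za_def zq_def wa_def wq_def t_def up_def by (simp add: field_simps)
  also have "\<dots> / (t ^ 2 * up y) = - (x - 1 / x) / t"
    by (rule cancel)
  also have "\<dots> = \<i> * wt q x"
    unfolding wt_def t_def[symmetric] by simp
  finally show ?thesis .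
qed

lemma zero_weight_scalar_C:
  fixes c c' :: complex
  assumes x: "x \<noteq> 0" and y: "y \<noteq> 0"
    and nz: "up x \<noteq> 0" "up y \<noteq> 0" "up (q * x) \<noteq> 0" "up (x / q) \<noteq> 0" "up (q * y) \<noteq> 0" "up (y / q) \<noteq> 0"
  defines "F z \<equiv> (z + c') * (c - z)" and "G w \<equiv> (c + w) * (c' - w)" and "t \<equiv> q - 1 / q"
  shows "up (y / q) * (- F (up (x * y / q)) / t ^ 2 / (up x * up y * up (x / q) * up (y / q))
        + - G (up (q * x / y)) / t ^ 2 / (up x * up y * up (q * x) * up (y / q)))
      - up (q * y) * (- F (up (q * x * y)) / t ^ 2 / (up x * up y * up (q * x) * up (q * y))
        + - G (up (x / (q * y))) / t ^ 2 / (up x * up y * up (x / q) * up (q * y))) = \<i> * wt q y" (is "?L = _")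
proof -
  have t: "t \<noteq> 0" using theta_nonzero unfolding t_def .
  define za zq wa wq where "za = up (q * x * y)" and "zq = up (x * y / q)" and "wa = up (q * x / y)" and "wq = up (x / (q * y))"
  have cancel: "- t * d * up x / (t ^ 2 * up x) = - d / t" for d
    using nz t by (simp add: power2_eq_square)
  have FG: "F z - G w = (z + w) * (c - c' - z + w)" for z w
    unfolding F_def G_def by (simp add: algebra_simps)
  have e1: "za + wa = up (q * x) * up y"
    using up_mult[of "q * x" y] x y q_nonzero by (simp add: za_def wa_def)
  have e2: "zq + wq = up (x / q) * up y"
    using up_mult[of "x / q" y] x y q_nonzero by (simp add: zq_def wq_def)
  have split: "b * (- f / t2 / (X * Y * \<alpha> * b) + - g' / t2 / (X * Y * \<alpha>' * b))
     - b' * (- f' / t2 / (X * Y * \<alpha>' * b') + - g / t2 / (X * Y * \<alpha> * b'))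
     = ((f' - g') / \<alpha>' - (f - g) / \<alpha>) / (t2 * X * Y)"
    if "\<alpha> \<noteq> 0" "\<alpha>' \<noteq> 0" "b \<noteq> 0" "b' \<noteq> 0" "X \<noteq> 0" "Y \<noteq> 0" "t2 \<noteq> 0" for \<alpha> \<alpha>' b b' X Y t2 f g f' g' :: complex
    using that by (simp add: field_simps)
  have "?L = ((F za - G wa) / up (q * x) - (F zq - G wq) / up (x / q)) / (t ^ 2 * up x * up y)"
    unfolding za_def[symmetric] zq_def[symmetric] wa_def[symmetric] wq_def[symmetric]
    by (rule split) (use nz t in auto)
  also have "\<dots> = ((c - c' - za + wa) - (c - c' - zq + wq)) / (t ^ 2 * up x)"
    unfolding FG e1 e2 using nz t by (simp add: field_simps)
  also have "(c - c' - za + wa) - (c - c' - zq + wq) = - t * (y - 1 / y) * up x"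
    using x y q_nonzero unfolding za_def zq_def wa_def wq_def t_def up_def by (simp add: field_simps)
  also have "\<dots> / (t ^ 2 * up x) = - (y - 1 / y) / t"
    by (rule cancel)
  also have "\<dots> = \<i> * wt q y"
    unfolding wt_def t_def[symmetric] by simp
  finally show ?thesis .
qed

end

context so4_ops begin

text \<open>The two zero-weight relations are linear in the two unknown vectors, with determinant up
  (x/q) (q + 1/q) (up y) up to sign, which is nonzero for good labels. So scalars satisfying the
  corresponding scalar equations must be the answer.\<close>

lemma zero_weight_solve:
  assumes v: "v \<in> ws x y" and x: "good x" and y: "good y"
    and P1: "X (1 / q) (1 / q) (q * x) (q * y) (X q q x y v) = P1 \<cdot> v"
    and P2: "X (1 / q) q (q * x) (1 / q * y) (X q (1 / q) x y v) = P2 \<cdot> v"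
    and eA: "up (x / q) * (Q1 + Q2) - up (q * x) * (P1 + P2) = \<i> * wt q x"
    and eC: "up (y / q) * (Q1 + P2) - up (q * y) * (P1 + Q2) = \<i> * wt q y"
  shows "X q q (1 / q * x) (1 / q * y) (X (1 / q) (1 / q) x y v) = Q1 \<cdot> v"
    and "X q (1 / q) (1 / q * x) (q * y) (X (1 / q) q x y v) = Q2 \<cdot> v"
proof -
  define u where "u = X q q (1 / q * x) (1 / q * y) (X (1 / q) (1 / q) x y v)"
  define w where "w = X q (1 / q) (1 / q * x) (q * y) (X (1 / q) q x y v)"
  have "up (x / q) \<cdot> (u + w) - up (q * x) \<cdot> (P1 \<cdot> v + P2 \<cdot> v) = (\<i> * wt q x) \<cdot> v"
    using weight_zero_A[OF v x y] unfolding P1 P2 u_def w_def .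
  then have "up (x / q) \<cdot> ((u - Q1 \<cdot> v) + (w - Q2 \<cdot> v)) = 0"
    unfolding eA[symmetric] by (simp add: algebra_simps)
  then have "(u - Q1 \<cdot> v) + (w - Q2 \<cdot> v) = 0"
    using good_up[OF good_inverse_q[OF x]] by simp
  then have s: "w - Q2 \<cdot> v = - (u - Q1 \<cdot> v)"
    by (rule minus_unique[symmetric])
  have "up (y / q) \<cdot> (u + P2 \<cdot> v) - up (q * y) \<cdot> (P1 \<cdot> v + w) = (\<i> * wt q y) \<cdot> v"
    using weight_zero_C[OF v x y] unfolding P1 P2 u_def w_def .
  then have "up (y / q) \<cdot> (u - Q1 \<cdot> v) - up (q * y) \<cdot> (w - Q2 \<cdot> v) = 0"
    unfolding eC[symmetric] by (simp add: algebra_simps)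
  then have "(up (y / q) + up (q * y)) \<cdot> (u - Q1 \<cdot> v) = 0"
    unfolding s by (simp only: scale_minus_right scale_left_distrib diff_minus_eq_add)
  moreover have "up (y / q) + up (q * y) = (q + 1 / q) * up y"
    using up_mult[of q y] up_minus[of "y / q"] q_nonzero good_nz[OF y] by (simp add: up_def[of q] add.commute)
  moreover have "q + 1 / q \<noteq> 0"
  proof
    assume "q + 1 / q = 0"
    then have "q * q + 1 = 0" using q_nonzero by (simp add: field_simps)
    then have "q * q = - 1" by (simp add: eq_neg_iff_add_eq_0)
    with q_sq_neq_m1 show False by blast
  qed
  ultimately have u: "u - Q1 \<cdot> v = 0" using good_up[OF y] by simp
  then show "X q q (1 / q * x) (1 / q * y) (X (1 / q) (1 / q) x y v) = Q1 \<cdot> v" by (simp add: u_def)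
  show "X q (1 / q) (1 / q * x) (q * y) (X (1 / q) q x y v) = Q2 \<cdot> v"
    using s u by (simp add: w_def)
qed

end

section \<open>Action of the four components on the lattice\<close>

locale so4_top = so4_ops +
  fixes x0 y0 :: complex
  assumes good_x0: "good x0" and good_y0: "good y0"
    and top: "u \<in> V \<Longrightarrow> A u = wt q (q * x0) \<cdot> u \<Longrightarrow> u = 0"
begin

text \<open>m counts the steps with \<open>km\<close> and n those with \<open>lm\<close>. For x =
  q^(k + l) and y = q^(k - l) they lower k and l, respectively, by one.\<close>

definition xx :: "nat \<Rightarrow> nat \<Rightarrow> complex" where "xx m n = x0 / q ^ m / q ^ n"
definition yy :: "nat \<Rightarrow> nat \<Rightarrow> complex" where "yy m n = y0 * q ^ n / q ^ m"
definition DD :: "nat \<Rightarrow> nat \<Rightarrow> complex" where "DD m n = up (xx m n) * up (yy m n)"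
text \<open>The coefficients of R_jj' in another normalization: all brackets are moved to the
  raising coefficients. The lowering ones are then nonzero, and \<open>E\<close> can be defined by
  division before the length of the lattice is known.\<close>

definition Lk :: "nat \<Rightarrow> nat \<Rightarrow> complex" where "Lk m n = - up (x0 / q ^ m) / DD m n"
definition Ll :: "nat \<Rightarrow> nat \<Rightarrow> complex" where "Ll m n = up (x0 / q ^ n) / DD m n"
definition Uk :: "nat \<Rightarrow> nat \<Rightarrow> complex" where
  "Uk m n = up (y0 / q ^ m) * br q (q ^ m) * br q (x0 * y0 * q / q ^ m) / DD m n"
definition Ul :: "nat \<Rightarrow> nat \<Rightarrow> complex" where
  "Ul m n = - (up (y0 * q ^ n) * br q (q ^ n) * br q (x0 * q / (y0 * q ^ n))) / DD m n"

abbreviation "kp m n \<equiv> X q q (xx m n) (yy m n)"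
abbreviation "lp m n \<equiv> X q (1 / q) (xx m n) (yy m n)"
abbreviation "lm m n \<equiv> X (1 / q) q (xx m n) (yy m n)"
abbreviation "km m n \<equiv> X (1 / q) (1 / q) (xx m n) (yy m n)"

primrec Ek :: "'a \<Rightarrow> nat \<Rightarrow> 'a" where
  "Ek v 0 = v"
| "Ek v (Suc m) = (1 / Lk m 0) \<cdot> km m 0 (Ek v m)"

primrec E :: "'a \<Rightarrow> nat \<Rightarrow> nat \<Rightarrow> 'a" where
  "E v m 0 = Ek v m"
| "E v m (Suc n) = (1 / Ll m n) \<cdot> lm m n (E v m n)"

lemma good_xx: "good (xx m n)" and good_yy: "good (yy m n)"
  unfolding xx_def yy_def by (intro good_inverse_power good_power good_x0 good_y0)+

lemma labels: "1 / q * xx m n = xx (Suc m) n" "1 / q * xx m n = xx m (Suc n)"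
  "1 / q * yy m n = yy (Suc m) n" "q * yy m n = yy m (Suc n)"
  "q * xx (Suc m) n = xx m n" "q * xx m (Suc n) = xx m n" "q * yy (Suc m) n = yy m n" "1 / q * yy m (Suc n) = yy m n"
  using q_nonzero by (simp_all add: xx_def yy_def)

lemma nz: "x0 \<noteq> 0" "y0 \<noteq> 0" "up (xx m n) \<noteq> 0" "up (yy m n) \<noteq> 0" "DD m n \<noteq> 0" "Lk m n \<noteq> 0" "Ll m n \<noteq> 0"
  using good_nz[OF good_x0] good_nz[OF good_y0] good_up[OF good_xx] good_up[OF good_yy]
    good_up[OF good_inverse_power[OF good_x0]]
  by (simp_all add: DD_def Lk_def Ll_def)

lemma km_E0: "km m 0 (E v m 0) = Lk m 0 \<cdot> E v (Suc m) 0"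
  using nz by simp

lemma lm_E: "lm m n (E v m n) = Ll m n \<cdot> E v m (Suc n)"
  using nz by simp

text \<open>This allows the top vector itself to be chosen as an eigenvector of v -> E v J K in the
  nonclassical case.\<close>

lemma linear_E: "linear_op sc (\<lambda>v. E v m n)"
proof -
  have "linear_op sc (\<lambda>v. Ek v m)"
    by (induction m) (auto simp: linear_op_def X_simps scale_right_distrib mult.commute)
  then show ?thesis
    by (induction n) (auto simp: linear_op_def X_simps scale_right_distrib mult.commute)
qed

context
  fixes v assumes v: "v \<in> ws x0 y0"
begin

lemma E_ws: "E v m n \<in> ws (xx m n) (yy m n)"
proof (induction n)
  case 0
  show ?case
  proof (induction m)
    case 0
    then show ?case using v by (simp add: xx_def yy_def)
  next
    case (Suc m)
    have "km m 0 (E v m 0) \<in> ws (1 / q * xx m 0) (1 / q * yy m 0)"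
      by (rule X_ws[OF Suc good_xx good_yy]) auto
    then show ?case unfolding labels(1,3)
      using subspace_scale[OF subspace_ws] by simp
  qed
next
  case (Suc n)
  have "lm m n (E v m n) \<in> ws (1 / q * xx m n) (q * yy m n)"
    by (rule X_ws[OF Suc good_xx good_yy]) auto
  then show ?case unfolding labels(2,4)
    using subspace_scale[OF subspace_ws] by simp
qed

text \<open>\<open>E\<close> lowers in the first direction before the second, so n = 0 is the
  definition; \<open>lower_commute\<close> then moves \<open>km\<close> past one \<open>lm\<close>
  at a time.\<close>

lemma km_E: "km m n (E v m n) = Lk m n \<cdot> E v (Suc m) n"
proof (induction n)
  case 0
  show ?case by (rule km_E0)
next
  case (Suc n)
  have "up (yy m (Suc n)) \<cdot> km m (Suc n) (lm m n (E v m n)) = up (yy (Suc m) n) \<cdot> lm (Suc m) n (km m n (E v m n))"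
    using lower_commute[OF E_ws good_xx good_yy, of m n]
    unfolding labels(3,4) labels(2)[of m n, symmetric]
    by (simp add: labels(1)[symmetric] labels(3)[symmetric])
  then have "(up (yy m (Suc n)) * Ll m n) \<cdot> km m (Suc n) (E v m (Suc n))
    = (up (yy (Suc m) n) * Lk m n * Ll (Suc m) n) \<cdot> E v (Suc m) (Suc n)"
    unfolding lm_E Suc by (simp add: X_simps lm_E del: E.simps)
  moreover have "up (yy (Suc m) n) * Lk m n * Ll (Suc m) n = (up (yy m (Suc n)) * Ll m n) * Lk m (Suc n)"
  proof -
    have "xx (Suc m) n = xx m (Suc n)" using labels(1,2) by metis
    then show ?thesis using nz(3,4,5) unfolding Lk_def Ll_def DD_def by (simp add: field_simps)
  qed
  ultimately have "(up (yy m (Suc n)) * Ll m n) \<cdot> km m (Suc n) (E v m (Suc n))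
    = (up (yy m (Suc n)) * Ll m n) \<cdot> (Lk m (Suc n) \<cdot> E v (Suc m) (Suc n))" by simp
  moreover have "up (yy m (Suc n)) * Ll m n \<noteq> 0" using nz(4,7) by simp
  ultimately show ?case using scale_left_imp_eq by blast
qed

text \<open>The straight steps, back to (m, n), come from \<open>zero_weight_solve\<close>: lowering
  after raising is known there, hence so is raising after lowering. The cross terms come from
  \<open>mix_plus\<close> and \<open>mix_minus\<close>, which carry a raising step in one direction
  past a lowering step in the other.\<close>

lemma raising_step:
  assumes kp: "kp m n (E v m n) = Uk m n \<cdot> E v (m - 1) n" and lp: "lp m n (E v m n) = Ul m n \<cdot> E v m (n - 1)"
  shows "kp (Suc m) n (E v (Suc m) n) = Uk (Suc m) n \<cdot> E v m n"
    and "lp m (Suc n) (E v m (Suc n)) = Ul m (Suc n) \<cdot> E v m n"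
    and "kp m (Suc n) (E v m (Suc n)) = Uk m (Suc n) \<cdot> E v (m - 1) (Suc n)"
    and "lp (Suc m) n (E v (Suc m) n) = Ul (Suc m) n \<cdot> E v (Suc m) (n - 1)"
proof -
  define x y where "x = xx m n" and "y = yy m n"
  define e where "e = E v m n"
  have gx: "good x" and gy: "good y" unfolding x_def y_def by (rule good_xx good_yy)+
  have ups: "up x \<noteq> 0" "up y \<noteq> 0" "up (q * x) \<noteq> 0" "up (x / q) \<noteq> 0" "up (q * y) \<noteq> 0" "up (y / q) \<noteq> 0"
    by (intro good_up good_q good_inverse_q gx gy)+
  have x: "x \<noteq> 0" and y: "y \<noteq> 0" using gx gy by (auto simp: good_nz)
  have ews: "e \<in> ws x y" unfolding e_def x_def y_def by (rule E_ws)
  have lab: "1 / q * x = xx (Suc m) n" "1 / q * x = xx m (Suc n)" "1 / q * y = yy (Suc m) n" "q * y = yy m (Suc n)"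
    "x / q = xx (Suc m) n" "x / q = xx m (Suc n)" "y / q = yy (Suc m) n"
    unfolding x_def y_def using labels(1-4)[of m n] by auto
  have DDs: "DD m n = up x * up y" "DD (Suc m) n = up (x / q) * up (y / q)" "DD m (Suc n) = up (x / q) * up (q * y)"
    unfolding DD_def lab(5)[symmetric] lab(6)[symmetric] lab(7)[symmetric] lab(4)[symmetric] x_def y_def by simp_all
  \<comment> \<open>In the classical case c and c' are q^(2j+1) + q^(-2j-1) and the same with j',
    analogues of the Casimir values of the two so3 factors. They are constant along the
    lattice.\<close>
  define t c c' where "t = q - 1 / q" and "c = up (x0 * y0 * q)" and "c' = up (x0 * q / y0)"
  define KK where "KK a = up (y0 / a) * up (x0 * q / a) * br q a * br q (x0 * y0 * q / a)" for a
  define HH where "HH b = up (y0 * b) * up (x0 * q / b) * br q b * br q (x0 * q / (y0 * b))" for b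
  have KK: "KK a = (up (x0 * y0 * q / a ^ 2) + c') * (c - up (x0 * y0 * q / a ^ 2)) / t ^ 2" if "a \<noteq> 0" for a
  proof -
    have "up (x0 * q / a) * up (y0 / a) = up (x0 * y0 * q / a ^ 2) + c'"
      using up_mult[of "x0 * q / a" "y0 / a"] nz(1,2) q_nonzero that by (simp add: c'_def power2_eq_square mult_ac)
    moreover have "br q (x0 * y0 * q / a) * br q a = (c - up (x0 * y0 * q / a ^ 2)) / t ^ 2"
      using br_mult[of "x0 * y0 * q / a" a] nz(1,2) q_nonzero that by (simp add: c_def t_def power2_eq_square mult_ac)
    moreover have "KK a = (up (x0 * q / a) * up (y0 / a)) * (br q (x0 * y0 * q / a) * br q a)" by (simp add: KK_def mult_ac)
    ultimately show ?thesis by simp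
  qed
  have HH: "HH b = (c + up (x0 * q / (y0 * b ^ 2))) * (c' - up (x0 * q / (y0 * b ^ 2))) / t ^ 2" if "b \<noteq> 0" for b
  proof -
    have "up (x0 * q / b) * up (y0 * b) = c + up (x0 * q / (y0 * b ^ 2))"
      using up_mult[of "x0 * q / b" "y0 * b"] nz(1,2) q_nonzero that by (simp add: c_def power2_eq_square mult_ac)
    moreover have "br q (x0 * q / (y0 * b)) * br q b = (c' - up (x0 * q / (y0 * b ^ 2))) / t ^ 2"
      using br_mult[of "x0 * q / (y0 * b)" b] nz(1,2) q_nonzero that by (simp add: c'_def t_def power2_eq_square mult_ac)
    moreover have "HH b = (up (x0 * q / b) * up (y0 * b)) * (br q (x0 * q / (y0 * b)) * br q b)" by (simp add: HH_def mult_ac)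
    ultimately show ?thesis by simp
  qed
  have args: "x0 * y0 * q / (q ^ m) ^ 2 = q * x * y" "x0 * y0 * q / (q ^ Suc m) ^ 2 = x * y / q"
    "x0 * q / (y0 * (q ^ n) ^ 2) = q * x / y" "x0 * q / (y0 * (q ^ Suc n) ^ 2) = x / (q * y)"
    using q_nonzero nz(2) by (simp_all add: x_def y_def xx_def yy_def power2_eq_square mult_ac)
  have pw: "q ^ m \<noteq> 0" "q ^ Suc m \<noteq> 0" "q ^ n \<noteq> 0" "q ^ Suc n \<noteq> 0" using q_nonzero by simp_all
  note K = KK[OF pw(1), unfolded args] KK[OF pw(2), unfolded args]
  note H = HH[OF pw(3), unfolded args] HH[OF pw(4), unfolded args]
  \<comment> \<open>The scalars of the four two-step paths returning to (m, n): P1 and P2 go up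
    first and follow from the assumptions, Q1 and Q2 go down first and are to be
    established.\<close>
  define P1 Q1 P2 Q2 where "P1 = - KK (q ^ m) / (up x * up y * up (q * x) * up (q * y))"
    and "Q1 = - KK (q ^ Suc m) / (up x * up y * up (x / q) * up (y / q))"
    and "P2 = - HH (q ^ n) / (up x * up y * up (q * x) * up (y / q))"
    and "Q2 = - HH (q ^ Suc n) / (up x * up y * up (x / q) * up (q * y))"
  have Q1: "Q1 = Lk m n * Uk (Suc m) n"
    unfolding Q1_def Lk_def Uk_def DDs KK_def using q_nonzero by (simp add: mult_ac)
  have Q2: "Q2 = Ll m n * Ul m (Suc n)"
    unfolding Q2_def Ll_def Ul_def DDs HH_def using q_nonzero by (simp add: mult_ac)
  have P1: "X (1 / q) (1 / q) (q * x) (q * y) (X q q x y e) = P1 \<cdot> e"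
  proof (cases m)
    \<comment> \<open>At the edge m - 1 is truncated to 0, but the coefficient contains br q 1 =
      0.\<close>
    case 0
    then have "Uk m n = 0" "P1 = 0" by (simp_all add: Uk_def P1_def KK_def br_def)
    then show ?thesis using kp by (simp add: x_def y_def e_def X_simps)
  next
    case (Suc l)
    have l: "q * x = xx l n" "q * y = yy l n" unfolding x_def y_def Suc by (rule labels)+
    have "DD l n = up (q * x) * up (q * y)" unfolding DD_def l ..
    then have "Uk m n * Lk l n = P1"
      unfolding P1_def Lk_def Uk_def DDs KK_def using q_nonzero by (simp add: Suc mult_ac)
    then show ?thesis
      using kp km_E[of l n] unfolding l by (simp add: x_def y_def e_def X_simps Suc del: E.simps)
  qed
  have P2: "X (1 / q) q (q * x) (1 / q * y) (X q (1 / q) x y e) = P2 \<cdot> e"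
  proof (cases n)
    case 0
    then have "Ul m n = 0" "P2 = 0" by (simp_all add: Ul_def P2_def HH_def br_def)
    then show ?thesis using lp by (simp add: x_def y_def e_def X_simps)
  next
    case (Suc l)
    have l: "q * x = xx m l" "1 / q * y = yy m l" unfolding x_def y_def Suc by (rule labels)+
    have "DD m l = up (q * x) * up (y / q)" unfolding DD_def l[symmetric] by simp
    then have "Ul m n * Ll m l = P2"
      unfolding P2_def Ll_def Ul_def DDs HH_def using q_nonzero by (simp add: Suc mult_ac)
    then show ?thesis
      using lp lm_E[of m l v] unfolding l by (simp add: x_def y_def e_def X_simps Suc del: E.simps)
  qed
  have eA: "up (x / q) * (Q1 + Q2) - up (q * x) * (P1 + P2) = \<i> * wt q x"
    using zero_weight_scalar_A[OF x y ups, of c' c]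
    unfolding P1_def P2_def Q1_def Q2_def K H t_def by (simp only: minus_divide_left)
  have eC: "up (y / q) * (Q1 + P2) - up (q * y) * (P1 + Q2) = \<i> * wt q y"
    using zero_weight_scalar_C[OF x y ups, of c' c]
    unfolding P1_def P2_def Q1_def Q2_def K H t_def by (simp only: minus_divide_left)
  note sol = zero_weight_solve[OF ews gx gy P1 P2 eA eC]
  have "kp (Suc m) n (km m n (E v m n)) = Q1 \<cdot> E v m n"
    using sol(1) unfolding lab(1,3) unfolding x_def y_def e_def .
  then have "Lk m n \<cdot> kp (Suc m) n (E v (Suc m) n) = Lk m n \<cdot> (Uk (Suc m) n \<cdot> E v m n)"
    unfolding km_E Q1 by (simp only: X_simps scale_scale)
  then show "kp (Suc m) n (E v (Suc m) n) = Uk (Suc m) n \<cdot> E v m n"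
    using nz(6) scale_left_imp_eq by blast
  have "lp m (Suc n) (lm m n (E v m n)) = Q2 \<cdot> E v m n"
    using sol(2) unfolding lab(2,4) unfolding x_def y_def e_def .
  then have "Ll m n \<cdot> lp m (Suc n) (E v m (Suc n)) = Ll m n \<cdot> (Ul m (Suc n) \<cdot> E v m n)"
    unfolding lm_E Q2 by (simp only: X_simps scale_scale)
  then show "lp m (Suc n) (E v m (Suc n)) = Ul m (Suc n) \<cdot> E v m n"
    using nz(7) scale_left_imp_eq by blast

  have "up (q * x) \<cdot> X (1 / q) q (q * x) (q * y) (kp m n e) = up (x / q) \<cdot> kp m (Suc n) (lm m n e)"
    using mix_plus[OF ews gx gy] unfolding lab(2,4) unfolding x_def y_def .
  also have "\<dots> = (up (x / q) * Ll m n) \<cdot> kp m (Suc n) (E v m (Suc n))"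
    unfolding e_def lm_E by (simp only: X_simps scale_scale)
  also have "up (q * x) \<cdot> X (1 / q) q (q * x) (q * y) (kp m n e) = (up (x / q) * Ll m n) \<cdot> (Uk m (Suc n) \<cdot> E v (m - 1) (Suc n))"
  proof (cases m)
    case 0
    then have "Uk m n = 0" "Uk m (Suc n) = 0" by (simp_all add: Uk_def br_def)
    then show ?thesis using kp by (simp add: e_def X_simps del: E.simps)
  next
    case (Suc l)
    have l: "q * x = xx l n" "q * y = yy l n" unfolding x_def y_def Suc by (rule labels)+
    have "DD l n = up (q * x) * up (q * y)" unfolding DD_def l ..
    then have "up (q * x) * (Uk m n * Ll l n) = up (x / q) * Ll m n * Uk m (Suc n)"
      unfolding Ll_def Uk_def DDs using ups by (simp add: field_simps)
    then have "up (q * x) \<cdot> (Uk m n \<cdot> (Ll l n \<cdot> E v l (Suc n))) = (up (x / q) * Ll m n) \<cdot> (Uk m (Suc n) \<cdot> E v l (Suc n))"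
      by (simp only: scale_scale)
    then show ?thesis
      using kp lm_E[of l n v] unfolding l by (simp add: e_def X_simps Suc del: E.simps scale_scale)
  qed
  finally have "(up (x / q) * Ll m n) \<cdot> kp m (Suc n) (E v m (Suc n)) = (up (x / q) * Ll m n) \<cdot> (Uk m (Suc n) \<cdot> E v (m - 1) (Suc n))" ..
  moreover have "up (x / q) * Ll m n \<noteq> 0" using ups nz(7) by simp
  ultimately show "kp m (Suc n) (E v m (Suc n)) = Uk m (Suc n) \<cdot> E v (m - 1) (Suc n)"
    using scale_left_imp_eq by blast

  have "up (q * x) \<cdot> X (1 / q) (1 / q) (q * x) (1 / q * y) (lp m n e) = up (x / q) \<cdot> lp (Suc m) n (km m n e)"
    using mix_minus[OF ews gx gy] unfolding lab(1,3) unfolding x_def y_def .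
  also have "\<dots> = (up (x / q) * Lk m n) \<cdot> lp (Suc m) n (E v (Suc m) n)"
    unfolding e_def km_E by (simp only: X_simps scale_scale)
  also have "up (q * x) \<cdot> X (1 / q) (1 / q) (q * x) (1 / q * y) (lp m n e) = (up (x / q) * Lk m n) \<cdot> (Ul (Suc m) n \<cdot> E v (Suc m) (n - 1))"
  proof (cases n)
    case 0
    then have "Ul m n = 0" "Ul (Suc m) n = 0" by (simp_all add: Ul_def br_def)
    then show ?thesis using lp by (simp add: e_def X_simps del: E.simps)
  next
    case (Suc l)
    have l: "q * x = xx m l" "1 / q * y = yy m l" unfolding x_def y_def Suc by (rule labels)+
    have "DD m l = up (q * x) * up (y / q)" unfolding DD_def l[symmetric] by simp
    then have "up (q * x) * (Ul m n * Lk m l) = up (x / q) * Lk m n * Ul (Suc m) n"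
      unfolding Lk_def Ul_def DDs using ups by (simp add: field_simps)
    then have "up (q * x) \<cdot> (Ul m n \<cdot> (Lk m l \<cdot> E v (Suc m) l)) = (up (x / q) * Lk m n) \<cdot> (Ul (Suc m) n \<cdot> E v (Suc m) l)"
      by (simp only: scale_scale)
    then show ?thesis
      using lp km_E[of m l] unfolding l by (simp add: e_def X_simps Suc del: E.simps scale_scale)
  qed
  finally have "(up (x / q) * Lk m n) \<cdot> lp (Suc m) n (E v (Suc m) n) = (up (x / q) * Lk m n) \<cdot> (Ul (Suc m) n \<cdot> E v (Suc m) (n - 1))" ..
  moreover have "up (x / q) * Lk m n \<noteq> 0" using ups nz(6) by simp
  ultimately show "lp (Suc m) n (E v (Suc m) n) = Ul (Suc m) n \<cdot> E v (Suc m) (n - 1)"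
    using scale_left_imp_eq by blast
qed

lemma raising: "kp m n (E v m n) = Uk m n \<cdot> E v (m - 1) n \<and> lp m n (E v m n) = Ul m n \<cdot> E v m (n - 1)"
proof (induction n arbitrary: m)
  case 0
  show ?case
  proof (induction m)
    case 0
    \<comment> \<open>Both components raise the label of \<open>A\<close> to q x0, for which
      \<open>V\<close> has no nonzero vector.\<close>
    have "X q r x0 y0 v = 0" if "r = q \<or> r = 1 / q" for r
    proof (rule top)
      have "X q r x0 y0 v \<in> ws (q * x0) (r * y0)"
        by (rule X_ws[OF v good_x0 good_y0]) (use that in auto)
      then show "X q r x0 y0 v \<in> V" "A (X q r x0 y0 v) = wt q (q * x0) \<cdot> X q r x0 y0 v"
        by (auto dest: wsD)
    qed
    then show ?case by (simp add: xx_def yy_def Uk_def Ul_def br_def)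
  next
    case (Suc m)
    then show ?case using raising_step[of m 0] by (simp del: E.simps)
  qed
next
  case (Suc n)
  have "kp m n (E v m n) = Uk m n \<cdot> E v (m - 1) n" "lp m n (E v m n) = Ul m n \<cdot> E v m (n - 1)"
    using Suc by auto
  from raising_step[OF this] show ?case by (simp del: E.simps)
qed

end

end

section \<open>Length of the lattice and its normalized basis\<close>

context generic_q begin

lemma br_eq_0: "z \<noteq> 0 \<Longrightarrow> br q z = 0 \<longleftrightarrow> z ^ 2 = 1"
proof -
  assume z: "z \<noteq> 0"
  have "br q z = (z ^ 2 - 1) / z / (q - 1 / q)"
    using z by (simp add: br_def diff_divide_distrib power2_eq_square)
  also have "\<dots> = 0 \<longleftrightarrow> z ^ 2 - 1 = 0"
    using z theta_nonzero by (simp only: divide_eq_0_iff) simp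
  finally show ?thesis by simp
qed

lemma q_power_inj: "q ^ m = q ^ n \<longleftrightarrow> m = n"
  using q_powi_inj[of "int m" "int n"] by simp

lemma q_power_sq_inj: "(q ^ m) ^ 2 = (q ^ n) ^ 2 \<longleftrightarrow> m = n"
  using q_power_inj[of "m * 2" "n * 2"] by (simp add: power_mult)

lemma br_q_power: "m > 0 \<Longrightarrow> br q (q ^ m) \<noteq> 0"
  using br_eq_0[of "q ^ m"] q_power_sq_inj[of m 0] q_nonzero by simp

end

context so4_top begin

lemma Lk_neq: "Lk m n \<noteq> 0" and Ll_neq: "Ll m n \<noteq> 0" by (rule nz)+

text \<open>Only every second step is taken: equal weights of x0/q^e and x0/q^e' force e = e' or
  x0^2 = -q^(e + e'), and goodness excludes the latter for even e + e'. For odd sums it does occur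
  in the nonclassical case.\<close>

lemma even_lattice_inj: "inj (\<lambda>i. wt q (x0 / q ^ (2 * i)))"
proof (rule injI)
  fix i j assume "wt q (x0 / q ^ (2 * i)) = wt q (x0 / q ^ (2 * j))"
  then have "x0 / q ^ (2 * i) = x0 / q ^ (2 * j) \<or> x0 / q ^ (2 * i) * (x0 / q ^ (2 * j)) = - 1"
    by (subst (asm) wt_eq_iff) (use nz(1) q_nonzero in auto)
  then show "i = j"
  proof
    assume "x0 / q ^ (2 * i) = x0 / q ^ (2 * j)"
    then have "q ^ (2 * i) = q ^ (2 * j)" using nz(1) q_nonzero by (simp add: frac_eq_eq)
    then show ?thesis unfolding q_power_inj by simp
  next
    assume "x0 / q ^ (2 * i) * (x0 / q ^ (2 * j)) = - 1"
    then have "x0 ^ 2 / q ^ (2 * (i + j)) = - 1" by (simp add: power_add power2_eq_square distrib_left)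
    then have "x0 ^ 2 = - (q ^ (2 * (i + j)))" using q_nonzero by (simp add: divide_eq_eq)
    also have "q ^ (2 * (i + j)) = q powi (2 * int (i + j))"
      using power_int_of_nat[of q "2 * (i + j)"] by simp
    finally show ?thesis using good_x0 unfolding good_def by blast
  qed
qed

context
  fixes v assumes v: "v \<in> ws x0 y0" and v_neq: "v \<noteq> 0"
begin

lemma E_step_m: "E v m n = 0 \<Longrightarrow> E v (Suc m) n = 0"
  using km_E[OF v, of m n] Lk_neq[of m n] by (simp add: X_simps del: E.simps)

lemma E_step_n: "E v m n = 0 \<Longrightarrow> E v m (Suc n) = 0"
  using lm_E[of m n v] Ll_neq[of m n] by (simp add: X_simps del: E.simps)

lemma E_zero_mono:
  assumes "E v m n = 0" "m \<le> m'" "n \<le> n'"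
  shows "E v m' n' = 0"
proof -
  have z: "E v m' n = 0" using assms(2,1) by (induction m' rule: dec_induct) (auto intro: E_step_m simp del: E.simps)
  show ?thesis using assms(3) z by (induction n' rule: dec_induct) (auto intro: E_step_n simp del: E.simps)
qed

lemma E_A: "A (E v m n) = wt q (xx m n) \<cdot> E v m n" and E_C: "C (E v m n) = wt q (yy m n) \<cdot> E v m n"
  and E_V: "E v m n \<in> V"
  using E_ws[OF v] by (auto dest: wsD simp del: E.simps)

text \<open>At the first vanishing vector E v (Suc J) 0, the raising formula says that Uk (Suc J) 0
  times a nonzero vector is zero. The only factor that can vanish is the bracket at x0 y0 / q^J, and
  this quantizes x0 y0.\<close>

lemma chain_k_aux: "\<exists>J. (x0 * y0) ^ 2 = (q ^ J) ^ 2 \<and> E v (Suc J) 0 = 0"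
proof -
  have "\<exists>m. E v m 0 = 0"
  proof (rule ccontr)
    assume neg: "\<nexists>m. E v m 0 = 0"
    show False
    proof (rule finitely_many_eigenvalues[OF finite_S AB.lin_A _ _ _ even_lattice_inj])
      show "E v (2 * i) 0 \<in> span S" for i using E_V V_span by blast
      show "E v (2 * i) 0 \<noteq> 0" for i using neg by blast
      show "A (E v (2 * i) 0) = wt q (x0 / q ^ (2 * i)) \<cdot> E v (2 * i) 0" for i
        using E_A[of "2 * i" 0] by (simp add: xx_def)
    qed
  qed
  then obtain M where M: "E v M 0 = 0" "\<And>m. m < M \<Longrightarrow> E v m 0 \<noteq> 0"
    using exists_least_iff[of "\<lambda>m. E v m 0 = 0"] by auto
  have "M \<noteq> 0" using M(1) v_neq by (intro notI) simp
  then obtain J where J: "M = Suc J" by (cases M) auto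
  have "Uk (Suc J) 0 \<cdot> E v J 0 = 0"
    using raising[OF v, of "Suc J" 0] M(1) unfolding J by (simp add: X_simps del: E.simps)
  then have "Uk (Suc J) 0 = 0" using M(2)[of J] J by simp
  then have "br q (x0 * y0 * q / q ^ Suc J) = 0"
    using good_up[OF good_inverse_power[OF good_y0, of "Suc J"]] br_q_power[of "Suc J"] nz(5)
    by (simp add: Uk_def del: power_Suc)
  moreover have "x0 * y0 * q / q ^ Suc J = x0 * y0 / q ^ J" using q_nonzero by simp
  ultimately have "(x0 * y0 / q ^ J) ^ 2 = 1" using br_eq_0[of "x0 * y0 / q ^ J"] nz(1,2) q_nonzero by simp
  then have "(x0 * y0) ^ 2 = (q ^ J) ^ 2" using q_nonzero by (simp add: power_divide)
  then show ?thesis using M(1) unfolding J by blast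
qed

lemma chain_l_aux: "\<exists>K. (x0 / y0) ^ 2 = (q ^ K) ^ 2 \<and> E v 0 (Suc K) = 0"
proof -
  have "\<exists>n. E v 0 n = 0"
  proof (rule ccontr)
    assume neg: "\<nexists>n. E v 0 n = 0"
    show False
    proof (rule finitely_many_eigenvalues[OF finite_S AB.lin_A _ _ _ even_lattice_inj])
      show "E v 0 (2 * i) \<in> span S" for i using E_V V_span by blast
      show "E v 0 (2 * i) \<noteq> 0" for i using neg by blast
      show "A (E v 0 (2 * i)) = wt q (x0 / q ^ (2 * i)) \<cdot> E v 0 (2 * i)" for i
        using E_A[of 0 "2 * i"] by (simp add: xx_def)
    qed
  qed
  then obtain M where M: "E v 0 M = 0" "\<And>m. m < M \<Longrightarrow> E v 0 m \<noteq> 0"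
    using exists_least_iff[of "\<lambda>m. E v 0 m = 0"] by auto
  have "M \<noteq> 0" using M(1) v_neq by (intro notI) simp
  then obtain K where K: "M = Suc K" by (cases M) auto
  have "Ul 0 (Suc K) \<cdot> E v 0 K = 0"
    using raising[OF v, of 0 "Suc K"] M(1) unfolding K by (simp add: X_simps del: E.simps)
  then have "Ul 0 (Suc K) = 0" using M(2)[of K] K by simp
  then have "br q (x0 * q / (y0 * q ^ Suc K)) = 0"
    using good_up[OF good_power[OF good_y0, of "Suc K"]] br_q_power[of "Suc K"] nz(5)
    by (simp add: Ul_def del: power_Suc)
  moreover have "x0 * q / (y0 * q ^ Suc K) = x0 / y0 / q ^ K" using q_nonzero by simp
  ultimately have "(x0 / y0 / q ^ K) ^ 2 = 1" using br_eq_0[of "x0 / y0 / q ^ K"] nz(1,2) q_nonzero by simp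
  moreover have "x0 / y0 = x0 / y0 / q ^ K * q ^ K" using q_nonzero by simp
  then have "(x0 / y0) ^ 2 = (x0 / y0 / q ^ K) ^ 2 * (q ^ K) ^ 2" by (metis power_mult_distrib)
  ultimately have "(x0 / y0) ^ 2 = (q ^ K) ^ 2" by simp
  then show ?thesis using M(1) unfolding K by blast
qed

lemma chain_lengths: "\<exists>J K. (x0 * y0) ^ 2 = (q ^ J) ^ 2 \<and> (x0 / y0) ^ 2 = (q ^ K) ^ 2"
  using chain_k_aux chain_l_aux by blast

text \<open>\<eta> is a sign kept free for matching the formulas: 1 in the classical and i \<iota>
  in the nonclassical case.\<close>

context
  fixes J K :: nat and \<eta> :: complex
  assumes J: "(x0 * y0) ^ 2 = (q ^ J) ^ 2" and K: "(x0 / y0) ^ 2 = (q ^ K) ^ 2" and \<eta>: "\<eta> * \<eta> = 1"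
begin

text \<open>The lengths found by \<open>chain_k_aux\<close> and \<open>chain_l_aux\<close> are the
  given J and K, since q^(2n) determines n.\<close>

lemma E_zero: "m > J \<or> n > K \<Longrightarrow> E v m n = 0"
proof -
  obtain J' where "(x0 * y0) ^ 2 = (q ^ J') ^ 2" "E v (Suc J') 0 = 0" using chain_k_aux by blast
  then have "E v (Suc J) 0 = 0" using J q_power_sq_inj by metis
  moreover obtain K' where "(x0 / y0) ^ 2 = (q ^ K') ^ 2" "E v 0 (Suc K') = 0" using chain_l_aux by blast
  then have "E v 0 (Suc K) = 0" using K q_power_sq_inj by metis
  moreover assume "m > J \<or> n > K"
  ultimately show ?thesis using E_zero_mono[of "Suc J" 0 m n] E_zero_mono[of 0 "Suc K" m n] by auto
qed

lemma br_J: "i < J \<Longrightarrow> br q (x0 * y0 / q ^ i) \<noteq> 0"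
proof
  assume i: "i < J" and "br q (x0 * y0 / q ^ i) = 0"
  then have "(x0 * y0 / q ^ i) ^ 2 = 1" using br_eq_0[of "x0 * y0 / q ^ i"] nz(1,2) q_nonzero by simp
  then have "(q ^ J) ^ 2 = (q ^ i) ^ 2" using q_nonzero by (simp add: power_divide J)
  with i show False unfolding q_power_sq_inj by simp
qed

lemma br_K: "i < K \<Longrightarrow> br q (x0 / (y0 * q ^ i)) \<noteq> 0"
proof
  assume i: "i < K" and "br q (x0 / (y0 * q ^ i)) = 0"
  then have "(x0 / (y0 * q ^ i)) ^ 2 = 1" using br_eq_0[of "x0 / (y0 * q ^ i)"] nz(1,2) q_nonzero by simp
  then have "(x0 / y0) ^ 2 = (q ^ i) ^ 2" using q_nonzero nz(2) by (simp add: power_divide power_mult_distrib frac_eq_eq mult.commute)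
  then have "(q ^ K) ^ 2 = (q ^ i) ^ 2" using K by simp
  with i show False unfolding q_power_sq_inj by simp
qed

text \<open>Inside the rectangle the raising coefficients are nonzero in the direction of the
  induction, so a zero vector would make its predecessor zero, and finally v.\<close>

lemma E_nonzero: "m \<le> J \<Longrightarrow> n \<le> K \<Longrightarrow> E v m n \<noteq> 0"
proof (induction m)
  case 0
  then show ?case
  proof (induction n)
    case 0
    then show ?case using v_neq by simp
  next
    case (Suc n)
    show ?case
    proof
      assume "E v 0 (Suc n) = 0"
      then have "Ul 0 (Suc n) \<cdot> E v 0 n = 0"
        using raising[OF v, of 0 "Suc n"] by (simp add: X_simps del: E.simps)
      then have "Ul 0 (Suc n) = 0" using Suc by simp
      then have "br q (x0 * q / (y0 * q ^ Suc n)) = 0"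
        using good_up[OF good_power[OF good_y0, of "Suc n"]] br_q_power[of "Suc n"] nz(5)
        by (simp add: Ul_def del: power_Suc)
      moreover have "x0 * q / (y0 * q ^ Suc n) = x0 / (y0 * q ^ n)" using q_nonzero by simp
      ultimately show False using br_K[of n] Suc(3) by simp
    qed
  qed
next
  case (Suc m)
  show ?case
  proof
    assume "E v (Suc m) n = 0"
    then have "Uk (Suc m) n \<cdot> E v m n = 0"
      using raising[OF v, of "Suc m" n] by (simp add: X_simps del: E.simps)
    then have "Uk (Suc m) n = 0" using Suc by simp
    then have "br q (x0 * y0 * q / q ^ Suc m) = 0"
      using good_up[OF good_inverse_power[OF good_y0, of "Suc m"]] br_q_power[of "Suc m"] nz(5)
      by (simp add: Uk_def del: power_Suc)
    moreover have "x0 * y0 * q / q ^ Suc m = x0 * y0 / q ^ m" using q_nonzero by simp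
    ultimately show False using br_J[of m] Suc(2) by simp
  qed
qed

text \<open>
  The rescaling which makes the raising and lowering coefficients as symmetric as in $R_{jj'}$.
\<close>

definition pk :: "nat \<Rightarrow> complex" where "pk m = (\<Prod>i<m. \<eta> / br q (x0 * y0 / q ^ i))"
definition pl :: "nat \<Rightarrow> complex" where "pl n = (\<Prod>i<n. \<eta> / br q (x0 / (y0 * q ^ i)))"
definition f :: "nat \<Rightarrow> nat \<Rightarrow> 'a" where "f m n = (pk m * pl n) \<cdot> E v m n"

lemma eta_neq: "\<eta> \<noteq> 0" using \<eta> by auto

lemma pk_neq: "m \<le> J \<Longrightarrow> pk m \<noteq> 0" and pl_neq: "n \<le> K \<Longrightarrow> pl n \<noteq> 0"
  using br_J br_K eta_neq by (auto simp: pk_def pl_def)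

lemma f_00: "f 0 0 = v" by (simp add: f_def pk_def pl_def)

lemma f_ws: "f m n \<in> ws (xx m n) (yy m n)"
  unfolding f_def using subspace_scale[OF subspace_ws E_ws[OF v]] .

lemma f_A: "A (f m n) = wt q (xx m n) \<cdot> f m n" and f_C: "C (f m n) = wt q (yy m n) \<cdot> f m n" and f_V: "f m n \<in> V"
  using f_ws by (auto dest: wsD)

lemma f_nonzero: "m \<le> J \<Longrightarrow> n \<le> K \<Longrightarrow> f m n \<noteq> 0"
  using E_nonzero pk_neq pl_neq by (simp add: f_def del: E.simps)

lemma f_zero: "m > J \<or> n > K \<Longrightarrow> f m n = 0"
  using E_zero by (simp add: f_def del: E.simps)

lemma
  assumes mn: "m \<le> J" "n \<le> K"
  shows km_f: "km m n (f m n) = (- \<eta> * (up (x0 / q ^ m) * br q (x0 * y0 / q ^ m)) / DD m n) \<cdot> f (Suc m) n"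
    and lm_f: "lm m n (f m n) = (\<eta> * (up (x0 / q ^ n) * br q (x0 / (y0 * q ^ n))) / DD m n) \<cdot> f m (Suc n)"
    and kp_f: "kp m n (f m n) = (\<eta> * (up (y0 / q ^ m) * br q (q ^ m)) / DD m n) \<cdot> f (m - 1) n"
    and lp_f: "lp m n (f m n) = (- \<eta> * (up (y0 * q ^ n) * br q (q ^ n)) / DD m n) \<cdot> f m (n - 1)"
proof -
  show "km m n (f m n) = (- \<eta> * (up (x0 / q ^ m) * br q (x0 * y0 / q ^ m)) / DD m n) \<cdot> f (Suc m) n"
  proof (cases "m = J")
    \<comment> \<open>\<open>pk (Suc J)\<close> divides by the bracket that vanishes at J. Both
      sides are zero here because the lattice ends.\<close>
    case True
    then show ?thesis using km_E[OF v, of m n] E_zero[of "Suc m" n] f_zero[of "Suc m" n]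
      by (simp add: f_def X_simps del: E.simps)
  next
    case False
    then have "pk (Suc m) = pk m * (\<eta> / br q (x0 * y0 / q ^ m))" "br q (x0 * y0 / q ^ m) \<noteq> 0"
      using br_J[of m] mn by (simp_all add: pk_def)
    then have "pk m * pl n * Lk m n = - \<eta> * (up (x0 / q ^ m) * br q (x0 * y0 / q ^ m)) / DD m n * (pk (Suc m) * pl n)"
      using \<eta> by (simp add: Lk_def)
    then show ?thesis using km_E[OF v, of m n] by (simp add: f_def X_simps del: E.simps)
  qed
  show "lm m n (f m n) = (\<eta> * (up (x0 / q ^ n) * br q (x0 / (y0 * q ^ n))) / DD m n) \<cdot> f m (Suc n)"
  proof (cases "n = K")
    case True
    then show ?thesis using lm_E[of m n v] E_zero[of m "Suc n"] f_zero[of m "Suc n"]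
      by (simp add: f_def X_simps del: E.simps)
  next
    case False
    then have "pl (Suc n) = pl n * (\<eta> / br q (x0 / (y0 * q ^ n)))" "br q (x0 / (y0 * q ^ n)) \<noteq> 0"
      using br_K[of n] mn by (simp_all add: pl_def)
    then have "pk m * pl n * Ll m n = \<eta> * (up (x0 / q ^ n) * br q (x0 / (y0 * q ^ n))) / DD m n * (pk m * pl (Suc n))"
      using \<eta> by (simp add: Ll_def)
    then show ?thesis using lm_E[of m n v] by (simp add: f_def X_simps del: E.simps)
  qed
  show "kp m n (f m n) = (\<eta> * (up (y0 / q ^ m) * br q (q ^ m)) / DD m n) \<cdot> f (m - 1) n"
  proof (cases m)
    case 0
    then show ?thesis using raising[OF v, of m n] by (simp add: f_def X_simps Uk_def br_def del: E.simps)
  next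
    case (Suc l)
    have "x0 * y0 * q / q ^ Suc l = x0 * y0 / q ^ l" using q_nonzero by simp
    moreover have "pk (Suc l) = pk l * (\<eta> / br q (x0 * y0 / q ^ l))" "br q (x0 * y0 / q ^ l) \<noteq> 0"
      using br_J[of l] mn Suc by (simp_all add: pk_def)
    ultimately have "pk m * pl n * Uk m n = \<eta> * (up (y0 / q ^ m) * br q (q ^ m)) / DD m n * (pk l * pl n)"
      unfolding Suc Uk_def by (simp del: power_Suc)
    then show ?thesis using raising[OF v, of m n] by (simp add: f_def X_simps Suc del: E.simps power_Suc)
  qed
  show "lp m n (f m n) = (- \<eta> * (up (y0 * q ^ n) * br q (q ^ n)) / DD m n) \<cdot> f m (n - 1)"
  proof (cases n)
    case 0
    then show ?thesis using raising[OF v, of m n] by (simp add: f_def X_simps Ul_def br_def del: E.simps)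
  next
    case (Suc l)
    have "x0 * q / (y0 * q ^ Suc l) = x0 / (y0 * q ^ l)" using q_nonzero by simp
    moreover have "pl (Suc l) = pl l * (\<eta> / br q (x0 / (y0 * q ^ l)))" "br q (x0 / (y0 * q ^ l)) \<noteq> 0"
      using br_K[of l] mn Suc by (simp_all add: pl_def)
    ultimately have "pk m * pl n * Ul m n = - \<eta> * (up (y0 * q ^ n) * br q (q ^ n)) / DD m n * (pk m * pl l)"
      unfolding Suc Ul_def by (simp del: power_Suc)
    then show ?thesis using raising[OF v, of m n] by (simp add: f_def X_simps Suc del: E.simps power_Suc)
  qed
qed

lemma B_f:
  assumes mn: "m \<le> J" "n \<le> K"
  shows "B (f m n) = (\<eta> / DD m n) \<cdot> ((up (y0 / q ^ m) * br q (q ^ m)) \<cdot> f (m - 1) n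
     - (up (y0 * q ^ n) * br q (q ^ n)) \<cdot> f m (n - 1)
     + (up (x0 / q ^ n) * br q (x0 / (y0 * q ^ n))) \<cdot> f m (Suc n)
     - (up (x0 / q ^ m) * br q (x0 * y0 / q ^ m)) \<cdot> f (Suc m) n)"
proof -
  have "B (f m n) = kp m n (f m n) + lp m n (f m n) + lm m n (f m n) + km m n (f m n)"
    by (rule B_decomp[OF good_xx good_yy])
  then show ?thesis unfolding km_f[OF mn] lm_f[OF mn] kp_f[OF mn] lp_f[OF mn]
    by (simp add: scale_right_distrib scale_right_diff_distrib)
qed

lemma f_span_invariant:
  defines "W \<equiv> span ((\<lambda>(m, n). f m n) ` ({..J} \<times> {..K}))"
  shows "W \<subseteq> V" "W \<noteq> {0}" "u \<in> W \<Longrightarrow> A u \<in> W \<and> B u \<in> W \<and> C u \<in> W"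
proof -
  show "W \<subseteq> V" unfolding W_def
    by (rule span_minimal[OF _ subspace_V]) (auto simp: f_V)
  have f_W: "f m n \<in> W" for m n
  proof (cases "m \<le> J \<and> n \<le> K")
    case True
    then show ?thesis unfolding W_def by (intro span_base) auto
  next
    case False
    then have "f m n = 0" by (intro f_zero) auto
    then show ?thesis unfolding W_def by (simp add: span_zero)
  qed
  show "W \<noteq> {0}" using f_W[of 0 0] f_nonzero[of 0 0] by auto
  have sub: "subspace W" unfolding W_def by (rule subspace_span)
  have gen: "g u \<in> W" if g: "linear_op sc g" and "\<And>m n. m \<le> J \<Longrightarrow> n \<le> K \<Longrightarrow> g (f m n) \<in> W" and u: "u \<in> W" for g u
  proof -
    have "subspace {u. g u \<in> W}"
      by (rule subspaceI) (use sub in \<open>auto simp: linear_opD[OF g] subspace_0 subspace_add subspace_scale\<close>)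
    moreover have "(\<lambda>(m, n). f m n) ` ({..J} \<times> {..K}) \<subseteq> {u. g u \<in> W}" using that(2) by auto
    ultimately have "W \<subseteq> {u. g u \<in> W}" unfolding W_def by (intro span_minimal) auto
    with u show ?thesis by blast
  qed
  assume u: "u \<in> W"
  have "A u \<in> W" by (rule gen[OF AB.lin_A _ u]) (simp add: f_A subspace_scale[OF sub] f_W)
  moreover have "C u \<in> W" by (rule gen[OF CB.lin_A _ u]) (simp add: f_C subspace_scale[OF sub] f_W)
  moreover have "B u \<in> W"
    by (rule gen[OF AB.lin_B _ u])
      (auto simp: B_f intro!: subspace_scale[OF sub] subspace_add[OF sub] subspace_diff[OF sub] f_W)
  ultimately show "A u \<in> W \<and> B u \<in> W \<and> C u \<in> W" by blast
qed

text \<open>Since x0^2 = -q^(J + K), the point (J - m, K - n) has the labels -1/x and -1/y, hence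
  the weights of (m, n). By \<open>X_mirror\<close> a raising component there is a lowering
  component here. Comparing \<open>kp_f\<close> with \<open>km_f\<close> and \<open>lp_f\<close>
  with \<open>lm_f\<close> carries proportionality from the corner over the lattice, with a change
  of sign at each step.\<close>

lemma mirror:
  assumes x_sq: "x0 ^ 2 = - (q ^ J * q ^ K)" and \<sigma>: "x0 * y0 = \<sigma> * q ^ J" "\<sigma> * \<sigma> = 1"
    and base: "f J K = c \<cdot> f 0 0"
  shows "m \<le> J \<Longrightarrow> n \<le> K \<Longrightarrow> f (J - m) (K - n) = (c * (- 1) ^ (m + n)) \<cdot> f m n"
proof -
  \<comment> \<open>\<open>up\<close> and \<open>br\<close> are odd functions, so signs of arguments
    come out. \<sigma> is the undetermined sign relating x0 y0 to q^J.\<close>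
  have sgn: "up (\<tau> * z) = \<tau> * up z" "br q (\<tau> * z) = \<tau> * br q z" if "\<tau> * \<tau> = 1" for \<tau> z
  proof -
    have neg: "up (- z) = - up z" "br q (- z) = - br q z"
    proof -
      have "- z - 1 / (- z) = - (z - 1 / z)" by simp
      then show "br q (- z) = - br q z" unfolding br_def by (simp only: minus_divide_left)
      show "up (- z) = - up z" by (simp add: up_def)
    qed
    have "\<tau> = 1 \<or> \<tau> = - 1" using that square_eq_1_iff by blast
    then show "up (\<tau> * z) = \<tau> * up z" "br q (\<tau> * z) = \<tau> * br q z"
      using neg by (elim disjE; simp)+
  qed
  have x0: "x0 \<noteq> 0" and y0: "y0 \<noteq> 0" by (rule nz)+
  have qn: "q ^ i \<noteq> 0" for i using q_nonzero by simp
  have s': "y0 * q ^ K = - \<sigma> * x0"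
  proof -
    have "x0 * (y0 * q ^ K) = \<sigma> * (q ^ J * q ^ K)"
      unfolding mult.assoc[symmetric] \<sigma>(1) ..
    also have "q ^ J * q ^ K = - (x0 * x0)" using x_sq by (simp add: power2_eq_square)
    also have "\<sigma> * - (x0 * x0) = x0 * (- \<sigma> * x0)" by simp
    finally show ?thesis using x0 mult_left_cancel by blast
  qed
  have \<sigma>0: "\<sigma> \<noteq> 0" using \<sigma>(2) by auto
  have y_sq: "y0 ^ 2 * q ^ K = - (q ^ J)"
  proof -
    have "y0 ^ 2 * q ^ K = y0 * (y0 * q ^ K)" by (simp add: power2_eq_square)
    also have "\<dots> = - \<sigma> * (x0 * y0)" unfolding s' by simp
    also have "\<dots> = - (q ^ J)" unfolding \<sigma>(1) using \<sigma>(2) by (simp flip: mult.assoc)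
    finally show ?thesis .
  qed
  have lab: "xx (J - m) (K - n) = - 1 / xx m n" "yy (J - m) (K - n) = - 1 / yy m n"
    if mn: "m \<le> J" "n \<le> K" for m n
  proof -
    have d: "q ^ (J - m) = q ^ J / q ^ m" "q ^ (K - n) = q ^ K / q ^ n"
      using mn q_nonzero by (simp_all add: power_diff)
    have jk: "q ^ J * q ^ K = - (x0 * x0)" using x_sq by (simp add: power2_eq_square)
    have "x0 / (q ^ J * q ^ K) = - 1 / x0" unfolding jk using x0 by simp
    moreover have "xx (J - m) (K - n) = x0 / (q ^ J * q ^ K) * (q ^ m * q ^ n)"
      by (simp add: xx_def d)
    moreover have "- 1 / xx m n = - 1 / x0 * (q ^ m * q ^ n)" by (simp add: xx_def)
    ultimately show "xx (J - m) (K - n) = - 1 / xx m n" by (simp only:)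
    have j: "q ^ J = - (y0 * y0 * q ^ K)" using y_sq by (simp add: power2_eq_square)
    have "y0 * q ^ K / q ^ J = - 1 / y0" unfolding j using y0 qn by simp
    moreover have "yy (J - m) (K - n) = y0 * q ^ K / q ^ J * (q ^ m / q ^ n)"
      by (simp add: yy_def d)
    moreover have "- 1 / yy m n = - 1 / y0 * (q ^ m / q ^ n)" by (simp add: yy_def)
    ultimately show "yy (J - m) (K - n) = - 1 / yy m n" by (simp only:)
  qed
  have DD: "DD (J - m) (K - n) = DD m n" if "m \<le> J" "n \<le> K" for m n
    unfolding DD_def lab[OF that] using sgn(1)[of "- 1" "1 / xx m n"] sgn(1)[of "- 1" "1 / yy m n"]
    by (simp add: up_minus)
  have comp: "kp (J - m) (K - n) w = km m n w" "lp (J - m) (K - n) w = lm m n w" if "m \<le> J" "n \<le> K" for m n w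
    unfolding lab[OF that] using X_mirror[of "1 / q" "1 / q" "xx m n" "yy m n" w] X_mirror[of "1 / q" q "xx m n" "yy m n" w]
    by simp_all
  have step_m: "f (J - Suc m) (K - n) = (- d) \<cdot> f (Suc m) n"
    if mn: "m < J" "n \<le> K" and IH: "f (J - m) (K - n) = d \<cdot> f m n" for m n d
  proof -
    have mJ: "m \<le> J" using mn by simp
    define \<kappa> where "\<kappa> = \<eta> * (up (x0 / q ^ m) * br q (x0 * y0 / q ^ m)) / DD m n"
    have "\<kappa> \<noteq> 0" using eta_neq good_up[OF good_inverse_power[OF good_x0]] br_J[OF mn(1)] nz(5) by (simp add: \<kappa>_def)
    have p: "q ^ (J - m) = q ^ J / q ^ m" using mJ q_nonzero by (simp add: power_diff)
    have "y0 / q ^ (J - m) = \<sigma> * (1 / (x0 / q ^ m))"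
      unfolding p using \<sigma>(1) x0 qn \<sigma>0 by (simp add: frac_eq_eq mult_ac)
    then have u: "up (y0 / q ^ (J - m)) = \<sigma> * up (x0 / q ^ m)" by (simp only: sgn[OF \<sigma>(2)] up_minus)
    have "q ^ (J - m) = \<sigma> * (x0 * y0 / q ^ m)"
      unfolding p \<sigma>(1) using \<sigma>(2) by (simp flip: mult.assoc)
    then have b: "br q (q ^ (J - m)) = \<sigma> * br q (x0 * y0 / q ^ m)" by (simp only: sgn[OF \<sigma>(2)])
    have "\<eta> * (up (y0 / q ^ (J - m)) * br q (q ^ (J - m))) / DD (J - m) (K - n) = (\<sigma> * \<sigma>) * \<kappa>"
      unfolding u b DD[OF mJ mn(2)] \<kappa>_def by (simp add: mult_ac)
    then have "kp (J - m) (K - n) (f (J - m) (K - n)) = \<kappa> \<cdot> f (J - Suc m) (K - n)"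
      using kp_f[of "J - m" "K - n"] \<sigma>(2) by simp
    moreover have "kp (J - m) (K - n) (f (J - m) (K - n)) = \<kappa> \<cdot> ((- d) \<cdot> f (Suc m) n)"
      unfolding comp[OF mJ mn(2)] IH X_simps km_f[OF mJ mn(2)] \<kappa>_def by (simp add: mult_ac)
    ultimately show ?thesis using \<open>\<kappa> \<noteq> 0\<close> scale_left_imp_eq by metis
  qed
  have step_n: "f (J - m) (K - Suc n) = (- d) \<cdot> f m (Suc n)"
    if mn: "m \<le> J" "n < K" and IH: "f (J - m) (K - n) = d \<cdot> f m n" for m n d
  proof -
    have nK: "n \<le> K" using mn by simp
    define \<kappa> where "\<kappa> = \<eta> * (up (x0 / q ^ n) * br q (x0 / (y0 * q ^ n))) / DD m n"
    have "\<kappa> \<noteq> 0" using eta_neq good_up[OF good_inverse_power[OF good_x0]] br_K[OF mn(2)] nz(5) by (simp add: \<kappa>_def)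
    have p: "q ^ (K - n) = q ^ K / q ^ n" using nK q_nonzero by (simp add: power_diff)
    have \<tau>: "(- \<sigma>) * (- \<sigma>) = 1" using \<sigma>(2) by simp
    have "y0 * q ^ (K - n) = (- \<sigma>) * (x0 / q ^ n)"
      unfolding p times_divide_eq_right s' ..
    then have u: "up (y0 * q ^ (K - n)) = (- \<sigma>) * up (x0 / q ^ n)" by (simp only: sgn[OF \<tau>])
    have "q ^ K = (- \<sigma>) * (x0 / y0)" using s' y0 by (simp add: field_simps)
    then have "q ^ (K - n) = (- \<sigma>) * (x0 / (y0 * q ^ n))"
      unfolding p by (simp add: field_simps)
    then have b: "br q (q ^ (K - n)) = (- \<sigma>) * br q (x0 / (y0 * q ^ n))" by (simp only: sgn[OF \<tau>])
    have "- \<eta> * (up (y0 * q ^ (K - n)) * br q (q ^ (K - n))) / DD (J - m) (K - n) = - ((\<sigma> * \<sigma>) * \<kappa>)"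
      unfolding u b DD[OF mn(1) nK] \<kappa>_def by (simp add: mult_ac)
    then have "lp (J - m) (K - n) (f (J - m) (K - n)) = (- \<kappa>) \<cdot> f (J - m) (K - Suc n)"
      using lp_f[of "J - m" "K - n"] \<sigma>(2) by simp
    moreover have "lp (J - m) (K - n) (f (J - m) (K - n)) = (- \<kappa>) \<cdot> ((- d) \<cdot> f m (Suc n))"
      unfolding comp[OF mn(1) nK] IH X_simps lm_f[OF mn(1) nK] \<kappa>_def by (simp add: mult_ac)
    ultimately show ?thesis using \<open>\<kappa> \<noteq> 0\<close> scale_left_imp_eq by (metis neg_0_equal_iff_equal)
  qed
  have row: "f (J - m) K = (c * (- 1) ^ m) \<cdot> f m 0" if "m \<le> J" for m
    using that
  proof (induction m)
    case 0
    then show ?case using base by simp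
  next
    case (Suc m)
    then show ?case using step_m[of m 0 "c * (- 1) ^ m"] by simp
  qed
  show "f (J - m) (K - n) = (c * (- 1) ^ (m + n)) \<cdot> f m n" if "m \<le> J" "n \<le> K"
    using that(2)
  proof (induction n)
    case 0
    then show ?case using row[OF that(1)] by simp
  next
    case (Suc n)
    then show ?case using step_n[of m n "c * (- 1) ^ (m + n)"] that(1) by simp
  qed
qed

text \<open>Reflecting the corner twice gives back the same vector; the two factors are c and c
  (-1)^(J + K) = -c.\<close>

lemma mirror_constant:
  assumes "f J K = c \<cdot> f 0 0" and "odd (J + K)"
    and "\<And>m n. m \<le> J \<Longrightarrow> n \<le> K \<Longrightarrow> f (J - m) (K - n) = (c * (- 1) ^ (m + n)) \<cdot> f m n"
  shows "c * c = - 1"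
proof -
  have "f 0 0 = (c * (- 1) ^ (J + K)) \<cdot> f J K" using assms(3)[of J K] by simp
  also have "\<dots> = (- (c * c)) \<cdot> f 0 0" using assms(1,2) by simp
  finally have "f 0 0 + (c * c) \<cdot> f 0 0 = 0" by (simp only: scale_minus_left eq_neg_iff_add_eq_0)
  then have "(1 + c * c) \<cdot> f 0 0 = 0" by (simp add: scale_left_distrib)
  then have "1 + c * c = 0" using f_nonzero[of 0 0] by simp
  then show ?thesis by (simp add: eq_neg_iff_add_eq_0 add.commute)
qed

end

end

end

section \<open>Classification in coordinates\<close>

text \<open>
  Here $m = j - k$ and $n = j' - l$ in terms of $|k,l\rangle$, with $J = 2j$ and $K = 2j'$.  At $m = 0$ and $n = 0$ the truncated
  predecessors \<open>g (m - 1) n\<close> and \<open>g m (n - 1)\<close> have the coefficient \<open>br q 1 = 0\<close>.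
\<close>

definition lattice_basis ::
  "(complex \<Rightarrow> 'v \<Rightarrow> 'v::ab_group_add) \<Rightarrow> complex \<Rightarrow> ('v \<Rightarrow> 'v) \<Rightarrow> ('v \<Rightarrow> 'v) \<Rightarrow> ('v \<Rightarrow> 'v) \<Rightarrow> 'v set
    \<Rightarrow> complex \<Rightarrow> complex \<Rightarrow> complex \<Rightarrow> nat \<Rightarrow> nat \<Rightarrow> (nat \<Rightarrow> nat \<Rightarrow> 'v) \<Rightarrow> bool" where
  "lattice_basis sc q A B C V x0 y0 \<eta> J K g \<longleftrightarrow>
    (\<forall>m n. m \<le> J \<longrightarrow> n \<le> K \<longrightarrow> g m n \<noteq> 0 \<and> g m n \<in> V
      \<and> A (g m n) = sc (wt q (x0 / q ^ m / q ^ n)) (g m n)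
      \<and> C (g m n) = sc (wt q (y0 * q ^ n / q ^ m)) (g m n)
      \<and> B (g m n) = sc (\<eta> / (up (x0 / q ^ m / q ^ n) * up (y0 * q ^ n / q ^ m)))
         (sc (up (y0 / q ^ m) * br q (q ^ m)) (g (m - 1) n)
          - sc (up (y0 * q ^ n) * br q (q ^ n)) (g m (n - 1))
          + sc (up (x0 / q ^ n) * br q (x0 / (y0 * q ^ n))) (g m (Suc n))
          - sc (up (x0 / q ^ m) * br q (x0 * y0 / q ^ m)) (g (Suc m) n)))
    \<and> (\<forall>m n. m > J \<or> n > K \<longrightarrow> g m n = 0)
    \<and> V = module.span sc ((\<lambda>(m, n). g m n) ` ({..J} \<times> {..K}))"

locale so4_irr = so4_ops +
  fixes s :: complex
  assumes s_sq: "s ^ 2 = q" and V_neq: "V \<noteq> {0}"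
    and irr: "\<lbrakk>subspace W; W \<subseteq> V; \<And>u. u \<in> W \<Longrightarrow> A u \<in> W \<and> B u \<in> W \<and> C u \<in> W\<rbrakk> \<Longrightarrow> W = {0} \<or> W = V"
begin

lemma s_neq: "s \<noteq> 0" using s_sq q_nonzero by auto

lemma q_s: "q ^ n = s ^ n * s ^ n"
  unfolding s_sq[symmetric] by (simp add: power2_eq_square power_mult_distrib)

lemma q_s_powi: "q powi k = s powi (2 * k)"
  unfolding s_sq[symmetric] power_int_mult by simp

lemma s_powi_inj: "s powi k = s powi l \<longleftrightarrow> k = l"
proof
  assume "s powi k = s powi l"
  then have "s powi (2 * k) = s powi (2 * l)" by (simp only: mult.commute[of 2] power_int_mult)
  then show "k = l" unfolding q_s_powi[symmetric] q_powi_inj .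
qed simp

definition TOP :: "complex \<Rightarrow> complex \<Rightarrow> bool" where
  "TOP x0 y0 \<longleftrightarrow> so4_top sc q A B C V S x0 y0 \<and> (\<exists>v\<in>ws x0 y0. v \<noteq> 0)"

text \<open>Climb with \<open>A\<close> first. Then \<open>C\<close> preserves the top eigenspace of
  \<open>A\<close> and has an eigenvector there.\<close>

lemma TOP_exists:
  assumes x: "x \<noteq> 0" and v: "v \<in> V" "v \<noteq> 0" "A v = wt q x \<cdot> v"
  shows "\<exists>r y0. TOP (x * q ^ r) y0"
proof -
  obtain r v' where v': "v' \<in> V" "v' \<noteq> 0" "A v' = wt q (x * q ^ r) \<cdot> v'"
    "\<And>u. u \<in> V \<Longrightarrow> A u = wt q (q * (x * q ^ r)) \<cdot> u \<Longrightarrow> u = 0"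
    using AB.climb[OF finite_S V_span x v] by blast
  define U where "U = {u \<in> V. A u = wt q (x * q ^ r) \<cdot> u}"
  have "\<exists>w\<in>U. w \<noteq> 0 \<and> (\<exists>c. C w = c \<cdot> w)"
  proof (rule eigenvector_exists[OF finite_S _ _ _ CB.lin_A])
    show "subspace U" unfolding U_def
      by (rule subspaceI) (use subspace_V in \<open>auto simp: subspace_0 subspace_add subspace_scale A_simps scale_right_distrib mult.commute\<close>)
    show "U \<subseteq> span S" using V_span by (auto simp: U_def)
    show "U \<noteq> {0}" using v' by (auto simp: U_def)
    show "u \<in> U \<Longrightarrow> C u \<in> U" for u by (simp add: U_def C_V AC C_simps)
  qed
  then obtain w c where w: "w \<in> V" "w \<noteq> 0" "A w = wt q (x * q ^ r) \<cdot> w" "C w = c \<cdot> w" by (auto simp: U_def)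
  obtain y where y: "y \<noteq> 0" "wt q y = c" using wt_inj_exists by blast
  have "good (x * q ^ r)" using eigenvalue_good[OF w(1,2), of "x * q ^ r"] w(3) x q_nonzero by auto
  moreover have "good y" using eigenvalue_good[OF w(1,2) y(1)] w(4) y(2) by auto
  ultimately have "so4_top sc q A B C V S (x * q ^ r) y"
    by (intro so4_top.intro so4_ops_axioms so4_top_axioms.intro v'(4))
  then have "TOP (x * q ^ r) y" unfolding TOP_def ws_def using w y by auto
  then show ?thesis by blast
qed

text \<open>The same vector with the other label of its weight for \<open>C\<close>. Since x0 y0 and
  x0/y0 are exchanged up to sign, the lengths J and K change places.\<close>

lemma TOP_flip:
  assumes "TOP x0 y0"
  shows "TOP x0 (- 1 / y0)"
proof -
  interpret T: so4_top sc q A B C V S x0 y0 using assms by (simp add: TOP_def)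
  have ws: "ws x0 (- 1 / y0) = ws x0 y0" unfolding ws_def wt_minus_inverse ..
  obtain v where v: "v \<in> ws x0 y0" "v \<noteq> 0" using assms by (auto simp: TOP_def)
  have "C v = wt q (- 1 / y0) \<cdot> v" unfolding wt_minus_inverse using wsD(3)[OF v(1)] .
  then have "good (- 1 / y0)"
    using eigenvalue_good[OF wsD(1)[OF v(1)] v(2), of "- 1 / y0"] T.nz(2) by simp
  then have "so4_top sc q A B C V S x0 (- 1 / y0)"
    by (intro so4_top.intro so4_ops_axioms so4_top_axioms.intro T.good_x0 T.top)
  then show ?thesis unfolding TOP_def ws using v by blast
qed

lemma TOP_lengths: "TOP x0 y0 \<Longrightarrow> \<exists>J K. (x0 * y0) ^ 2 = (q ^ J) ^ 2 \<and> (x0 / y0) ^ 2 = (q ^ K) ^ 2"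
  using so4_top.chain_lengths unfolding TOP_def by blast

lemma TOP_neq: "TOP x0 y0 \<Longrightarrow> x0 \<noteq> 0 \<and> y0 \<noteq> 0 \<and> good x0"
proof -
  assume "TOP x0 y0"
  then interpret T: so4_top sc q A B C V S x0 y0 by (simp add: TOP_def)
  show ?thesis using T.nz(1,2) T.good_x0 by blast
qed

lemma TOP_x4:
  assumes "TOP x0 y0" "(x0 * y0) ^ 2 = (q ^ J) ^ 2" "(x0 / y0) ^ 2 = (q ^ K) ^ 2"
  shows "(x0 ^ 2) ^ 2 = (q ^ (J + K)) ^ 2"
proof -
  have "x0 ^ 2 = (x0 * y0) * (x0 / y0)" using TOP_neq[OF assms(1)] by (simp add: power2_eq_square)
  then have "(x0 ^ 2) ^ 2 = (x0 * y0) ^ 2 * (x0 / y0) ^ 2" by (metis power_mult_distrib)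
  then show ?thesis unfolding assms(2,3) by (simp add: power_add power_mult_distrib)
qed

lemma TOP_y:
  assumes "x0 = \<iota> * s ^ (J + K)" "\<iota> \<noteq> 0" "(x0 * y0) ^ 2 = (q ^ J) ^ 2"
  shows "y0 = 1 / \<iota> * (s ^ J / s ^ K) \<or> y0 = - (1 / \<iota> * (s ^ J / s ^ K))"
proof -
  have x0: "x0 \<noteq> 0" using assms s_neq by simp
  have "x0 * y0 = q ^ J \<or> x0 * y0 = - (q ^ J)" using assms(3) by (simp only: power2_eq_iff)
  then have "y0 = q ^ J / x0 \<or> y0 = - (q ^ J / x0)" using x0 by (auto simp: field_simps)
  moreover have "q ^ J / x0 = 1 / \<iota> * (s ^ J / s ^ K)"
    unfolding assms(1) q_s power_add using s_neq assms(2) by (simp add: field_simps)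
  ultimately show ?thesis by simp
qed

text \<open>By \<open>TOP_x4\<close>, x0^2 is plus or minus q^(J + K). The plus sign leads to the
  classical case; the minus sign, with J + K odd by goodness, to the nonclassical one.
  \<open>TOP_flip\<close> settles the sign of y0 in the former and the order of J and K in the
  latter.\<close>

lemma classification_numbers:
  "\<exists>x0 y0 J K. TOP x0 y0 \<and> (x0 * y0) ^ 2 = (q ^ J) ^ 2 \<and> (x0 / y0) ^ 2 = (q ^ K) ^ 2 \<and>
    (x0 = s ^ (J + K) \<and> y0 = s ^ J / s ^ K \<or>
     (\<exists>\<iota> \<iota>'. \<iota> * \<iota> = - 1 \<and> \<iota>' * \<iota>' = - 1 \<and> x0 = \<iota> * s ^ (J + K) \<and> y0 = \<iota>' * (s ^ J / s ^ K) \<and> odd (J + K) \<and> K \<le> J))"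
proof -
  obtain v c where "v \<in> V" "v \<noteq> 0" "A v = c \<cdot> v"
    using eigenvector_exists[OF finite_S subspace_V V_span V_neq AB.lin_A A_V] by blast
  moreover obtain x where "x \<noteq> 0" "wt q x = c" using wt_inj_exists by blast
  ultimately obtain x1 y1 where T1: "TOP x1 y1" using TOP_exists by metis
  obtain J1 K1 where J1: "(x1 * y1) ^ 2 = (q ^ J1) ^ 2" and K1: "(x1 / y1) ^ 2 = (q ^ K1) ^ 2"
    using TOP_lengths[OF T1] by blast
  have x1: "x1 \<noteq> 0" "good x1" and y1: "y1 \<noteq> 0" using TOP_neq[OF T1] by auto
  have flip: "(x0 * (- 1 / y0)) ^ 2 = (x0 / y0) ^ 2" "(x0 / (- 1 / y0)) ^ 2 = (x0 * y0) ^ 2" for x0 y0 :: complex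
    by simp_all
  have "x1 ^ 2 = q ^ (J1 + K1) \<or> x1 ^ 2 = - (q ^ (J1 + K1))"
    using TOP_x4[OF T1 J1 K1] by (simp only: power2_eq_iff)
  then show ?thesis
  proof
    assume "x1 ^ 2 = q ^ (J1 + K1)"
    then have "x1 ^ 2 = (s ^ (J1 + K1)) ^ 2" unfolding q_s by (simp add: power2_eq_square)
    then have "x1 = s ^ (J1 + K1) \<or> x1 = - (s ^ (J1 + K1))" by (simp only: power2_eq_iff)
    \<comment> \<open>The label -s^(J1 + K1) has the same weight as s^(-J1 - K1). Since climbing
      depends on the label and not only on the weight, it is started anew from the power of s and
      may end at other values of J and K.\<close>
    then have "\<exists>k. wt q x1 = wt q (s powi k)"
    proof
      assume "x1 = s ^ (J1 + K1)"
      then show ?thesis by (intro exI[of _ "int (J1 + K1)"]) (simp only: power_int_of_nat)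
    next
      assume "x1 = - (s ^ (J1 + K1))"
      then have "- 1 / x1 = s powi (- int (J1 + K1))"
        unfolding power_int_minus power_int_of_nat by (simp add: divide_inverse)
      then show ?thesis using wt_minus_inverse[of x1] by metis
    qed
    then obtain k where k: "wt q x1 = wt q (s powi k)" by blast
    obtain w where "w \<in> ws x1 y1" "w \<noteq> 0" using T1 by (auto simp: TOP_def)
    then have "w \<in> V" "w \<noteq> 0" "A w = wt q (s powi k) \<cdot> w" using k by (auto dest: wsD)
    then obtain r y2 where T2: "TOP (s powi k * q ^ r) y2"
      using TOP_exists[of "s powi k" w] s_neq by (metis power_int_eq_0_iff)
    define l where "l = k + 2 * int r"
    have l: "s powi k * q ^ r = s powi l"
      unfolding l_def power_int_of_nat[symmetric] q_s_powi by (rule power_int_add[symmetric]) (use s_neq in simp)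
    define x2 where "x2 = s powi l"
    have T2: "TOP x2 y2" using T2 unfolding l x2_def .
    obtain J K where J: "(x2 * y2) ^ 2 = (q ^ J) ^ 2" and K: "(x2 / y2) ^ 2 = (q ^ K) ^ 2"
      using TOP_lengths[OF T2] by blast
    have "(x2 ^ 2) ^ 2 = (q ^ (J + K)) ^ 2" by (rule TOP_x4[OF T2 J K])
    then have "s powi (l * 4) = s powi (int (J + K) * 4)"
    proof -
      have "s powi (l * 4) = (x2 ^ 2) ^ 2" unfolding x2_def power_int_mult by (simp flip: power_mult)
      moreover have "s powi (int (J + K) * 4) = (q ^ (J + K)) ^ 2"
        unfolding power_int_mult power_int_of_nat q_s by (simp add: mult.commute flip: power_mult power2_eq_square)
      ultimately show ?thesis using \<open>(x2 ^ 2) ^ 2 = (q ^ (J + K)) ^ 2\<close> by simp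
    qed
    then have "l = int (J + K)" unfolding s_powi_inj by simp
    then have x2: "x2 = s ^ (J + K)" unfolding x2_def by (simp only: power_int_of_nat)
    from TOP_y[of x2 1 J K y2] x2 J
    have "y2 = s ^ J / s ^ K \<or> y2 = - (s ^ J / s ^ K)" by simp
    then show ?thesis
    proof
      assume "y2 = s ^ J / s ^ K"
      then show ?thesis using T2 J K x2 by blast
    next
      assume "y2 = - (s ^ J / s ^ K)"
      then have "- 1 / y2 = s ^ K / s ^ J" by simp
      moreover have "x2 = s ^ (K + J)" using x2 by (simp add: add.commute)
      ultimately show ?thesis using TOP_flip[OF T2] J K flip[of x2 y2] by metis
    qed
  next
    assume sq: "x1 ^ 2 = - (q ^ (J1 + K1))"
    have "odd (J1 + K1)"
    proof
      assume "even (J1 + K1)"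
      then obtain e where "J1 + K1 = 2 * e" by blast
      then have "q ^ (J1 + K1) = q powi (2 * int e)" by (metis power_int_of_nat of_nat_mult of_nat_numeral)
      with x1(2) sq show False unfolding good_def by metis
    qed
    \<comment> \<open>The quotients of the top labels by their classical values are square roots of
      -1; they turn i [m] into a sign times [m]_+.\<close>
    define \<iota> where "\<iota> = x1 / s ^ (J1 + K1)"
    have x1': "x1 = \<iota> * s ^ (J1 + K1)" using s_neq by (simp add: \<iota>_def)
    have "\<iota> * \<iota> = x1 ^ 2 / q ^ (J1 + K1)" unfolding \<iota>_def q_s power2_eq_square by simp
    then have \<iota>: "\<iota> * \<iota> = - 1" unfolding sq using q_nonzero by simp
    then have \<iota>0: "\<iota> \<noteq> 0" by auto
    define \<iota>' where "\<iota>' = y1 / (s ^ J1 / s ^ K1)"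
    have y1': "y1 = \<iota>' * (s ^ J1 / s ^ K1)" using s_neq by (simp add: \<iota>'_def)
    have "\<iota>' = 1 / \<iota> \<or> \<iota>' = - (1 / \<iota>)"
      using TOP_y[OF x1' \<iota>0 J1] s_neq unfolding \<iota>'_def by auto
    then have \<iota>': "\<iota>' * \<iota>' = - 1" using \<iota> by auto
    show ?thesis
    proof (cases "K1 \<le> J1")
      case True
      then show ?thesis using T1 J1 K1 \<iota> \<iota>' x1' y1' \<open>odd (J1 + K1)\<close> by blast
    next
      case False
      have "\<iota>' \<noteq> 0" using \<iota>' by auto
      have "- 1 / \<iota>' = \<iota>'" unfolding \<iota>'[symmetric] using \<open>\<iota>' \<noteq> 0\<close> by simp
      moreover have "- 1 / y1 = (- 1 / \<iota>') * (s ^ K1 / s ^ J1)" unfolding y1' by simp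
      ultimately have "- 1 / y1 = \<iota>' * (s ^ K1 / s ^ J1)" by simp
      moreover have "x1 = \<iota> * s ^ (K1 + J1)" using x1' by (simp add: add.commute)
      moreover have "odd (K1 + J1)" "J1 \<le> K1" using \<open>odd (J1 + K1)\<close> False by auto
      ultimately show ?thesis using TOP_flip[OF T1] J1 K1 flip[of x1 y1] \<iota> \<iota>' by metis
    qed
  qed
qed

lemma lattice_basis_exists:
  assumes T: "so4_top sc q A B C V S x0 y0" and v: "v \<in> ws x0 y0" "v \<noteq> 0"
    and J: "(x0 * y0) ^ 2 = (q ^ J) ^ 2" and K: "(x0 / y0) ^ 2 = (q ^ K) ^ 2" and \<eta>: "\<eta> * \<eta> = 1"
  shows "lattice_basis sc q A B C V x0 y0 \<eta> J K (so4_top.f sc q A B C x0 y0 v \<eta>)"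
proof -
  interpret T: so4_top sc q A B C V S x0 y0 by (rule T)
  note ctx = v J K \<eta>
  note inv = T.f_span_invariant[OF ctx]
  have "V = span ((\<lambda>(m, n). T.f v \<eta> m n) ` ({..J} \<times> {..K}))"
    using irr[OF subspace_span inv(1) inv(3)] inv(2) by blast
  then show ?thesis
    unfolding lattice_basis_def
    using T.f_nonzero[OF ctx] T.f_V[OF ctx] T.f_zero[OF ctx] T.f_A[OF ctx] T.f_C[OF ctx] T.B_f[OF ctx]
    unfolding T.xx_def T.yy_def T.DD_def by blast
qed

theorem classification:
  "(\<exists>J K g. lattice_basis sc q A B C V (s ^ (J + K)) (s ^ J / s ^ K) 1 J K g) \<or>
   (\<exists>J K g \<iota> \<iota>' c. \<iota> * \<iota> = - 1 \<and> \<iota>' * \<iota>' = - 1 \<and> c * c = - 1 \<and> odd (J + K) \<and> K \<le> J \<and>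
      lattice_basis sc q A B C V (\<iota> * s ^ (J + K)) (\<iota>' * (s ^ J / s ^ K)) (\<i> * \<iota>) J K g \<and>
      (\<forall>m n. m \<le> J \<longrightarrow> n \<le> K \<longrightarrow> g (J - m) (K - n) = (c * (- 1) ^ (m + n)) \<cdot> g m n))"
proof -
  obtain x0 y0 J K where T: "TOP x0 y0" and J: "(x0 * y0) ^ 2 = (q ^ J) ^ 2" and K: "(x0 / y0) ^ 2 = (q ^ K) ^ 2"
    and cases: "x0 = s ^ (J + K) \<and> y0 = s ^ J / s ^ K \<or>
     (\<exists>\<iota> \<iota>'. \<iota> * \<iota> = - 1 \<and> \<iota>' * \<iota>' = - 1 \<and> x0 = \<iota> * s ^ (J + K) \<and> y0 = \<iota>' * (s ^ J / s ^ K) \<and> odd (J + K) \<and> K \<le> J)"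
    using classification_numbers by blast
  have top: "so4_top sc q A B C V S x0 y0" using T by (simp add: TOP_def)
  interpret T: so4_top sc q A B C V S x0 y0 by (rule top)
  obtain v0 where v0: "v0 \<in> ws x0 y0" "v0 \<noteq> 0" using T by (auto simp: TOP_def)
  from cases show ?thesis
  proof (elim disjE exE conjE)
    assume xy: "x0 = s ^ (J + K)" "y0 = s ^ J / s ^ K"
    show ?thesis using lattice_basis_exists[OF top v0 J K, of 1] unfolding xy by auto
  next
    fix \<iota> \<iota>' assume \<iota>: "\<iota> * \<iota> = - 1" "\<iota>' * \<iota>' = - 1" and xy: "x0 = \<iota> * s ^ (J + K)" "y0 = \<iota>' * (s ^ J / s ^ K)"
      and JK: "odd (J + K)" "K \<le> J"
    have x_sq: "x0 ^ 2 = - (q ^ J * q ^ K)"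
    proof -
      have "x0 ^ 2 = (\<iota> * \<iota>) * (q ^ (J + K))" unfolding xy q_s by (simp add: power2_eq_square mult_ac)
      then show ?thesis by (simp add: \<iota> power_add)
    qed
    have y_sq: "y0 ^ 2 * q ^ K = - (q ^ J)"
    proof -
      have "y0 ^ 2 * q ^ K = (\<iota>' * \<iota>') * (q ^ J)" unfolding xy q_s using s_neq by (simp add: power2_eq_square mult_ac)
      then show ?thesis by (simp add: \<iota>)
    qed
    have xyJ: "x0 * y0 = (\<iota> * \<iota>') * q ^ J"
      unfolding xy q_s power_add using s_neq by (simp add: mult_ac)
    have sig: "(\<iota> * \<iota>') * (\<iota> * \<iota>') = 1"
    proof -
      have "(\<iota> * \<iota>') * (\<iota> * \<iota>') = (\<iota> * \<iota>) * (\<iota>' * \<iota>')" by (simp add: mult_ac)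
      then show ?thesis unfolding \<iota> by simp
    qed
    have eta: "(\<i> * \<iota>) * (\<i> * \<iota>) = 1"
    proof -
      have "(\<i> * \<iota>) * (\<i> * \<iota>) = (\<i> * \<i>) * (\<iota> * \<iota>)" by (simp only: mult_ac)
      then show ?thesis unfolding \<iota> by simp
    qed
    \<comment> \<open>The opposite corner has the labels -1/x0 and -1/y0, so v -> E v J K maps the
      top weight space into itself.\<close>
    have lab: "wt q (T.xx J K) = wt q x0" "wt q (T.yy J K) = wt q y0"
    proof -
      have jk: "q ^ J * q ^ K = - (x0 * x0)" using x_sq by (simp add: power2_eq_square)
      have "T.xx J K = x0 / (q ^ J * q ^ K)" by (simp add: T.xx_def)
      also have "\<dots> = - 1 / x0" unfolding jk using T.nz(1) by simp
      finally show "wt q (T.xx J K) = wt q x0" using wt_minus_inverse by simp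
      have j: "q ^ J = - (y0 * y0 * q ^ K)" using y_sq by (simp add: power2_eq_square)
      have "T.yy J K = - 1 / y0" unfolding T.yy_def j using T.nz(2) q_nonzero by simp
      then show "wt q (T.yy J K) = wt q y0" using wt_minus_inverse by simp
    qed
    have "\<exists>w\<in>ws x0 y0. w \<noteq> 0 \<and> (\<exists>c. T.E w J K = c \<cdot> w)"
    proof (rule eigenvector_exists[OF finite_S subspace_ws])
      show "ws x0 y0 \<subseteq> span S" using V_span by (auto simp: ws_def)
      show "ws x0 y0 \<noteq> {0}" using v0 by auto
      show "linear_op sc (\<lambda>w. T.E w J K)" by (rule T.linear_E)
      show "u \<in> ws x0 y0 \<Longrightarrow> T.E u J K \<in> ws x0 y0" for u
        using T.E_ws[of u J K] lab unfolding ws_def by simp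
    qed
    then obtain v \<omega> where v: "v \<in> ws x0 y0" "v \<noteq> 0" and \<omega>: "T.E v J K = \<omega> \<cdot> v" by blast
    define g where "g = T.f v (\<i> * \<iota>)"
    note ctx = v J K eta
    define c where "c = T.pk (\<i> * \<iota>) J * T.pl (\<i> * \<iota>) K * \<omega>"
    have base: "T.f v (\<i> * \<iota>) J K = c \<cdot> T.f v (\<i> * \<iota>) 0 0"
      unfolding T.f_00[OF ctx] unfolding T.f_def[OF ctx] \<omega> c_def by simp
    have mir: "T.f v (\<i> * \<iota>) (J - m) (K - n) = (c * (- 1) ^ (m + n)) \<cdot> T.f v (\<i> * \<iota>) m n" if "m \<le> J" "n \<le> K" for m n
      by (rule T.mirror[OF ctx x_sq xyJ sig base that])
    have "c * c = - 1" by (rule T.mirror_constant[OF ctx base JK(1) mir])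
    moreover have "lattice_basis sc q A B C V x0 y0 (\<i> * \<iota>) J K g"
      unfolding g_def by (rule lattice_basis_exists[OF top v J K eta])
    ultimately show ?thesis using \<iota> JK mir unfolding xy g_def by blast
  qed
qed

end

section \<open>From representations to operators and back\<close>

lemma cls_hom: "cls q \<in> ring_hom free_ring (Uq_so4 q)"
  using ideal.rcos_ring_hom[OF ideal_so4_ideal[of q]] unfolding Uq_so4_def cls_def .

lemma cls_mult: "cls q x \<otimes>\<^bsub>Uq_so4 q\<^esub> cls q y = cls q (x * y)"
  using ring_hom_mult[OF cls_hom, of x y q] by (simp add: free_ring_def)

lemma cls_add: "cls q x \<oplus>\<^bsub>Uq_so4 q\<^esub> cls q y = cls q (x + y)"
  using ring_hom_add[OF cls_hom, of x y q] by (simp add: free_ring_def)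

lemma cls_one: "\<one>\<^bsub>Uq_so4 q\<^esub> = cls q 1"
  using ring_hom_one[OF cls_hom, of q] by (simp add: free_ring_def)

lemma cls_carrier: "cls q x \<in> carrier (Uq_so4 q)"
  by (simp add: carrier_Uq_so4)

lemma cls_relator:
  assumes "r \<in> so4_relators q"
  shows "cls q r = cls q 0"
proof -
  interpret I: ideal "so4_ideal q" free_ring by (rule ideal_so4_ideal)
  have "r \<in> so4_ideal q"
    unfolding so4_ideal_def
    using ring.genideal_self[OF ring_free_ring, of "so4_relators q"] assms by (auto simp: free_ring_def)
  moreover have "0 \<in> so4_ideal q" using additive_subgroup.zero_closed[OF ideal.axioms(1)[OF ideal_so4_ideal[of q]]] by (simp add: free_ring_def)
  ultimately show ?thesis unfolding cls_def by (simp add: I.a_rcos_const)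
qed

context so4_rep
begin

definition op :: "free_alg \<Rightarrow> 'v \<Rightarrow> 'v" where "op x v = \<rho> (cls q x) v"

lemma op_V: "v \<in> V \<Longrightarrow> op x v \<in> V"
  unfolding op_def by (rule maps_to[OF cls_carrier])

lemma op_lin: "v \<in> V \<Longrightarrow> w \<in> V \<Longrightarrow> op x (v + w) = op x v + op x w" "v \<in> V \<Longrightarrow> op x (scale c v) = scale c (op x v)"
  unfolding op_def by (rule op_add[OF cls_carrier] op_scale[OF cls_carrier]; assumption)+

lemma op_alg:
  assumes "v \<in> V"
  shows "op (x * y) v = op x (op y v)" "op (x + y) v = op x v + op y v" "op 1 v = v"
    "op (scalar c * x) v = scale c (op x v)" "op 0 v = 0" "op (x - y) v = op x v - op y v"
    "op (scalar c) v = scale c v"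
proof -
  show "op (x * y) v = op x (op y v)"
    unfolding op_def using rep_mult[OF cls_carrier cls_carrier assms, of x y] by (simp add: cls_mult)
  show add: "op (x + y) v = op x v + op y v" for x y
    unfolding op_def using rep_add[OF cls_carrier cls_carrier assms, of x y] by (simp add: cls_add)
  show one: "op 1 v = v"
    unfolding op_def using rep_one[OF assms] by (simp add: cls_one)
  show scal: "op (scalar c * x) v = scale c (op x v)" for x
    unfolding op_def using rep_scale[OF cls_carrier assms, of c x] by (simp add: cls_mult)
  show "op 0 v = 0" using add[of 0 0] by simp
  show "op (x - y) v = op x v - op y v" using add[of "x - y" y] by simp
  show "op (scalar c) v = scale c v" using scal[of 1] one by simp
qed

lemma op_relator: "r \<in> so4_relators q \<Longrightarrow> v \<in> V \<Longrightarrow> op r v = 0"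
  using cls_relator[of r q] op_alg(5)[of v] unfolding op_def by simp

lemma serre:
  assumes "serre_relator q x y \<in> so4_relators q" and v: "v \<in> V"
  shows "op (gen x) (op (gen y) (op (gen y) v)) - scale (q + 1 / q) (op (gen y) (op (gen x) (op (gen y) v)))
    + op (gen y) (op (gen y) (op (gen x) v)) = - op (gen x) v"
proof -
  have "0 = op (serre_relator q x y) v" using op_relator[OF assms] by simp
  also have "\<dots> = op (gen x) (op (gen y) (op (gen y) v)) - scale (q + 1 / q) (op (gen y) (op (gen x) (op (gen y) v)))
    + op (gen y) (op (gen y) (op (gen x) v)) + op (gen x) v"
    unfolding serre_relator_def power2_eq_square
    by (simp add: op_alg op_V v mult.assoc inverse_eq_divide)
  finally show ?thesis by (simp add: eq_neg_iff_add_eq_0)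
qed

lemma commute: "v \<in> V \<Longrightarrow> op (gen I21) (op (gen I43) v) = op (gen I43) (op (gen I21) v)"
  using op_relator[of "gen I21 * gen I43 - gen I43 * gen I21" v] by (simp add: so4_relators_def op_alg op_V)

text \<open>Every class has a representative in the free algebra, which is a sum of scaled words,
  and a word acts as the composition of its letters.\<close>

lemma invariant_if_gen_invariant:
  assumes W: "subspace W" "W \<subseteq> V" and gen: "\<And>g w. w \<in> W \<Longrightarrow> op (gen g) w \<in> W" and a: "a \<in> carrier (Uq_so4 q)" and w: "w \<in> W"
  shows "\<rho> a w \<in> W"
proof -
  have single: "op (Poly_Mapping.single u c) w \<in> W" for u c
  proof -
    obtain us where "u = Word us" by (cases u)
    moreover have "op (Poly_Mapping.single (Word us) c) w \<in> W"
    proof (induction us)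
      case Nil
      have "Poly_Mapping.single (Word []) c = scalar c * 1" by (simp add: scalar_def zero_word_def)
      then show ?case using op_alg(4)[of w c 1] op_alg(3)[of w] w W by (auto simp: subspace_scale)
    next
      case (Cons g us)
      have "Poly_Mapping.single (Word (g # us)) c = gen g * Poly_Mapping.single (Word us) c"
        by (simp add: gen_def mult_single)
      then show ?case using op_alg(1)[of w] w W(2) gen[OF Cons] by auto
    qed
    ultimately show ?thesis by simp
  qed
  have sums: "op (\<Sum>i\<in>F. p i) w = (\<Sum>i\<in>F. op (p i) w)" for p :: "so4_gen word \<Rightarrow> free_alg" and F
    by (induction F rule: infinite_finite_induct) (use op_alg w W(2) in auto)
  obtain x where x: "a = cls q x" using a by (auto simp: carrier_Uq_so4)
  have "x = (\<Sum>u\<in>Poly_Mapping.keys x. Poly_Mapping.single u (Poly_Mapping.lookup x u))"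
    by (rule poly_mapping_eqI) (simp add: lookup_sum lookup_single when_def in_keys_iff)
  then have "op x w = (\<Sum>u\<in>Poly_Mapping.keys x. op (Poly_Mapping.single u (Poly_Mapping.lookup x u)) w)"
    using sums by metis
  then have "op x w \<in> W" using single W(1) by (simp add: subspace_sum)
  then show ?thesis by (simp add: x op_def)
qed

end

text \<open>A representation on \<open>V\<close> says nothing about other vectors, while the locales
  ask for relations on the whole type. Precomposing with a linear projection \<pi> onto
  \<open>V\<close> provides them: all values lie in \<open>V\<close>, where \<pi> is the
  identity.\<close>

lemma irreducible_gives_operators:
  assumes q: "q \<noteq> 0" "\<And>n::nat. n > 0 \<Longrightarrow> q ^ n \<noteq> 1" and s: "s ^ 2 = q"
    and irr: "irreducible_so4_rep sc q V \<rho>" and fin: "finite_dim_space sc V"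
  obtains A B C S where "so4_irr sc q A B C V S s"
    "\<And>v. v \<in> V \<Longrightarrow> \<rho> (cls q (gen I21)) v = A v" "\<And>v. v \<in> V \<Longrightarrow> \<rho> (cls q (gen I32)) v = B v"
    "\<And>v. v \<in> V \<Longrightarrow> \<rho> (cls q (gen I43)) v = C v"
proof -
  have rep: "so4_rep sc q V \<rho>" using irr by (simp add: irreducible_so4_rep_def)
  interpret R: so4_rep sc q V \<rho> by (rule rep)
  interpret VS: vector_space_pair sc sc by unfold_locales
  obtain S where S: "finite S" "R.span S = V" using fin by (auto simp: finite_dim_space_def)
  obtain \<pi> where \<pi>: "range \<pi> \<subseteq> V" "Vector_Spaces.linear sc sc \<pi>" "\<And>v. v \<in> V \<Longrightarrow> \<pi> v = v"
    using VS.linear_exists_left_inverse_on[OF _ R.subspace_V, of id]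
    by (auto simp: R.linear_id)
  have \<pi>V: "\<pi> v \<in> V" for v using \<pi>(1) by blast
  define Gop where "Gop g v = R.op (gen g) (\<pi> v)" for g v
  have Gop_V: "Gop g v \<in> V" for g v unfolding Gop_def by (rule R.op_V[OF \<pi>V])
  have Gop_eq: "v \<in> V \<Longrightarrow> Gop g v = R.op (gen g) v" for g v by (simp add: Gop_def \<pi>(3))
  have linear_Gop: "linear_op sc (Gop g)" for g
    using \<pi>(2) by (simp add: linear_op_def Gop_def Vector_Spaces.linear_iff R.op_lin \<pi>V)
  have OO: "Gop g (Gop h v) = R.op (gen g) (R.op (gen h) (\<pi> v))" for g h v
    by (simp add: Gop_def \<pi>(3) R.op_V \<pi>V)
  have OOO: "Gop i (Gop g (Gop h v)) = R.op (gen i) (R.op (gen g) (R.op (gen h) (\<pi> v)))" for i g h v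
    by (simp add: Gop_def \<pi>(3) R.op_V \<pi>V)
  have serre: "Gop x (Gop y (Gop y v)) - sc (q + 1 / q) (Gop y (Gop x (Gop y v))) + Gop y (Gop y (Gop x v)) = - Gop x v"
    if "serre_relator q x y \<in> so4_relators q" for x y v
    unfolding OOO using R.serre[OF that \<pi>V] unfolding Gop_def .
  have "so4_irr sc q (Gop I21) (Gop I32) (Gop I43) V S s"
  proof (intro so4_irr.intro so4_ops.intro so4_ops_axioms.intro so4_irr_axioms.intro so3_pair.intro so3_pair_axioms.intro)
    show "cvs sc" "cvs sc" "cvs sc" by (unfold_locales)
    show "generic_q q" "generic_q q" "generic_q q" using q by (unfold_locales) auto
    show "Gop I21 (Gop I43 v) = Gop I43 (Gop I21 v)" for v unfolding OO by (rule R.commute[OF \<pi>V])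
    show "R.subspace V" by (rule R.subspace_V)
    show "finite S" "V \<subseteq> R.span S" using S by auto
    show "s ^ 2 = q" by (rule s)
    show "V \<noteq> {0}" using irr by (simp add: irreducible_so4_rep_def)
  next
    fix W assume W: "R.subspace W" "W \<subseteq> V" and inv: "\<And>u. u \<in> W \<Longrightarrow> Gop I21 u \<in> W \<and> Gop I32 u \<in> W \<and> Gop I43 u \<in> W"
    have "R.op (gen g) w \<in> W" if "w \<in> W" for g w
      using inv[OF that] Gop_eq[of w] W(2) that by (cases g) auto
    then have "\<forall>a\<in>carrier (Uq_so4 q). \<rho> a ` W \<subseteq> W"
      using R.invariant_if_gen_invariant[OF W] by blast
    then show "W = {0} \<or> W = V" using irr W by (simp add: irreducible_so4_rep_def)
  qed (intro linear_Gop serre Gop_V; simp add: so4_relators_def)+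
  then show thesis by (rule that) (simp_all add: Gop_eq R.op_def)
qed

text \<open>\<Phi> goes from the model U to V. The action is pulled back along it, and each identity
  in U is checked after applying \<Phi>, by injectivity.\<close>

lemma transport_rep:
  fixes sc :: "complex \<Rightarrow> 'v::ab_group_add \<Rightarrow> 'v" and sc' :: "complex \<Rightarrow> 'w::ab_group_add \<Rightarrow> 'w"
  assumes irr: "irreducible_so4_rep sc q V \<rho>" and vs: "vector_space sc'" and U: "module.subspace sc' U"
    and bij: "bij_betw \<Phi> U V" and add: "\<And>u w. \<Phi> (u + w) = \<Phi> u + \<Phi> w" and scl: "\<And>c u. \<Phi> (sc' c u) = sc c (\<Phi> u)"
  shows "\<exists>R. irreducible_so4_rep sc' q U R \<and> equivalent_so4_rep q sc V \<rho> sc' U R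
    \<and> (\<forall>a\<in>carrier (Uq_so4 q). \<forall>u\<in>U. R a u \<in> U \<and> \<Phi> (R a u) = \<rho> a (\<Phi> u))"
proof -
  have rep: "so4_rep sc q V \<rho>" using irr by (simp add: irreducible_so4_rep_def)
  interpret P: so4_rep sc q V \<rho> by (rule rep)
  interpret U: vector_space sc' by (rule vs)
  define T where "T = inv_into U \<Phi>"
  have T: "T v \<in> U" "\<Phi> (T v) = v" if "v \<in> V" for v
    using bij that by (auto simp: T_def bij_betw_def inv_into_into f_inv_into_f)
  have \<Phi>V: "\<Phi> u \<in> V" if "u \<in> U" for u using bij that by (auto simp: bij_betw_def)
  have T\<Phi>: "T (\<Phi> u) = u" if "u \<in> U" for u using bij that by (auto simp: T_def bij_betw_def)
  have inj: "u = w" if "u \<in> U" "w \<in> U" "\<Phi> u = \<Phi> w" for u w using T\<Phi> that by metis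
  define R where "R a u = T (\<rho> a (\<Phi> u))" for a u
  have R: "R a u \<in> U" "\<Phi> (R a u) = \<rho> a (\<Phi> u)" if "a \<in> carrier (Uq_so4 q)" "u \<in> U" for a u
    unfolding R_def using T P.maps_to[OF that(1) \<Phi>V[OF that(2)]] by auto
  have ring: "ring (Uq_so4 q)" by (rule ring_Uq_so4)
  note clos = ring.ring_simprules(1,5)[OF ring] monoid.one_closed[OF ring.is_monoid[OF ring]] 
  note U_closed = U.subspace_add[OF U] U.subspace_scale[OF U]
  have repR: "so4_rep sc' q U R"
  proof (intro so4_rep.intro so4_rep_axioms.intro vs U)
    fix a b u w c assume a: "a \<in> carrier (Uq_so4 q)" and u: "u \<in> U"
    show "R a u \<in> U" by (rule R[OF a u])
    show "R a (sc' c u) = sc' c (R a u)"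
      by (rule inj) (use a u U_closed R in \<open>auto simp: scl P.op_scale \<Phi>V\<close>)
    show "R (cls q (scalar c) \<otimes>\<^bsub>Uq_so4 q\<^esub> a) u = sc' c (R a u)"
      by (rule inj) (use a u U_closed R clos cls_carrier in \<open>auto simp: scl P.rep_scale \<Phi>V\<close>)
    show "R a (u + w) = R a u + R a w" if w: "w \<in> U"
      by (rule inj) (use a u w U_closed R in \<open>auto simp: add P.op_add \<Phi>V\<close>)
    show "R (a \<oplus>\<^bsub>Uq_so4 q\<^esub> b) u = R a u + R b u" if b: "b \<in> carrier (Uq_so4 q)"
      by (rule inj) (use a b u U_closed R clos in \<open>auto simp: add P.rep_add \<Phi>V\<close>)
    show "R (a \<otimes>\<^bsub>Uq_so4 q\<^esub> b) u = R a (R b u)" if b: "b \<in> carrier (Uq_so4 q)"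
      by (rule inj) (use a b u U_closed R clos in \<open>auto simp: P.rep_mult \<Phi>V\<close>)
  next
    fix u assume "u \<in> U"
    then show "R \<one>\<^bsub>Uq_so4 q\<^esub> u = u" unfolding R_def by (simp add: P.rep_one \<Phi>V T\<Phi>)
  qed
  have \<Phi>0: "\<Phi> 0 = 0" using add[of 0 0] by simp
  have "irreducible_so4_rep sc' q U R"
    unfolding irreducible_so4_rep_def
  proof (intro conjI allI impI; (elim conjE)?)
    show "so4_rep sc' q U R" by (rule repR)
    show "U \<noteq> {0}"
    proof
      assume "U = {0}"
      then have "V = {0}" using bij \<Phi>0 by (auto simp: bij_betw_def)
      then show False using irr by (simp add: irreducible_so4_rep_def)
    qed
  next
    fix W assume W: "U.subspace W" "W \<subseteq> U" "\<forall>a\<in>carrier (Uq_so4 q). R a ` W \<subseteq> W"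
    have "P.subspace (\<Phi> ` W)"
    proof (rule P.subspaceI)
      show "0 \<in> \<Phi> ` W" using U.subspace_0[OF W(1)] \<Phi>0 by (metis imageI)
      show "x + y \<in> \<Phi> ` W" if "x \<in> \<Phi> ` W" "y \<in> \<Phi> ` W" for x y
        using that U.subspace_add[OF W(1)] add by (metis (no_types, lifting) imageE imageI)
      show "sc c x \<in> \<Phi> ` W" if "x \<in> \<Phi> ` W" for c x
        using that U.subspace_scale[OF W(1)] scl by (metis (no_types, lifting) imageE imageI)
    qed
    moreover have "\<Phi> ` W \<subseteq> V" using W(2) \<Phi>V by blast
    moreover have "\<forall>a\<in>carrier (Uq_so4 q). \<rho> a ` \<Phi> ` W \<subseteq> \<Phi> ` W"
    proof (intro ballI subsetI)
      fix a x assume a: "a \<in> carrier (Uq_so4 q)" and "x \<in> \<rho> a ` \<Phi> ` W"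
      then obtain w where w: "w \<in> W" "x = \<rho> a (\<Phi> w)" by blast
      then have "x = \<Phi> (R a w)" using R(2)[OF a] W(2) by auto
      moreover have "R a w \<in> W" using W(3) a w by blast
      ultimately show "x \<in> \<Phi> ` W" by blast
    qed
    ultimately have "\<Phi> ` W = {0} \<or> \<Phi> ` W = V" using irr by (simp add: irreducible_so4_rep_def)
    then show "W = {0} \<or> W = U"
    proof
      assume z: "\<Phi> ` W = {0}"
      have "w = 0" if "w \<in> W" for w
        by (rule inj) (use z that W(2) \<Phi>0 U.subspace_0[OF U] in auto)
      then show ?thesis using U.subspace_0[OF W(1)] by blast
    next
      assume "\<Phi> ` W = V"
      have "u \<in> W" if u: "u \<in> U" for u
      proof -
        obtain w where "w \<in> W" "\<Phi> u = \<Phi> w" using \<open>\<Phi> ` W = V\<close> \<Phi>V[OF u] by (metis imageE)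
        then show ?thesis using inj[OF u, of w] W(2) by auto
      qed
      then show ?thesis using W(2) by blast
    qed
  qed
  moreover have "equivalent_so4_rep q sc V \<rho> sc' U R"
    unfolding equivalent_so4_rep_def
  proof (intro exI[of _ T] conjI ballI allI)
    show "bij_betw T V U" unfolding T_def by (rule bij_betw_inv_into[OF bij])
    show "T (v + w) = T v + T w" if "v \<in> V" "w \<in> V" for v w
      by (rule inj) (use that T U_closed P.subspace_add[OF P.subspace_V] in \<open>auto simp: add\<close>)
    show "T (sc c v) = sc' c (T v)" if "v \<in> V" for c v
      by (rule inj) (use that T U_closed P.subspace_scale[OF P.subspace_V] in \<open>auto simp: scl\<close>)
    show "T (\<rho> a v) = R a (T v)" if "a \<in> carrier (Uq_so4 q)" "v \<in> V" for a v
      unfolding R_def using T(2)[OF that(2)] by simp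
  qed
  ultimately show ?thesis using R by blast
qed

section \<open>Transport to the space spanned by kets\<close>

lemma ket_span_eq:
  assumes I: "finite I"
  shows "ket_span I = {p. \<forall>i. i \<notin> I \<longrightarrow> Poly_Mapping.lookup p i = 0}" (is "_ = ?U")
proof -
  interpret K: vector_space ket_scale by (rule vector_space_ket_scale)
  have sub: "K.subspace ?U"
    by (rule K.subspaceI) (auto simp: lookup_add lookup_ket_scale)
  show ?thesis
  proof
    show "ket_span I \<subseteq> ?U" unfolding ket_span_def
      by (rule K.span_minimal[OF _ sub]) (auto simp: ket_def lookup_single when_def)
    show "?U \<subseteq> ket_span I"
    proof
      fix p assume p: "p \<in> ?U"
      have "p = (\<Sum>i\<in>I. Poly_Mapping.lookup p i *\<^sub>k (case i of (k, l) \<Rightarrow> ket k l))"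
      proof (rule poly_mapping_eqI)
        fix i
        have "(\<Sum>i'\<in>I. Poly_Mapping.lookup p i' * (if i' = i then 1 else 0)) = (\<Sum>i'\<in>I. if i' = i then Poly_Mapping.lookup p i' else 0)"
          by (rule sum.cong) auto
        also have "\<dots> = Poly_Mapping.lookup p i" using p I by (cases i) (auto simp: sum.delta)
        finally have "(\<Sum>i'\<in>I. Poly_Mapping.lookup p i' * (if i' = i then 1 else 0)) = Poly_Mapping.lookup p i" .
        then show "Poly_Mapping.lookup p i = Poly_Mapping.lookup (\<Sum>i\<in>I. Poly_Mapping.lookup p i *\<^sub>k (case i of (k, l) \<Rightarrow> ket k l)) i"
          by (simp add: lookup_sum lookup_ket_scale ket_def lookup_single when_def split_def)
      qed
      also have "\<dots> \<in> ket_span I" unfolding ket_span_def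
        by (intro K.span_sum K.span_scale K.span_base) auto
      finally show "p \<in> ket_span I" .
    qed
  qed
qed

lemma ket_in_span: "c = 0 \<or> (k, l) \<in> I \<Longrightarrow> c *\<^sub>k ket k l \<in> ket_span I"
proof -
  interpret K: vector_space ket_scale by (rule vector_space_ket_scale)
  assume "c = 0 \<or> (k, l) \<in> I"
  then show ?thesis
  proof
    assume "c = 0"
    then show ?thesis unfolding ket_span_def by (simp add: K.span_zero)
  next
    assume "(k, l) \<in> I"
    then have "ket k l \<in> (\<lambda>(k, l). ket k l) ` I" by (rule rev_image_eqI) simp
    then show ?thesis unfolding ket_span_def by (intro K.span_scale K.span_base)
  qed
qed

lemma ket_span_closed:
  "x \<in> ket_span I \<Longrightarrow> y \<in> ket_span I \<Longrightarrow> x + y \<in> ket_span I" "x \<in> ket_span I \<Longrightarrow> c *\<^sub>k x \<in> ket_span I"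
proof -
  interpret K: vector_space ket_scale by (rule vector_space_ket_scale)
  show "x \<in> ket_span I \<Longrightarrow> y \<in> ket_span I \<Longrightarrow> x + y \<in> ket_span I" "x \<in> ket_span I \<Longrightarrow> c *\<^sub>k x \<in> ket_span I"
    unfolding ket_span_def by (intro K.span_add K.span_scale; assumption)+
qed

text \<open>The linear map that sends the ket at i to F i for i in I and all other kets to 0, so
  kets outside the index set may remain in the formulas.\<close>

definition ketmap :: "(complex \<Rightarrow> 'v \<Rightarrow> 'v::ab_group_add) \<Rightarrow> (rat \<times> rat) set \<Rightarrow> (rat \<times> rat \<Rightarrow> 'v) \<Rightarrow> ket_space \<Rightarrow> 'v" where
  "ketmap sc I F p = (\<Sum>i\<in>I. sc (Poly_Mapping.lookup p i) (F i))"

context cvs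
begin

lemma ketmap_add: "ketmap sc I F (p + r) = ketmap sc I F p + ketmap sc I F r"
  by (simp add: ketmap_def lookup_add scale_left_distrib sum.distrib)

lemma ketmap_scale: "ketmap sc I F (c *\<^sub>k p) = c \<cdot> ketmap sc I F p"
  by (simp add: ketmap_def lookup_ket_scale scale_sum_right)

lemma ketmap_ket:
  assumes "finite I" "\<And>i. i \<notin> I \<Longrightarrow> F i = 0"
  shows "ketmap sc I F (ket k l) = F (k, l)"
proof -
  have "ketmap sc I F (ket k l) = (\<Sum>i\<in>I. if i = (k, l) then F i else 0)"
    unfolding ketmap_def by (rule sum.cong) (auto simp: ket_def lookup_single when_def)
  then show ?thesis using assms by simp
qed

text \<open>The representation on the kets is transported from V, and the assumption on
  \<open>act\<close> compares the formulas with the operators on F. Independence of F comes from the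
  joint eigenvalues of \<open>A\<close> and \<open>C\<close>.\<close>

lemma realize:
  assumes irr: "irreducible_so4_rep sc q V \<rho>" and A: "linear_op sc A" and C: "linear_op sc C" and I: "finite I"
    and F0: "\<And>i. i \<notin> I \<Longrightarrow> F i = 0"
    and ev: "\<And>i. i \<in> I \<Longrightarrow> A (F i) = \<alpha> i \<cdot> F i" "\<And>i. i \<in> I \<Longrightarrow> C (F i) = \<gamma> i \<cdot> F i" "\<And>i. i \<in> I \<Longrightarrow> F i \<noteq> 0"
    and inj: "inj_on (\<lambda>i. (\<alpha> i, \<gamma> i)) I" and V: "V = span (F ` I)"
    and act: "\<And>g k l. (k, l) \<in> I \<Longrightarrow> act g k l \<in> ket_span I"
      "\<And>g k l. (k, l) \<in> I \<Longrightarrow> ketmap sc I F (act g k l) = \<rho> (cls q (gen g)) (F (k, l))"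
  shows "\<exists>R. given_on_basis q I act R \<and> irreducible_so4_rep ket_scale q (ket_span I) R
    \<and> equivalent_so4_rep q sc V \<rho> ket_scale (ket_span I) R"
proof -
  interpret K: vector_space ket_scale by (rule vector_space_ket_scale)
  let ?\<Phi> = "ketmap sc I F"
  have sub: "K.subspace (ket_span I)" unfolding ket_span_def by (rule K.subspace_span)
  have F_ind: "c i = 0" if "(\<Sum>i\<in>I. c i \<cdot> F i) = 0" "i \<in> I" for c i
    by (rule joint_eigenvectors_independent[OF A C I ev inj that])
  have "inj_on ?\<Phi> (ket_span I)"
  proof (rule inj_onI)
    fix p r assume p: "p \<in> ket_span I" and r: "r \<in> ket_span I" and eq: "?\<Phi> p = ?\<Phi> r"
    have "(\<Sum>i\<in>I. (Poly_Mapping.lookup p i - Poly_Mapping.lookup r i) \<cdot> F i) = 0"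
      using eq by (simp add: ketmap_def scale_left_diff_distrib sum_subtractf)
    then have "Poly_Mapping.lookup p i = Poly_Mapping.lookup r i" if "i \<in> I" for i
      using F_ind[of "\<lambda>i. Poly_Mapping.lookup p i - Poly_Mapping.lookup r i" i] that by simp
    then show "p = r" using p r unfolding ket_span_eq[OF I] by (intro poly_mapping_eqI) (metis (mono_tags, lifting) mem_Collect_eq)
  qed
  moreover have "?\<Phi> ` ket_span I = V"
  proof
    show "?\<Phi> ` ket_span I \<subseteq> V" unfolding V ketmap_def
    proof (intro subsetI, elim imageE)
      fix x p assume "x = (\<Sum>i\<in>I. Poly_Mapping.lookup p i \<cdot> F i)"
      moreover have "(\<Sum>i\<in>I. Poly_Mapping.lookup p i \<cdot> F i) \<in> span (F ` I)"
        by (intro span_sum span_scale span_base imageI)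
      ultimately show "x \<in> span (F ` I)" by simp
    qed
    have "subspace (?\<Phi> ` ket_span I)"
    proof (rule subspaceI)
      show "0 \<in> ?\<Phi> ` ket_span I"
        by (rule image_eqI[of _ _ 0]) (auto simp: ketmap_def K.subspace_0[OF sub])
      fix x assume "x \<in> ?\<Phi> ` ket_span I"
      then obtain p where p: "p \<in> ket_span I" "x = ?\<Phi> p" by (elim imageE)
      show "c \<cdot> x \<in> ?\<Phi> ` ket_span I" for c
        by (rule image_eqI[of _ _ "c *\<^sub>k p"]) (simp_all add: ketmap_scale p ket_span_closed)
      fix y assume "y \<in> ?\<Phi> ` ket_span I"
      then obtain r where r: "r \<in> ket_span I" "y = ?\<Phi> r" by (elim imageE)
      show "x + y \<in> ?\<Phi> ` ket_span I"
        by (rule image_eqI[of _ _ "p + r"]) (simp_all add: ketmap_add p r ket_span_closed)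
    qed
    moreover have "F ` I \<subseteq> ?\<Phi> ` ket_span I"
    proof
      fix x assume "x \<in> F ` I"
      then obtain k l where kl: "(k, l) \<in> I" "x = F (k, l)" by auto
      have "ket k l \<in> ket_span I" unfolding ket_span_def by (rule K.span_base) (use kl in auto)
      then show "x \<in> ?\<Phi> ` ket_span I"
        by (intro image_eqI[of _ _ "ket k l"]) (simp_all add: ketmap_ket[OF I F0] kl(2))
    qed
    ultimately show "V \<subseteq> ?\<Phi> ` ket_span I" unfolding V by (intro span_minimal)
  qed
  ultimately have bij: "bij_betw ?\<Phi> (ket_span I) V" by (simp add: bij_betw_def)
  have "\<exists>R. irreducible_so4_rep ket_scale q (ket_span I) R \<and> equivalent_so4_rep q sc V \<rho> ket_scale (ket_span I) R
    \<and> (\<forall>a\<in>carrier (Uq_so4 q). \<forall>u\<in>ket_span I. R a u \<in> ket_span I \<and> ?\<Phi> (R a u) = \<rho> a (?\<Phi> u))"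
    by (rule transport_rep[OF irr vector_space_ket_scale sub bij]) (rule ketmap_add ketmap_scale)+
  then obtain R where R: "irreducible_so4_rep ket_scale q (ket_span I) R" "equivalent_so4_rep q sc V \<rho> ket_scale (ket_span I) R"
    and R3: "\<forall>a\<in>carrier (Uq_so4 q). \<forall>u\<in>ket_span I. R a u \<in> ket_span I \<and> ?\<Phi> (R a u) = \<rho> a (?\<Phi> u)"
    by (elim exE conjE)
  have "R (cls q (gen g)) (ket k l) = act g k l" if kl: "(k, l) \<in> I" for g k l
  proof (rule inj_onD[OF \<open>inj_on ?\<Phi> (ket_span I)\<close>])
    have ks: "ket k l \<in> ket_span I" unfolding ket_span_def by (rule K.span_base) (use kl in auto)
    have r: "R (cls q (gen g)) (ket k l) \<in> ket_span I \<and> ?\<Phi> (R (cls q (gen g)) (ket k l)) = \<rho> (cls q (gen g)) (?\<Phi> (ket k l))"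
      by (rule bspec[OF bspec[OF R3 cls_carrier] ks])
    then show "R (cls q (gen g)) (ket k l) \<in> ket_span I" by (rule conjunct1)
    show "act g k l \<in> ket_span I" by (rule act(1)[OF kl])
    show "?\<Phi> (R (cls q (gen g)) (ket k l)) = ?\<Phi> (act g k l)"
      unfolding conjunct2[OF r] act(2)[OF kl] by (simp add: ketmap_ket[OF I F0])
  qed
  then have "given_on_basis q I act R"
    using R(1) unfolding given_on_basis_def irreducible_so4_rep_def by auto
  with R(1,2) show ?thesis by blast
qed

end

text \<open>Integers are included, unlike in \<open>half_integral\<close>: these are the rationals
  on which the floor in \<open>qpow\<close> is exact and \<open>qpow\<close> is
  multiplicative.\<close>

definition half_int :: "rat \<Rightarrow> bool" where "half_int r \<longleftrightarrow> 2 * r \<in> \<int>"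

lemma half_int_simps [simp]:
  "half_int a \<Longrightarrow> half_int b \<Longrightarrow> half_int (a + b)" "half_int a \<Longrightarrow> half_int b \<Longrightarrow> half_int (a - b)"
  "half_int a \<Longrightarrow> half_int (- a)" "half_int (of_nat n)" "half_int 1" "half_int (of_nat n / 2)" "half_int (1 / 2)"
  by (auto simp: half_int_def distrib_left right_diff_distrib)

section \<open>Half-integral powers of q and the index sets\<close>

locale generic_root = generic_q q for q + fixes s :: complex assumes s_sq: "s ^ 2 = q"
begin

lemma s_neq: "s \<noteq> 0" using s_sq q_nonzero by auto

lemma s_powi_1: "s powi k = 1 \<longleftrightarrow> k = 0"
proof
  assume "s powi k = 1"
  then have "(s ^ 2) powi k = 1" by (simp add: power_int_mult_distrib power2_eq_square)
  then show "k = 0" unfolding s_sq q_powi_eq_1 .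
qed simp

lemma s_powi_m1: "s powi k \<noteq> - 1"
proof
  assume k: "s powi k = - 1"
  then have "(s ^ 2) powi k = 1" by (simp add: power_int_mult_distrib power2_eq_square)
  then have "k = 0" unfolding s_sq q_powi_eq_1 .
  with k show False by simp
qed

lemma qpow_val: "2 * r = of_int z \<Longrightarrow> qpow s r = s powi z"
  by (simp add: qpow_def)

lemma half_intE: "half_int r \<Longrightarrow> (\<And>z. 2 * r = of_int z \<Longrightarrow> P) \<Longrightarrow> P"
  unfolding half_int_def by (metis Ints_cases)

lemma qpow_neq [simp]: "qpow s r \<noteq> 0"
  using s_neq by (simp add: qpow_def)

lemma qpow_add [simp]:
  assumes "half_int a" "half_int b"
  shows "qpow s (a + b) = qpow s a * qpow s b"
proof -
  obtain x y where xy: "2 * a = of_int x" "2 * b = of_int y" using assms half_intE by metis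
  then have "2 * (a + b) = of_int (x + y)" by (simp add: distrib_left)
  then show ?thesis using qpow_val[OF xy(1)] qpow_val[OF xy(2)] qpow_val[of "a + b" "x + y"] s_neq
    by (simp add: power_int_add)
qed

lemma qpow_minus [simp]:
  assumes "half_int a"
  shows "qpow s (- a) = 1 / qpow s a"
proof -
  obtain x where x: "2 * a = of_int x" using assms half_intE by metis
  then have "2 * (- a) = of_int (- x)" by simp
  then show ?thesis using qpow_val[OF x] qpow_val[of "- a" "- x"] by (simp add: power_int_minus inverse_eq_divide)
qed

lemma qpow_diff [simp]: "half_int a \<Longrightarrow> half_int b \<Longrightarrow> qpow s (a - b) = qpow s a / qpow s b"
  using qpow_add[of a "- b"] by simp

lemma qpow_half_nat [simp]: "qpow s (of_nat n / 2) = s ^ n"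
  using qpow_val[of "of_nat n / 2" "int n"] by simp

lemma q_s: "q ^ n = s ^ n * s ^ n"
  unfolding s_sq[symmetric] by (simp add: power2_eq_square power_mult_distrib)

lemma qpow_nat [simp]: "qpow s (of_nat n) = q ^ n"
proof -
  have "qpow s (of_nat n) = s ^ (n * 2)"
    using qpow_val[of "of_nat n" "int (n * 2)"] unfolding power_int_of_nat by simp
  then show ?thesis by (simp add: q_s power2_eq_square power_mult)
qed

lemma qpow_1 [simp]: "qpow s 1 = q" using qpow_nat[of 1] by simp

lemma qpow_0: "qpow s 0 = 1" using qpow_nat[of 0] by simp

lemma qpow_eq_iff: "half_int a \<Longrightarrow> half_int b \<Longrightarrow> qpow s a = qpow s b \<longleftrightarrow> a = b"
proof
  assume h: "half_int a" "half_int b" "qpow s a = qpow s b"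
  then have "qpow s (a - b) = 1" by simp
  moreover obtain z where z: "2 * (a - b) = of_int z" using h(1,2) half_intE half_int_simps(2) by metis
  ultimately have "z = 0" using qpow_val[OF z] s_powi_1 by metis
  then show "a = b" using z by simp
qed simp

lemma qpow_neq_m1: "half_int a \<Longrightarrow> qpow s a \<noteq> - 1"
  using half_intE qpow_val s_powi_m1 by metis

lemma qnum_br: "half_int a \<Longrightarrow> qnum s a = br q (qpow s a)"
  by (simp add: qnum_def br_def)

lemma qnum_plus_up: "half_int a \<Longrightarrow> qnum_plus s a = up (qpow s a) / (q - 1 / q)"
  by (simp add: qnum_plus_def up_def)

lemma qnum_minus: "half_int a \<Longrightarrow> qnum s (- a) = - qnum s a"
  by (simp add: qnum_def minus_divide_left)

lemma qnum_0: "qnum s 0 = 0" by (simp add: qnum_def)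

end

lemma half_range:
  "{k::rat. - (of_nat J / 2) \<le> k \<and> k \<le> of_nat J / 2 \<and> of_nat J / 2 - k \<in> \<int>} = (\<lambda>m. of_nat J / 2 - of_nat m) ` {..J}"
proof (intro equalityI subsetI)
  fix k :: rat assume "k \<in> {k. - (of_nat J / 2) \<le> k \<and> k \<le> of_nat J / 2 \<and> of_nat J / 2 - k \<in> \<int>}"
  then have k: "- (of_nat J / 2) \<le> k" "k \<le> of_nat J / 2" "of_nat J / 2 - k \<in> \<int>" by auto
  obtain z where z: "of_nat J / 2 - k = of_int z" using k(3) Ints_cases by metis
  have "of_int z \<ge> (0::rat)" "of_int z \<le> (of_nat J :: rat)" using k z by linarith+
  then have "z \<ge> 0" "z \<le> int J" by (simp, metis of_int_le_iff of_int_of_nat_eq)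
  then show "k \<in> (\<lambda>m. of_nat J / 2 - of_nat m) ` {..J}"
    using z by (intro image_eqI[of _ _ "nat z"]) (auto simp: algebra_simps)
qed auto

lemma half_nat_Ints: "(of_nat J / 2 :: rat) \<in> \<int> \<longleftrightarrow> even J"
proof
  assume "(of_nat J / 2 :: rat) \<in> \<int>"
  then obtain z where "(of_nat J / 2 :: rat) = of_int z" using Ints_cases by metis
  then have "(of_nat J :: rat) = of_int (2 * z)" by simp
  then have "int J = 2 * z" by (metis of_int_eq_iff of_int_of_nat_eq)
  then show "even J" by presburger
next
  assume "even J"
  then obtain k where "J = 2 * k" by blast
  then show "(of_nat J / 2 :: rat) \<in> \<int>" by simp
qed

context cvs
begin

lemma lattice_basisD:
  assumes lb: "lattice_basis sc q A B C V x0 y0 \<eta> J K g"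
  shows "m > J \<or> n > K \<Longrightarrow> g m n = 0"
    and "V = span ((\<lambda>(m, n). g m n) ` ({..J} \<times> {..K}))"
    and "m \<le> J \<Longrightarrow> n \<le> K \<Longrightarrow> g m n \<noteq> 0"
    and "m \<le> J \<Longrightarrow> n \<le> K \<Longrightarrow> g m n \<in> V"
    and "m \<le> J \<Longrightarrow> n \<le> K \<Longrightarrow> A (g m n) = wt q (x0 / q ^ m / q ^ n) \<cdot> g m n"
    and "m \<le> J \<Longrightarrow> n \<le> K \<Longrightarrow> C (g m n) = wt q (y0 * q ^ n / q ^ m) \<cdot> g m n"
    and "m \<le> J \<Longrightarrow> n \<le> K \<Longrightarrow> B (g m n) = (\<eta> / (up (x0 / q ^ m / q ^ n) * up (y0 * q ^ n / q ^ m))) \<cdot>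
         ((up (y0 / q ^ m) * br q (q ^ m)) \<cdot> g (m - 1) n
          - (up (y0 * q ^ n) * br q (q ^ n)) \<cdot> g m (n - 1)
          + (up (x0 / q ^ n) * br q (x0 / (y0 * q ^ n))) \<cdot> g m (Suc n)
          - (up (x0 / q ^ m) * br q (x0 * y0 / q ^ m)) \<cdot> g (Suc m) n)"
proof -
  note u = lb[unfolded lattice_basis_def]
  show "m > J \<or> n > K \<Longrightarrow> g m n = 0" using u by (elim conjE allE impE) (assumption | blast)+
  show "V = span ((\<lambda>(m, n). g m n) ` ({..J} \<times> {..K}))" using u by (elim conjE)
  note v = u[THEN conjunct1, rule_format]
  show "m \<le> J \<Longrightarrow> n \<le> K \<Longrightarrow> g m n \<noteq> 0" using v by blast
  show "m \<le> J \<Longrightarrow> n \<le> K \<Longrightarrow> g m n \<in> V" using v by blast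
  show "m \<le> J \<Longrightarrow> n \<le> K \<Longrightarrow> A (g m n) = wt q (x0 / q ^ m / q ^ n) \<cdot> g m n" using v by blast
  show "m \<le> J \<Longrightarrow> n \<le> K \<Longrightarrow> C (g m n) = wt q (y0 * q ^ n / q ^ m) \<cdot> g m n" using v by blast
  show "m \<le> J \<Longrightarrow> n \<le> K \<Longrightarrow> B (g m n) = (\<eta> / (up (x0 / q ^ m / q ^ n) * up (y0 * q ^ n / q ^ m))) \<cdot>
         ((up (y0 / q ^ m) * br q (q ^ m)) \<cdot> g (m - 1) n
          - (up (y0 * q ^ n) * br q (q ^ n)) \<cdot> g m (n - 1)
          + (up (x0 / q ^ n) * br q (x0 / (y0 * q ^ n))) \<cdot> g m (Suc n)
          - (up (x0 / q ^ m) * br q (x0 * y0 / q ^ m)) \<cdot> g (Suc m) n)" using v by blast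
qed

end

lemma lattice_member_iff:
  "((j::rat) - of_nat m, (j'::rat) - of_nat n) \<in> (\<lambda>(m, n). (j - of_nat m, j' - of_nat n)) ` M \<longleftrightarrow> (m, n) \<in> M"
  by auto

lemma classical_index_eq:
  "classical_index (of_nat J / 2) (of_nat K / 2) =
    (\<lambda>(m, n). (of_nat J / 2 - of_nat m, of_nat K / 2 - of_nat n)) ` ({..J} \<times> {..K})"
  unfolding classical_index_def half_range by auto

lemma half_range_pos:
  "{k::rat. 1 / 2 \<le> k \<and> k \<le> of_nat J / 2 \<and> of_nat J / 2 - k \<in> \<int>} = (\<lambda>m. of_nat J / 2 - of_nat m) ` {m. m \<le> J \<and> 2 * m < J}"
proof -
  have "{k::rat. 1 / 2 \<le> k \<and> k \<le> of_nat J / 2 \<and> of_nat J / 2 - k \<in> \<int>} =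
    {k. - (of_nat J / 2) \<le> k \<and> k \<le> of_nat J / 2 \<and> of_nat J / 2 - k \<in> \<int>} \<inter> {k. 1 / 2 \<le> k}"
  proof -
    have "- (of_nat J / 2) \<le> k" if "1 / 2 \<le> k" for k :: rat
    proof -
      have "- (of_nat J / 2) \<le> (0::rat)" by simp
      with that show ?thesis by linarith
    qed
    then show ?thesis by blast
  qed
  also have "\<dots> = (\<lambda>m. of_nat J / 2 - of_nat m) ` {m. m \<le> J \<and> 2 * m < J}"
  proof -
    have "1 / 2 \<le> (of_nat J / 2 - of_nat m :: rat) \<longleftrightarrow> 2 * m < J" for m
    proof -
      have "1 / 2 \<le> (of_nat J / 2 - of_nat m :: rat) \<longleftrightarrow> (of_nat (2 * m + 1) :: rat) \<le> of_nat J"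
        by (simp add: field_simps)
      also have "\<dots> \<longleftrightarrow> 2 * m + 1 \<le> J" by (rule of_nat_le_iff)
      finally show ?thesis by auto
    qed
    then show ?thesis unfolding half_range by auto
  qed
  finally show ?thesis .
qed

lemma nonclassical_index_eq:
  "nonclassical_index (of_nat J / 2) (of_nat K / 2) =
    (\<lambda>(m, n). (of_nat J / 2 - of_nat m, of_nat K / 2 - of_nat n)) `
      {(m, n). m \<le> J \<and> n \<le> K \<and> (if odd J then 2 * m < J else 2 * n < K)}"
  unfolding nonclassical_index_def half_nat_Ints half_range half_range_pos by (cases "even J") auto

lemma neg_one_powi: "(- 1 :: complex) powi z = (if even z then 1 else - 1)"
proof (cases "z \<ge> 0")
  case True
  then have "even (nat z) \<longleftrightarrow> even z" by (simp add: even_nat_iff)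
  then show ?thesis using True by (simp add: power_int_def minus_one_power_iff)
next
  case False
  then have "even (nat (- z)) \<longleftrightarrow> even z" by (simp add: even_nat_iff)
  then show ?thesis using False by (simp add: power_int_def minus_one_power_iff)
qed

lemma neg_one_power_mult:
  assumes "even (int a + z) \<longleftrightarrow> even b"
  shows "(- 1 :: complex) ^ a * (- 1) powi z = (- 1) ^ b"
  using assms by (auto simp: neg_one_powi minus_one_power_iff)

lemma shifts:
  "n \<noteq> 0 \<Longrightarrow> (j'::rat) - of_nat n + 1 = j' - of_nat (n - 1)" "(j'::rat) - of_nat n - 1 = j' - of_nat (Suc n)"
  by (cases n; simp)+

section \<open>Comparison with the classical and nonclassical formulas\<close>

locale operator_rep = cvs sc + generic_root q s
  for sc :: "complex \<Rightarrow> 'v::ab_group_add \<Rightarrow> 'v"  (infixr "\<cdot>" 75) and q s +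
  fixes V \<rho> A B C
  assumes irrep: "irreducible_so4_rep sc q V \<rho>" and lin: "linear_op sc A" "linear_op sc C"
    and op_A: "\<And>v. v \<in> V \<Longrightarrow> \<rho> (cls q (gen I21)) v = A v"
    and op_B: "\<And>v. v \<in> V \<Longrightarrow> \<rho> (cls q (gen I32)) v = B v"
    and op_C: "\<And>v. v \<in> V \<Longrightarrow> \<rho> (cls q (gen I43)) v = C v"
begin

text \<open>With k = j - m and l = j' - n the labels become q^(k + l) and q^(k - l), and the lattice
  formula for \<open>B\<close> turns term by term into that of R_jj'. Coefficients leading out of
  the rectangle vanish.\<close>

lemma classical_case:
  assumes lb: "lattice_basis sc q A B C V (s ^ (J + K)) (s ^ J / s ^ K) 1 J K g"
  defines "j \<equiv> of_nat J / 2" and "j' \<equiv> of_nat K / 2"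
  shows "\<exists>R. classical_rep s j j' R \<and> irreducible_so4_rep ket_scale q (ket_span (classical_index j j')) R
    \<and> equivalent_so4_rep q sc V \<rho> ket_scale (ket_span (classical_index j j')) R"
proof -
  define I where "I = classical_index j j'"
  have I: "I = (\<lambda>(m, n). (j - of_nat m, j' - of_nat n)) ` ({..J} \<times> {..K})"
    unfolding I_def j_def j'_def by (rule classical_index_eq)
  define F where "F = (\<lambda>kl. if kl \<in> I then g (nat \<lfloor>j - fst kl\<rfloor>) (nat \<lfloor>j' - snd kl\<rfloor>) else 0)"
  have fin: "finite I" unfolding I by simp
  have F0: "F i = 0" if "i \<notin> I" for i using that by (simp add: F_def)
  have ketmap_F: "ketmap sc I F (ket a b) = F (a, b)" for a b
    by (rule ketmap_ket) (use fin F0 in blast)+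
  have mem: "(j - of_nat m, j' - of_nat n) \<in> I \<longleftrightarrow> m \<le> J \<and> n \<le> K" for m n
    unfolding I lattice_member_iff by simp
  have g0: "g m n = 0" if "m > J \<or> n > K" for m n using lattice_basisD(1)[OF lb that] .
  have Fg: "F (j - of_nat m, j' - of_nat n) = g m n" for m n
    using mem[of m n] g0[of m n] by (cases "m \<le> J \<and> n \<le> K") (auto simp: F_def)
  have Icases: thesis if "(k, l) \<in> I" "\<And>m n. m \<le> J \<Longrightarrow> n \<le> K \<Longrightarrow> k = j - of_nat m \<Longrightarrow> l = j' - of_nat n \<Longrightarrow> thesis" for k l thesis
    using that unfolding I by auto
  note B_g = lattice_basisD(7)[OF lb]
  have hj [simp]: "half_int j" "half_int j'" "qpow s j = s ^ J" "qpow s j' = s ^ K"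
    by (simp_all add: j_def j'_def)
  have x: "s ^ (J + K) / q ^ m / q ^ n = qpow s (j - of_nat m + (j' - of_nat n))"
    and y: "s ^ J / s ^ K * q ^ n / q ^ m = qpow s (j - of_nat m - (j' - of_nat n))" for m n
    using s_neq q_nonzero by (simp_all add: power_add)
  note ev = lattice_basisD(3-6)[OF lb, unfolded x y]
  have hI: "half_int k \<and> half_int l" if "(k, l) \<in> I" for k l
    by (rule Icases[OF that]) simp
  have "\<exists>R. given_on_basis q I (classical_action s j j') R \<and> irreducible_so4_rep ket_scale q (ket_span I) R
    \<and> equivalent_so4_rep q sc V \<rho> ket_scale (ket_span I) R"
  proof (rule realize[OF irrep lin fin F0, where \<alpha> = "\<lambda>(k, l). wt q (qpow s (k + l))" and \<gamma> = "\<lambda>(k, l). wt q (qpow s (k - l))"])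
    fix i assume "i \<in> I"
    then obtain k l where kl: "i = (k, l)" "(k, l) \<in> I" by (cases i) auto
    show "A (F i) = (case i of (k, l) \<Rightarrow> wt q (qpow s (k + l))) \<cdot> F i"
      unfolding kl(1) by (rule Icases[OF kl(2)]) (use ev in \<open>simp add: Fg del: qpow_add qpow_diff\<close>)
    show "C (F i) = (case i of (k, l) \<Rightarrow> wt q (qpow s (k - l))) \<cdot> F i"
      unfolding kl(1) by (rule Icases[OF kl(2)]) (use ev in \<open>simp add: Fg del: qpow_add qpow_diff\<close>)
    show "F i \<noteq> 0"
      unfolding kl(1) by (rule Icases[OF kl(2)]) (use ev in \<open>simp add: Fg\<close>)
  next
    show "inj_on (\<lambda>i. (case i of (k, l) \<Rightarrow> wt q (qpow s (k + l)), case i of (k, l) \<Rightarrow> wt q (qpow s (k - l)))) I"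
    proof (rule inj_onI, clarify)
      fix k l k' l' assume kl: "(k, l) \<in> I" "(k', l') \<in> I"
        and e: "wt q (qpow s (k + l)) = wt q (qpow s (k' + l'))" "wt q (qpow s (k - l)) = wt q (qpow s (k' - l'))"
      \<comment> \<open>The alternative for labels of equal weight would need q^(a + b) = -1, which
        no half-integral power satisfies; so k + l and k - l can be read off the weights.\<close>
      have inj: "a = b" if ab: "half_int a" "half_int b" "wt q (qpow s a) = wt q (qpow s b)" for a b
      proof -
        have "qpow s a = qpow s b \<or> qpow s a * qpow s b = - 1"
          using ab(3) wt_eq_iff[OF qpow_neq qpow_neq] by blast
        moreover have "qpow s a * qpow s b \<noteq> - 1" using qpow_neq_m1[of "a + b"] ab by simp
        ultimately show ?thesis using qpow_eq_iff ab by blast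
      qed
      have "k + l = k' + l'" "k - l = k' - l'"
        by (rule inj; use hI[OF kl(1)] hI[OF kl(2)] e in \<open>simp del: qpow_add qpow_diff\<close>)+
      then show "k = k' \<and> l = l'" by auto
    qed
  next
    have "F ` I = (\<lambda>(m, n). g m n) ` ({..J} \<times> {..K})"
      unfolding I image_image by (rule image_cong) (auto simp: Fg)
    then show "V = span (F ` I)" using lattice_basisD(2)[OF lb] by simp
  next
    fix h k l assume kl: "(k, l) \<in> I"
    obtain m n where mn: "m \<le> J" "n \<le> K" and k: "k = j - of_nat m" and l: "l = j' - of_nat n"
      using Icases[OF kl] by metis
    have FV: "F (k, l) \<in> V" using ev[OF mn] by (simp add: k l Fg)
    have hk [simp]: "half_int k" "half_int l" "qpow s k = s ^ J / q ^ m" "qpow s l = s ^ K / q ^ n"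
      by (simp_all add: k l)
    have X: "qpow s (k + l) = s ^ (J + K) / q ^ m / q ^ n" and Y: "qpow s (k - l) = s ^ J / s ^ K * q ^ n / q ^ m"
      by (simp_all only: x y k l)
    define c0 where "c0 = 1 / ((qpow s (k + l) + qpow s (- k - l)) * (qpow s (k - l) + qpow s (- k + l)))"
    define c1 where "c1 = - (qpow s (j - l) + qpow s (- j + l)) * qnum s (j' - l)"
    define c2 where "c2 = (qpow s (j + l) + qpow s (- j - l)) * qnum s (j' + l)"
    define c3 where "c3 = (qpow s (j' - k) + qpow s (- j' + k)) * qnum s (j - k)"
    define c4 where "c4 = - (qpow s (j' + k) + qpow s (- j' - k)) * qnum s (j + k)"
    have neg: "qpow s (- a - b) = 1 / qpow s (a + b)" "qpow s (- a + b) = 1 / qpow s (a - b)"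
      if "half_int a" "half_int b" for a b using that by simp_all
    have c0: "c0 = 1 / (up (s ^ (J + K) / q ^ m / q ^ n) * up (s ^ J / s ^ K * q ^ n / q ^ m))"
      unfolding c0_def neg[OF hk(1,2)] X Y up_def ..
    have c1: "c1 = - (up (s ^ J / s ^ K * q ^ n) * br q (q ^ n))"
      unfolding c1_def neg[OF hj(1) hk(2)] up_def[symmetric] using s_neq by (simp add: qnum_br)
    have c2: "c2 = up (s ^ (J + K) / q ^ n) * br q (s ^ (J + K) / (s ^ J / s ^ K * q ^ n))"
      unfolding c2_def neg[OF hj(1) hk(2)] up_def[symmetric] using s_neq by (simp add: qnum_br power_add)
    have c3: "c3 = up (s ^ J / s ^ K / q ^ m) * br q (q ^ m)"
    proof -
      have "up (qpow s (j' - k)) = up (qpow s (k - j'))" by (simp add: up_def add.commute mult.commute)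
      moreover have "qpow s (k - j') = s ^ J / s ^ K / q ^ m" by (simp add: mult.commute)
      ultimately show ?thesis
        unfolding c3_def neg[OF hj(2) hk(1)] up_def[symmetric] using s_neq by (simp add: qnum_br)
    qed
    have c4: "c4 = - (up (s ^ (J + K) / q ^ m) * br q (s ^ (J + K) * (s ^ J / s ^ K) / q ^ m))"
      unfolding c4_def neg[OF hj(2) hk(1)] up_def[symmetric] using s_neq by (simp add: qnum_br power_add mult_ac)
    have act: "classical_action s j j' I32 k l =
      c0 *\<^sub>k (c1 *\<^sub>k ket k (l + 1) + c2 *\<^sub>k ket k (l - 1) + c3 *\<^sub>k ket (k + 1) l + c4 *\<^sub>k ket (k - 1) l)"
      by (simp only: classical_action.simps c0_def c1_def c2_def c3_def c4_def)
    have br1: "br q 1 = 0" by (simp add: br_def)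
    \<comment> \<open>For n = 0 the ket formula has l + 1 beyond j' and the lattice formula has a
      truncated n - 1; both come with coefficient zero. The next three facts treat the other
      edges.\<close>
    have n0: "c1 = 0 \<or> n \<noteq> 0" unfolding c1 by (cases n) (simp_all add: br1)
    have m0: "c3 = 0 \<or> m \<noteq> 0" unfolding c3 by (cases m) (simp_all add: br1)
    have nK: "c2 = 0 \<or> n < K"
    proof (cases "n = K")
      case True
      have "s ^ (J + K) / (s ^ J / s ^ K * q ^ K) = 1" using s_neq by (simp add: power_add q_s)
      then show ?thesis unfolding c2 True by (simp only: br1 mult_zero_right) simp
    qed (use mn in simp)
    have mJ: "c4 = 0 \<or> m < J"
    proof (cases "m = J")
      case True
      have "s ^ (J + K) * (s ^ J / s ^ K) / q ^ J = 1" using s_neq by (simp add: power_add q_s)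
      then show ?thesis unfolding c4 True by (simp only: br1 mult_zero_right) simp
    qed (use mn in simp)
    have Fl: "F (k, l + 1) = g m (n - 1) \<and> (k, l + 1) \<in> I" if "n \<noteq> 0"
      unfolding k l shifts(1)[OF that] Fg mem using mn by simp
    have Fk: "F (k + 1, l) = g (m - 1) n \<and> (k + 1, l) \<in> I" if "m \<noteq> 0"
      unfolding k l shifts(1)[OF that] Fg mem using mn by simp
    have Fl': "F (k, l - 1) = g m (Suc n)" "n < K \<Longrightarrow> (k, l - 1) \<in> I"
      unfolding k l shifts(2) Fg mem using mn by simp_all
    have Fk': "F (k - 1, l) = g (Suc m) n" "m < J \<Longrightarrow> (k - 1, l) \<in> I"
      unfolding k l shifts(2) Fg mem using mn by simp_all
    have in_span: "classical_action s j j' I32 k l \<in> ket_span I"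
      unfolding act
    proof (rule ket_span_closed(2), intro ket_span_closed(1) ket_in_span)
      show "c1 = 0 \<or> (k, l + 1) \<in> I" using n0 Fl[THEN conjunct2] by blast
      show "c2 = 0 \<or> (k, l - 1) \<in> I" using nK Fl'(2) by blast
      show "c3 = 0 \<or> (k + 1, l) \<in> I" using m0 Fk[THEN conjunct2] by blast
      show "c4 = 0 \<or> (k - 1, l) \<in> I" using mJ Fk'(2) by blast
    qed
    have F1: "c1 = 0 \<or> F (k, l + 1) = g m (n - 1)" using n0 Fl by (cases "n = 0") simp_all
    have F3: "c3 = 0 \<or> F (k + 1, l) = g (m - 1) n" using m0 Fk by (cases "m = 0") simp_all
    have "ketmap sc I F (classical_action s j j' I32 k l) =
      c0 \<cdot> (c1 \<cdot> g m (n - 1) + c2 \<cdot> g m (Suc n) + c3 \<cdot> g (m - 1) n + c4 \<cdot> g (Suc m) n)"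
    proof -
      have 1: "ketmap sc I F (c1 *\<^sub>k ket k (l + 1)) = c1 \<cdot> g m (n - 1)"
        using F1 by (auto simp only: ketmap_scale ketmap_F scale_zero_left)
      have 2: "ketmap sc I F (c2 *\<^sub>k ket k (l - 1)) = c2 \<cdot> g m (Suc n)"
        by (simp only: ketmap_scale ketmap_F Fl')
      have 3: "ketmap sc I F (c3 *\<^sub>k ket (k + 1) l) = c3 \<cdot> g (m - 1) n"
        using F3 by (auto simp only: ketmap_scale ketmap_F scale_zero_left)
      have 4: "ketmap sc I F (c4 *\<^sub>k ket (k - 1) l) = c4 \<cdot> g (Suc m) n"
        by (simp only: ketmap_scale ketmap_F Fk')
      show ?thesis unfolding act ketmap_scale[of I F c0] ketmap_add 1 2 3 4 ..
    qed
    also have "\<dots> = B (g m n)"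
      unfolding B_g[OF mn] c0 c1 c2 c3 c4 by (simp only: scale_minus_left diff_conv_add_uminus add_ac)
    finally have B: "ketmap sc I F (classical_action s j j' I32 k l) = \<rho> (cls q (gen I32)) (F (k, l))"
      using op_B[OF FV] by (simp add: k l Fg)
    have wts: "\<i> * qnum s a = wt q (qpow s a)" if "half_int a" for a
      using that by (simp add: qnum_br br_def wt_def)
    have AC: "ketmap sc I F (classical_action s j j' I21 k l) = \<rho> (cls q (gen I21)) (F (k, l))"
      "ketmap sc I F (classical_action s j j' I43 k l) = \<rho> (cls q (gen I43)) (F (k, l))"
      using ev[OF mn] unfolding op_A[OF FV] op_C[OF FV]
      by (simp_all add: ketmap_scale ketmap_F wts k l Fg del: qpow_add qpow_diff)
    show "classical_action s j j' h k l \<in> ket_span I"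
      using in_span kl by (cases h) (simp_all only: classical_action.simps ket_in_span simp_thms)
    show "ketmap sc I F (classical_action s j j' h k l) = \<rho> (cls q (gen h)) (F (k, l))"
      using AC B by (cases h) (simp_all only:)
  qed
  then show ?thesis unfolding classical_rep_def s_sq I_def .
qed

text \<open>The reflection of \<open>mirror\<close> identifies the two halves of the rectangle, and
  the index set is the half \<open>H\<close> cut along the half-integral coordinate. The value of
  \<epsilon> is forced by expressing, at the cut, the vector just outside \<open>H\<close> by its
  reflection.\<close>

lemma nonclassical_case:
  assumes lb: "lattice_basis sc q A B C V (\<iota> * s ^ (J + K)) (\<iota>' * (s ^ J / s ^ K)) (\<i> * \<iota>) J K g"
    and \<iota>: "\<iota> * \<iota> = - 1" "\<iota>' * \<iota>' = - 1" and c: "c * c = - 1" and odd: "odd (J + K)"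
    and mirror: "\<And>m n. m \<le> J \<Longrightarrow> n \<le> K \<Longrightarrow> g (J - m) (K - n) = (c * (- 1) ^ (m + n)) \<cdot> g m n"
  defines "j \<equiv> of_nat J / 2" and "j' \<equiv> of_nat K / 2" and "\<epsilon> \<equiv> \<i> * c * (- 1) ^ ((J + K - 1) div 2)"
  shows "\<exists>R. nonclassical_rep s j j' (\<i> * \<iota>) (\<i> * \<iota>') \<epsilon> R \<and> irreducible_so4_rep ket_scale q (ket_span (nonclassical_index j j')) R
    \<and> equivalent_so4_rep q sc V \<rho> ket_scale (ket_span (nonclassical_index j j')) R"
proof -
  define H where "H = {(m, n). m \<le> J \<and> n \<le> K \<and> (if odd J then 2 * m < J else 2 * n < K)}"
  define I where "I = nonclassical_index j j'"
  have I: "I = (\<lambda>(m, n). (j - of_nat m, j' - of_nat n)) ` H"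
    unfolding I_def j_def j'_def H_def by (rule nonclassical_index_eq)
  define F where "F = (\<lambda>kl. if kl \<in> I then g (nat \<lfloor>j - fst kl\<rfloor>) (nat \<lfloor>j' - snd kl\<rfloor>) else 0)"
  have "finite H" by (rule finite_subset[of _ "{..J} \<times> {..K}"]) (auto simp: H_def)
  then have fin: "finite I" unfolding I by simp
  have F0: "F i = 0" if "i \<notin> I" for i using that by (simp add: F_def)
  have ketmap_F: "ketmap sc I F (ket a b) = F (a, b)" for a b
    by (rule ketmap_ket) (use fin F0 in blast)+
  have mem: "(j - of_nat m, j' - of_nat n) \<in> I \<longleftrightarrow> (m, n) \<in> H" for m n
    unfolding I lattice_member_iff ..
  have Fg: "F (j - of_nat m, j' - of_nat n) = g m n" if "(m, n) \<in> H" for m n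
    using mem[of m n] that by (auto simp: F_def)
  have Icases: thesis if "(k, l) \<in> I" "\<And>m n. (m, n) \<in> H \<Longrightarrow> k = j - of_nat m \<Longrightarrow> l = j' - of_nat n \<Longrightarrow> thesis" for k l thesis
    using that unfolding I by auto
  have HD: "m \<le> J" "n \<le> K" if "(m, n) \<in> H" for m n using that by (auto simp: H_def)
  note B_g = lattice_basisD(7)[OF lb]
  have hj [simp]: "half_int j" "half_int j'" "qpow s j = s ^ J" "qpow s j' = s ^ K"
    by (simp_all add: j_def j'_def)
  have x: "\<iota> * s ^ (J + K) / q ^ m / q ^ n = \<iota> * qpow s (j - of_nat m + (j' - of_nat n))"
    and y: "\<iota>' * (s ^ J / s ^ K) * q ^ n / q ^ m = \<iota>' * qpow s (j - of_nat m - (j' - of_nat n))" for m n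
    using s_neq q_nonzero by (simp_all add: power_add mult_ac)
  note ev = lattice_basisD(3-6)[OF lb, unfolded x y]
  have \<iota>0: "\<iota> \<noteq> 0" "\<iota>' \<noteq> 0" using \<iota> by auto
  have jZ: "j \<in> \<int> \<longleftrightarrow> even J" "j' \<in> \<int> \<longleftrightarrow> even K" unfolding j_def j'_def by (rule half_nat_Ints)+
  have hI: "half_int k \<and> half_int l" if "(k, l) \<in> I" for k l
    by (rule Icases[OF that]) simp
  have "\<exists>R. given_on_basis q I (nonclassical_action s j j' (\<i> * \<iota>) (\<i> * \<iota>') \<epsilon>) R \<and> irreducible_so4_rep ket_scale q (ket_span I) R
    \<and> equivalent_so4_rep q sc V \<rho> ket_scale (ket_span I) R"
  proof (rule realize[OF irrep lin fin F0, where \<alpha> = "\<lambda>(k, l). wt q (\<iota> * qpow s (k + l))" and \<gamma> = "\<lambda>(k, l). wt q (\<iota>' * qpow s (k - l))"])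
    fix i assume "i \<in> I"
    then obtain k l where kl: "i = (k, l)" "(k, l) \<in> I" by (cases i) auto
    show "A (F i) = (case i of (k, l) \<Rightarrow> wt q (\<iota> * qpow s (k + l))) \<cdot> F i"
      unfolding kl(1) by (rule Icases[OF kl(2)]) (use ev HD in \<open>simp add: Fg del: qpow_add qpow_diff\<close>)
    show "C (F i) = (case i of (k, l) \<Rightarrow> wt q (\<iota>' * qpow s (k - l))) \<cdot> F i"
      unfolding kl(1) by (rule Icases[OF kl(2)]) (use ev HD in \<open>simp add: Fg del: qpow_add qpow_diff\<close>)
    show "F i \<noteq> 0"
      unfolding kl(1) by (rule Icases[OF kl(2)]) (use ev HD in \<open>simp add: Fg\<close>)
  next
    show "inj_on (\<lambda>i. (case i of (k, l) \<Rightarrow> wt q (\<iota> * qpow s (k + l)), case i of (k, l) \<Rightarrow> wt q (\<iota>' * qpow s (k - l)))) I"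
    proof (rule inj_onI, clarify)
      fix k l k' l' assume kl: "(k, l) \<in> I" "(k', l') \<in> I"
        and e: "wt q (\<iota> * qpow s (k + l)) = wt q (\<iota> * qpow s (k' + l'))" "wt q (\<iota>' * qpow s (k - l)) = wt q (\<iota>' * qpow s (k' - l'))"
      \<comment> \<open>Here k + l and k - l are determined only up to sign. Equality in both gives
        the same point, negation in both gives the reflected point, which is outside
        \<open>H\<close>, and mixed signs contradict odd J + K.\<close>
      have inj: "a = b \<or> a + b = 0" if ab: "half_int a" "half_int b" "wt q (\<tau> * qpow s a) = wt q (\<tau> * qpow s b)" "\<tau> * \<tau> = - 1" for a b \<tau>
      proof -
        have \<tau>: "\<tau> \<noteq> 0" using ab(4) by auto
        have "\<tau> * qpow s a = \<tau> * qpow s b \<or> \<tau> * qpow s a * (\<tau> * qpow s b) = - 1"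
          using ab(3) by (subst (asm) wt_eq_iff) (use \<tau> in auto)
        moreover have "\<tau> * qpow s a * (\<tau> * qpow s b) = - qpow s (a + b)"
        proof -
          have "\<tau> * qpow s a * (\<tau> * qpow s b) = (\<tau> * \<tau>) * qpow s (a + b)" using ab(1,2) by (simp add: mult_ac)
          then show ?thesis unfolding ab(4) by simp
        qed
        ultimately have "qpow s a = qpow s b \<or> qpow s (a + b) = qpow s 0" using \<tau> by (auto simp: qpow_0 simp del: qpow_add)
        then show ?thesis using qpow_eq_iff[OF ab(1,2)] qpow_eq_iff[of "a + b" 0] ab(1,2) half_int_simps(4)[of 0] by auto
      qed
      have h: "half_int (k + l)" "half_int (k' + l')" "half_int (k - l)" "half_int (k' - l')"
        using hI[OF kl(1)] hI[OF kl(2)] by simp_all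
      have cs: "k + l = k' + l' \<or> k + l + (k' + l') = 0" "k - l = k' - l' \<or> k - l + (k' - l') = 0"
        by (rule inj[OF h(1,2) e(1) \<iota>(1)], rule inj[OF h(3,4) e(2) \<iota>(2)])
      obtain m n where mn: "(m, n) \<in> H" "k = j - of_nat m" "l = j' - of_nat n" using Icases[OF kl(1)] by metis
      obtain m' n' where mn': "(m', n') \<in> H" "k' = j - of_nat m'" "l' = j' - of_nat n'" using Icases[OF kl(2)] by metis
      let ?c = "rat_of_int"
      have two: "2 * (k + l) = ?c (int J + int K - 2 * int m - 2 * int n)" "2 * (k - l) = ?c (int J - int K - 2 * int m + 2 * int n)"
         "2 * (k' + l') = ?c (int J + int K - 2 * int m' - 2 * int n')" "2 * (k' - l') = ?c (int J - int K - 2 * int m' + 2 * int n')"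
        by (simp_all add: mn mn' j_def j'_def)
      have d1: "m + n = m' + n' \<or> J + K = m + n + m' + n'"
      proof -
        have "2 * (k + l) = 2 * (k' + l') \<or> 2 * (k + l) + 2 * (k' + l') = 0" using cs(1) by auto
        then show ?thesis unfolding two of_int_add[symmetric] of_int_eq_iff of_int_eq_0_iff by linarith
      qed
      have d2: "int m - int n = int m' - int n' \<or> int J - int K = int m - int n + int m' - int n'"
      proof -
        have "2 * (k - l) = 2 * (k' - l') \<or> 2 * (k - l) + 2 * (k' - l') = 0" using cs(2) by auto
        then show ?thesis unfolding two of_int_add[symmetric] of_int_eq_iff of_int_eq_0_iff by linarith
      qed
      have "m = m' \<and> n = n'"
      proof (rule ccontr)
        assume neg: "\<not> (m = m' \<and> n = n')"
        have "J = m + m' \<and> K = n + n'"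
          using d1
        proof
          assume s: "m + n = m' + n'"
          then have s': "int m + int n = int m' + int n'" by presburger
          show ?thesis using d2
          proof
            assume "int m - int n = int m' - int n'"
            with s neg show ?thesis by linarith
          next
            assume "int J - int K = int m - int n + int m' - int n'"
            then have "int (J + K) = 2 * (int K + int m - int n')" using s' by (simp only: of_nat_add) presburger
            then have "even (int (J + K))" by simp
            with odd show ?thesis by simp
          qed
        next
          assume s: "J + K = m + n + m' + n'"
          then have s': "int J + int K = int m + int n + int m' + int n'" by presburger
          show ?thesis using d2
          proof
            assume "int m - int n = int m' - int n'"
            then have "m + n' = m' + n" by presburger
            then have "J + K = 2 * (m' + n)" using s by presburger
            with odd show ?thesis by simp
          next
            assume "int J - int K = int m - int n + int m' - int n'"
            with s' show ?thesis by presburger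
          qed
        qed
        with mn(1) mn'(1) show False by (auto simp: H_def split: if_splits)
      qed
      then show "k = k' \<and> l = l'" by (simp add: mn mn')
    qed
  next
    have "F ` I = (\<lambda>(m, n). g m n) ` H"
      unfolding I image_image by (rule image_cong) (auto simp: Fg)
    moreover have "H \<subseteq> {..J} \<times> {..K}" by (auto simp: H_def)
    ultimately have "F ` I \<subseteq> (\<lambda>(m, n). g m n) ` ({..J} \<times> {..K})" by (simp only: image_mono)
    then have "span (F ` I) \<subseteq> V" unfolding lattice_basisD(2)[OF lb] by (rule span_mono)
    \<comment> \<open>A point outside \<open>H\<close> is the reflection of a point of
      \<open>H\<close>, so its vector is a multiple of one already in the span.\<close>
    moreover have "g m n \<in> span (F ` I)" if mn: "m \<le> J" "n \<le> K" for m n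
    proof -
      have H: "g m n \<in> span (F ` I)" if "(m, n) \<in> H" for m n
        using Fg[OF that] mem[of m n] that by (intro span_base) (metis imageI)
      show ?thesis
      proof (cases "(m, n) \<in> H")
        case False
        have "2 * (a - x) < a" if "odd a" "x \<le> a" "\<not> 2 * x < a" for a x :: nat
        proof -
          have "2 * x \<noteq> a" using that(1) by auto
          then show ?thesis using that(2,3) by arith
        qed
        then have "(J - m, K - n) \<in> H" using False mn odd by (auto simp: H_def split: if_splits)
        moreover have "g m n = (c * (- 1) ^ (J - m + (K - n))) \<cdot> g (J - m) (K - n)"
          using mirror[of "J - m" "K - n"] mn by simp
        ultimately show ?thesis using H by (simp add: span_scale)
      qed (rule H)
    qed
    then have "V \<subseteq> span (F ` I)" unfolding lattice_basisD(2)[OF lb] by (intro span_minimal) auto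
    ultimately show "V = span (F ` I)" by blast
  next
    fix h k l assume kl: "(k, l) \<in> I"
    obtain m n where mn: "(m, n) \<in> H" and k: "k = j - of_nat m" and l: "l = j' - of_nat n"
      using Icases[OF kl] by metis
    note mJ = HD(1)[OF mn] and nK = HD(2)[OF mn]
    have FV: "F (k, l) \<in> V" using ev[OF mJ nK] mn by (simp add: k l Fg)
    have hk [simp]: "half_int k" "half_int l" "qpow s k = s ^ J / q ^ m" "qpow s l = s ^ K / q ^ n"
      by (simp_all add: k l)
    define \<theta> where "\<theta> = q - 1 / q"
    have \<theta>: "\<theta> \<noteq> 0" using theta_nonzero unfolding \<theta>_def .
    have \<theta>q: "qpow s 1 - qpow s (- 1) = \<theta>" by (simp add: \<theta>_def)
    have inv_i: "1 / \<tau> = - \<tau>" if "\<tau> * \<tau> = - 1" for \<tau> :: complex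
    proof -
      have "\<tau> \<noteq> 0" using that by auto
      moreover have "\<tau> * - \<tau> = 1" using that by simp
      ultimately show ?thesis by (metis nonzero_eq_divide_eq mult.commute)
    qed
    \<comment> \<open>The factor \<tau> turns \<open>up\<close>, which forms the denominators of
      R_jj', into a multiple of a bracket. This is how the denominators of the nonclassical formulas
      arise.\<close>
    have up_i: "up (\<tau> * qpow s r) = \<tau> * \<theta> * qnum s r" if "\<tau> * \<tau> = - 1" "half_int r" for \<tau> r
    proof -
      have "1 / (\<tau> * qpow s r) = 1 / \<tau> * (1 / qpow s r)" by simp
      also have "\<dots> = - \<tau> * (1 / qpow s r)" unfolding inv_i[OF that(1)] ..
      finally have "up (\<tau> * qpow s r) = \<tau> * (qpow s r - 1 / qpow s r)" by (simp add: up_def algebra_simps)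
      then show ?thesis using \<theta> by (simp add: qnum_br[OF that(2)] br_def flip: \<theta>_def)
    qed
    have br_i: "br q (\<tau> * qpow s r) = \<tau> * qnum s r" if "\<tau> * \<tau> = 1" "half_int r" for \<tau> r
    proof -
      have "\<tau> = 1 \<or> \<tau> = - 1" using that(1) square_eq_1_iff by blast
      moreover have "br q (- z) = - br q z" for z
      proof -
        have "- z - 1 / (- z) = - (z - 1 / z)" by simp
        then show ?thesis unfolding br_def by (simp only: minus_divide_left)
      qed
      ultimately show ?thesis by (auto simp: qnum_br[OF that(2)])
    qed
    have \<iota>\<iota>: "(\<iota> * \<iota>') * (\<iota> * \<iota>') = 1" "(\<iota> / \<iota>') * (\<iota> / \<iota>') = 1"
    proof -
      have "(\<iota> * \<iota>') * (\<iota> * \<iota>') = (\<iota> * \<iota>) * (\<iota>' * \<iota>')" by (simp add: mult_ac)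
      then show "(\<iota> * \<iota>') * (\<iota> * \<iota>') = 1" unfolding \<iota> by simp
      have "(\<iota> / \<iota>') * (\<iota> / \<iota>') = (\<iota> * \<iota>) / (\<iota>' * \<iota>')" by simp
      then show "(\<iota> / \<iota>') * (\<iota> / \<iota>') = 1" unfolding \<iota> by simp
    qed
    define u w where "u = qnum s (k + l)" and "w = qnum s (k - l)"
    define c0 where "c0 = 1 / (u * w * \<theta>)"
    define c1 where "c1 = - \<i> * qnum s (j' - l) * qnum s (j - l)"
    define c2 where "c2 = \<i> * qnum s (j' + l) * qnum s (j + l)"
    define c3 where "c3 = - \<i> * qnum s (j' - k) * qnum s (j - k)"
    define c4 where "c4 = \<i> * qnum s (j' + k) * qnum s (j + k)"
    have D: "up (\<iota> * s ^ (J + K) / q ^ m / q ^ n) * up (\<iota>' * (s ^ J / s ^ K) * q ^ n / q ^ m) = (\<iota> * \<theta> * u) * (\<iota>' * \<theta> * w)"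
    proof -
      have "up (\<iota> * s ^ (J + K) / q ^ m / q ^ n) = \<iota> * \<theta> * u"
        unfolding x u_def k[symmetric] l[symmetric] by (rule up_i[OF \<iota>(1)]) simp
      moreover have "up (\<iota>' * (s ^ J / s ^ K) * q ^ n / q ^ m) = \<iota>' * \<theta> * w"
        unfolding y w_def k[symmetric] l[symmetric] by (rule up_i[OF \<iota>(2)]) simp
      ultimately show ?thesis by simp
    qed
    have t1: "up (\<iota>' * (s ^ J / s ^ K) * q ^ n) * br q (q ^ n) = \<iota>' * \<theta> * (qnum s (j' - l) * qnum s (j - l))"
    proof -
      have "\<iota>' * (s ^ J / s ^ K) * q ^ n = \<iota>' * qpow s (j - l)" by simp
      then have "up (\<iota>' * (s ^ J / s ^ K) * q ^ n) = \<iota>' * \<theta> * qnum s (j - l)" using up_i[OF \<iota>(2), of "j - l"] by (simp only: half_int_simps hj hk)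
      moreover have "br q (q ^ n) = qnum s (j' - l)" using s_neq by (simp add: qnum_br)
      ultimately show ?thesis by simp
    qed
    have t2: "up (\<iota> * s ^ (J + K) / q ^ n) * br q (\<iota> * s ^ (J + K) / (\<iota>' * (s ^ J / s ^ K) * q ^ n)) = \<iota> * \<theta> * (\<iota> / \<iota>') * (qnum s (j' + l) * qnum s (j + l))"
    proof -
      have "\<iota> * s ^ (J + K) / q ^ n = \<iota> * qpow s (j + l)" by (simp add: power_add)
      then have "up (\<iota> * s ^ (J + K) / q ^ n) = \<iota> * \<theta> * qnum s (j + l)" using up_i[OF \<iota>(1), of "j + l"] by (simp only: half_int_simps hj hk)
      moreover have "\<iota> * s ^ (J + K) / (\<iota>' * (s ^ J / s ^ K) * q ^ n) = (\<iota> / \<iota>') * qpow s (j' + l)" using s_neq by (simp add: power_add)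
      then have "br q (\<iota> * s ^ (J + K) / (\<iota>' * (s ^ J / s ^ K) * q ^ n)) = (\<iota> / \<iota>') * qnum s (j' + l)"
        using br_i[OF \<iota>\<iota>(2), of "j' + l"] by (simp only: half_int_simps hj hk)
      ultimately show ?thesis by (simp only: mult_ac)
    qed
    have t3: "up (\<iota>' * (s ^ J / s ^ K) / q ^ m) * br q (q ^ m) = - (\<iota>' * \<theta> * (qnum s (j' - k) * qnum s (j - k)))"
    proof -
      have "\<iota>' * (s ^ J / s ^ K) / q ^ m = \<iota>' * qpow s (k - j')" by (simp add: mult_ac)
      then have "up (\<iota>' * (s ^ J / s ^ K) / q ^ m) = \<iota>' * \<theta> * qnum s (k - j')" using up_i[OF \<iota>(2), of "k - j'"] by (simp only: half_int_simps hj hk)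
      also have "qnum s (k - j') = - qnum s (j' - k)" using qnum_minus[of "j' - k"] by simp
      finally have "up (\<iota>' * (s ^ J / s ^ K) / q ^ m) = - (\<iota>' * \<theta> * qnum s (j' - k))" by simp
      moreover have "br q (q ^ m) = qnum s (j - k)" using s_neq by (simp add: qnum_br)
      ultimately show ?thesis by simp
    qed
    have t4: "up (\<iota> * s ^ (J + K) / q ^ m) * br q (\<iota> * s ^ (J + K) * (\<iota>' * (s ^ J / s ^ K)) / q ^ m) = \<iota> * \<theta> * (\<iota> * \<iota>') * (qnum s (j' + k) * qnum s (j + k))"
    proof -
      have "\<iota> * s ^ (J + K) / q ^ m = \<iota> * qpow s (j' + k)" by (simp add: power_add)
      then have "up (\<iota> * s ^ (J + K) / q ^ m) = \<iota> * \<theta> * qnum s (j' + k)" using up_i[OF \<iota>(1), of "j' + k"] by (simp only: half_int_simps hj hk)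
      moreover have "\<iota> * s ^ (J + K) * (\<iota>' * (s ^ J / s ^ K)) / q ^ m = (\<iota> * \<iota>') * qpow s (j + k)" using s_neq by (simp add: power_add)
      then have "br q (\<iota> * s ^ (J + K) * (\<iota>' * (s ^ J / s ^ K)) / q ^ m) = (\<iota> * \<iota>') * qnum s (j + k)"
        using br_i[OF \<iota>\<iota>(1), of "j + k"] by (simp only: half_int_simps hj hk)
      ultimately show ?thesis by (simp only: mult_ac)
    qed
    have co: "\<i> * \<iota> / ((\<iota> * \<theta> * u) * (\<iota>' * \<theta> * w)) * (\<iota>' * \<theta> * z) = c0 * (\<i> * z)" for z
    proof (cases "u = 0 \<or> w = 0")
      case False
      then show ?thesis unfolding c0_def using \<iota>0 \<theta> by (simp add: field_simps)
    qed (auto simp: c0_def)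
    \<comment> \<open>This brings all four terms to the common factor \<iota>' \<theta>, so that a
      single constant stands in front of the sum.\<close>
    have \<iota>': "\<iota> * \<theta> * (\<iota> / \<iota>') * z = \<iota>' * \<theta> * z" "\<iota> * \<theta> * (\<iota> * \<iota>') * z = - (\<iota>' * \<theta> * z)" for z
    proof -
      have "\<iota> * \<theta> * (\<iota> / \<iota>') * z = (\<iota> * \<iota>) * (1 / \<iota>') * \<theta> * z" by simp
      then show "\<iota> * \<theta> * (\<iota> / \<iota>') * z = \<iota>' * \<theta> * z" unfolding \<iota> inv_i[OF \<iota>(2)] by simp
      have "\<iota> * \<theta> * (\<iota> * \<iota>') * z = (\<iota> * \<iota>) * (\<iota>' * \<theta> * z)" by (simp only: mult_ac)
      then show "\<iota> * \<theta> * (\<iota> * \<iota>') * z = - (\<iota>' * \<theta> * z)" unfolding \<iota> by simp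
    qed
    have B_eq: "B (g m n) = c0 \<cdot> (c1 \<cdot> g m (n - 1) + c2 \<cdot> g m (Suc n) + c3 \<cdot> g (m - 1) n + c4 \<cdot> g (Suc m) n)"
    proof -
      define E where "E = \<i> * \<iota> / ((\<iota> * \<theta> * u) * (\<iota>' * \<theta> * w))"
      have e: "E * (\<iota>' * \<theta> * z) = c0 * (\<i> * z)" for z unfolding E_def by (rule co)
      have c: "c0 * c1 = - (E * (\<iota>' * \<theta> * (qnum s (j' - l) * qnum s (j - l))))"
        "c0 * c2 = E * (\<iota>' * \<theta> * (qnum s (j' + l) * qnum s (j + l)))"
        "c0 * c3 = - (E * (\<iota>' * \<theta> * (qnum s (j' - k) * qnum s (j - k))))"
        "c0 * c4 = E * (\<iota>' * \<theta> * (qnum s (j' + k) * qnum s (j + k)))"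
        unfolding e c1_def c2_def c3_def c4_def by simp_all
      show ?thesis unfolding B_g[OF mJ nK] D t1 t2 t3 t4 \<iota>' E_def[symmetric] scale_right_distrib scale_right_diff_distrib scale_scale c
        by (simp add: algebra_simps)
    qed
    have n0: "c1 = 0 \<or> n \<noteq> 0" by (cases n) (simp_all add: c1_def l qnum_0)
    have m0: "c3 = 0 \<or> m \<noteq> 0" by (cases m) (simp_all add: c3_def k qnum_0)
    have nK': "c2 = 0 \<or> n < K"
    proof (cases "n = K")
      case True
      then have "j' + l = 0" by (simp add: l j'_def)
      then show ?thesis by (simp add: c2_def qnum_0)
    qed (use nK in simp)
    have mJ': "c4 = 0 \<or> m < J"
    proof (cases "m = J")
      case True
      then have "j + k = 0" by (simp add: k j_def)
      then show ?thesis by (simp add: c4_def qnum_0)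
    qed (use mJ in simp)
    have Fl: "F (k, l + 1) = g m (n - 1) \<and> (k, l + 1) \<in> I" if "n \<noteq> 0"
      using Fg[of m "n - 1"] mem[of m "n - 1"] mn that unfolding k l shifts(1)[OF that] by (auto simp: H_def split: if_splits)
    have Fk: "F (k + 1, l) = g (m - 1) n \<and> (k + 1, l) \<in> I" if "m \<noteq> 0"
      using Fg[of "m - 1" n] mem[of "m - 1" n] mn that unfolding k l shifts(1)[OF that] by (auto simp: H_def split: if_splits)
    have Fl': "F (k, l - 1) = g m (Suc n) \<and> (k, l - 1) \<in> I" if "(m, Suc n) \<in> H"
      using Fg[of m "Suc n"] mem[of m "Suc n"] that unfolding k l shifts(2) by auto
    have Fk': "F (k - 1, l) = g (Suc m) n \<and> (k - 1, l) \<in> I" if "(Suc m, n) \<in> H"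
      using Fg[of "Suc m" n] mem[of "Suc m" n] that unfolding k l shifts(2) by auto
    \<comment> \<open>Common to the interior and both edges: only the terms for l - 1 and k - 1 can
      leave \<open>H\<close> with a nonzero coefficient, and they may be replaced by any ket in the
      index set that has the same image.\<close>
    have four: "c0 *\<^sub>k (c1 *\<^sub>k ket k (l + 1) + d2 *\<^sub>k ket k2 l2 + c3 *\<^sub>k ket (k + 1) l + d4 *\<^sub>k ket k4 l4) \<in> ket_span I \<and>
      ketmap sc I F (c0 *\<^sub>k (c1 *\<^sub>k ket k (l + 1) + d2 *\<^sub>k ket k2 l2 + c3 *\<^sub>k ket (k + 1) l + d4 *\<^sub>k ket k4 l4)) = B (g m n)"
      if 2: "d2 = 0 \<or> (k2, l2) \<in> I" "d2 \<cdot> F (k2, l2) = c2 \<cdot> g m (Suc n)"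
        and 4: "d4 = 0 \<or> (k4, l4) \<in> I" "d4 \<cdot> F (k4, l4) = c4 \<cdot> g (Suc m) n" for d2 k2 l2 d4 k4 l4
    proof
      have 1: "c1 = 0 \<or> (k, l + 1) \<in> I" "c1 \<cdot> F (k, l + 1) = c1 \<cdot> g m (n - 1)" using n0 Fl by auto
      have 3: "c3 = 0 \<or> (k + 1, l) \<in> I" "c3 \<cdot> F (k + 1, l) = c3 \<cdot> g (m - 1) n" using m0 Fk by auto
      show "c0 *\<^sub>k (c1 *\<^sub>k ket k (l + 1) + d2 *\<^sub>k ket k2 l2 + c3 *\<^sub>k ket (k + 1) l + d4 *\<^sub>k ket k4 l4) \<in> ket_span I"
        by (rule ket_span_closed(2), intro ket_span_closed(1) ket_in_span 1(1) 2(1) 3(1) 4(1))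
      show "ketmap sc I F (c0 *\<^sub>k (c1 *\<^sub>k ket k (l + 1) + d2 *\<^sub>k ket k2 l2 + c3 *\<^sub>k ket (k + 1) l + d4 *\<^sub>k ket k4 l4)) = B (g m n)"
        unfolding ketmap_scale ketmap_add B_eq by (simp add: ketmap_F 1 2 3 4)
    qed
    have I32: "nonclassical_action s j j' (\<i> * \<iota>) (\<i> * \<iota>') \<epsilon> I32 k l \<in> ket_span I \<and>
      ketmap sc I F (nonclassical_action s j j' (\<i> * \<iota>) (\<i> * \<iota>') \<epsilon> I32 k l) = B (g m n)"
    proof -
      consider (edge_k) "odd J" "k = 1 / 2" | (edge_l) "even J" "l = 1 / 2"
        | (inner) "\<not> (odd J \<and> k = 1 / 2)" "\<not> (even J \<and> l = 1 / 2)" by blast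
      then show ?thesis
      proof cases
        case inner
        have "even J \<longleftrightarrow> odd K" using odd by presburger
        then have act: "nonclassical_action s j j' (\<i> * \<iota>) (\<i> * \<iota>') \<epsilon> I32 k l =
          c0 *\<^sub>k (c1 *\<^sub>k ket k (l + 1) + c2 *\<^sub>k ket k (l - 1) + c3 *\<^sub>k ket (k + 1) l + c4 *\<^sub>k ket (k - 1) l)"
          using inner unfolding nonclassical_action.simps jZ \<theta>q c0_def u_def w_def c1_def c2_def c3_def c4_def by auto
        have k2: "k = 1 / 2 \<longleftrightarrow> J = 2 * m + 1"
        proof -
          have "k = 1 / 2 \<longleftrightarrow> (of_nat J :: rat) = of_nat (2 * m + 1)" by (auto simp: k j_def field_simps)
          then show ?thesis by (simp only: of_nat_eq_iff)
        qed
        have l2: "l = 1 / 2 \<longleftrightarrow> K = 2 * n + 1"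
        proof -
          have "l = 1 / 2 \<longleftrightarrow> (of_nat K :: rat) = of_nat (2 * n + 1)" by (auto simp: l j'_def field_simps)
          then show ?thesis by (simp only: of_nat_eq_iff)
        qed
        have "c2 = 0 \<or> (m, Suc n) \<in> H"
        proof (cases "odd J")
          case True
          then show ?thesis using nK' mn by (auto simp: H_def)
        next
          case False
          have "K \<noteq> 2 * n + 1" using inner(2) False l2 by blast
          moreover have "K \<noteq> 2 * n + 2" using False odd by auto
          moreover have "2 * n < K" using mn False by (simp add: H_def)
          ultimately have "2 * Suc n < K" by arith
          then show ?thesis using False mJ by (simp add: H_def)
        qed
        moreover have "c4 = 0 \<or> (Suc m, n) \<in> H"
        proof (cases "odd J")
          case False
          then show ?thesis using mJ' mn by (auto simp: H_def)
        next
          case True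
          have "J \<noteq> 2 * m + 1" using inner(1) True k2 by blast
          moreover have "J \<noteq> 2 * m + 2" using True by auto
          moreover have "2 * m < J" using mn True by (simp add: H_def)
          ultimately have "2 * Suc m < J" by arith
          then show ?thesis using True nK by (simp add: H_def)
        qed
        ultimately show ?thesis unfolding act using Fl' Fk' by (intro four) auto
      next
        case edge_k
        have "(of_nat J :: rat) = of_nat (2 * m + 1)" using edge_k(2) by (simp add: k j_def field_simps)
        then have Jm: "J = 2 * m + 1" by (simp only: of_nat_eq_iff)
        obtain K' where K': "K = 2 * K'" using odd edge_k(1) by auto
        have Kn: "(m, K - n) \<in> H" using mn edge_k(1) by (simp add: H_def)
        have lK: "- l = j' - of_nat (K - n)" using nK by (simp add: l j'_def of_nat_diff)
        have fl: "\<lfloor>l\<rfloor> = int K' - int n"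
        proof -
          have "l = of_int (int K' - int n)" by (simp add: l j'_def K')
          then show ?thesis by (simp only: floor_of_int)
        qed
        define d where "d = \<epsilon> * (- 1) powi \<lfloor>l\<rfloor> * qnum s (j' + 1 / 2) * qnum s (j + 1 / 2)"
        \<comment> \<open>The sign of the reflection and the sign (-1)^l of the formula differ by a
          power that is the same for all l, with exponent (J + K - 1) div 2; it is absorbed into
          \<epsilon>, and so is the factor i of \<open>c4\<close>.\<close>
        have sg: "(- 1) ^ ((J + K - 1) div 2) * (- 1 :: complex) powi \<lfloor>l\<rfloor> = (- 1) ^ (m + (K - n))"
        proof -
          have "(J + K - 1) div 2 = m + K'" by (simp add: Jm K')
          moreover have "even (int (m + K') + (int K' - int n)) \<longleftrightarrow> even (m + (K - n))" using nK K' by presburger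
          ultimately show ?thesis unfolding fl by (simp only: neg_one_power_mult)
        qed
        have dc4: "d = c4 * (c * (- 1) ^ (m + (K - n)))"
          unfolding d_def c4_def sg[symmetric] \<epsilon>_def edge_k(2) by (simp add: mult_ac)
        \<comment> \<open>Since J = 2m + 1, the step to k - 1 crosses the cut and lands on the
          reflection of (m, K - n), whose ket is |1/2, -l>.\<close>
        have "g (Suc m) n = g (J - m) (K - (K - n))" using nK by (simp add: Jm)
        also have "\<dots> = (c * (- 1) ^ (m + (K - n))) \<cdot> g m (K - n)" by (rule mirror) (use mJ in auto)
        finally have gS: "c4 \<cdot> g (Suc m) n = d \<cdot> g m (K - n)" by (simp add: dc4)
        have F4: "F (k, - l) = g m (K - n) \<and> (k, - l) \<in> I" using Fg[OF Kn] mem[of m "K - n"] Kn unfolding lK k by auto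
        \<comment> \<open>At k = 1/2 the bracket of k - l is minus that of l - 1/2, hence the minus
          sign in front of this boundary formula. At l = 1/2 there is no such sign.\<close>
        have c0': "c0 = - 1 / (qnum s (l + 1 / 2) * qnum s (l - 1 / 2) * (qpow s 1 - qpow s (- 1)))"
        proof -
          have "k + l = l + 1 / 2" "k - l = - (l - 1 / 2)" by (simp_all add: edge_k(2))
          moreover have "qnum s (- (l - 1 / 2)) = - qnum s (l - 1 / 2)" by (rule qnum_minus) simp
          ultimately show ?thesis unfolding c0_def u_def w_def \<theta>q by (simp only:) simp
        qed
        have half_3: "(1 / 2 + 1 :: rat) = 3 / 2" by simp
        have j_nonint: "j \<notin> \<int>" using edge_k(1) jZ by simp
        have act: "nonclassical_action s j j' (\<i> * \<iota>) (\<i> * \<iota>') \<epsilon> I32 k l =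
          c0 *\<^sub>k (c1 *\<^sub>k ket k (l + 1) + c2 *\<^sub>k ket k (l - 1) + c3 *\<^sub>k ket (k + 1) l + d *\<^sub>k ket k (- l))"
          unfolding c0' c1_def c2_def c3_def d_def edge_k(2) using j_nonint
          by (simp only: nonclassical_action.simps half_3 simp_thms if_True mult_ac)
        have "c2 = 0 \<or> (m, Suc n) \<in> H" using nK' mn edge_k(1) by (auto simp: H_def)
        then show ?thesis unfolding act using Fl' F4 gS by (intro four) auto
      next
        case edge_l
        have oK: "odd K" using odd edge_l(1) by simp
        have "(of_nat K :: rat) = of_nat (2 * n + 1)" using edge_l(2) by (simp add: l j'_def field_simps)
        then have Kn: "K = 2 * n + 1" by (simp only: of_nat_eq_iff)
        obtain J' where J': "J = 2 * J'" using edge_l(1) by auto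
        have Jm: "(J - m, n) \<in> H" using mn edge_l(1) by (auto simp: H_def)
        have kJ: "- k = j - of_nat (J - m)" using mJ by (simp add: k j_def of_nat_diff)
        have fl: "\<lfloor>k\<rfloor> = int J' - int m"
        proof -
          have "k = of_int (int J' - int m)" by (simp add: k j_def J')
          then show ?thesis by (simp only: floor_of_int)
        qed
        define d where "d = \<epsilon> * (- 1) powi \<lfloor>k\<rfloor> * qnum s (j + 1 / 2) * qnum s (j' + 1 / 2)"
        have sg: "(- 1) ^ ((J + K - 1) div 2) * (- 1 :: complex) powi \<lfloor>k\<rfloor> = (- 1) ^ (J - m + n)"
        proof -
          have "(J + K - 1) div 2 = J' + n" by (simp add: J' Kn)
          moreover have "even (int (J' + n) + (int J' - int m)) \<longleftrightarrow> even (J - m + n)" using mJ J' by presburger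
          ultimately show ?thesis unfolding fl by (simp only: neg_one_power_mult)
        qed
        have dc2: "d = c2 * (c * (- 1) ^ (J - m + n))"
          unfolding d_def c2_def sg[symmetric] \<epsilon>_def edge_l(2) by (simp add: mult_ac)
        \<comment> \<open>Since K = 2n + 1, the step to l - 1 crosses the cut and lands on the
          reflection of (J - m, n), whose ket is |-k, 1/2>.\<close>
        have "g m (Suc n) = g (J - (J - m)) (K - n)" using mJ by (simp add: Kn)
        also have "\<dots> = (c * (- 1) ^ (J - m + n)) \<cdot> g (J - m) n" by (rule mirror) (use nK in auto)
        finally have gS: "c2 \<cdot> g m (Suc n) = d \<cdot> g (J - m) n" by (simp add: dc2)
        have F2: "F (- k, l) = g (J - m) n \<and> (- k, l) \<in> I" using Fg[OF Jm] mem[of "J - m" n] Jm unfolding kJ l by auto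
        have half_3: "(1 / 2 + 1 :: rat) = 3 / 2" by simp
        have j_int: "j \<in> \<int>" "j' \<notin> \<int>" using edge_l(1) oK jZ by simp_all
        have act: "nonclassical_action s j j' (\<i> * \<iota>) (\<i> * \<iota>') \<epsilon> I32 k l =
          c0 *\<^sub>k (c1 *\<^sub>k ket k (l + 1) + d *\<^sub>k ket (- k) l + c3 *\<^sub>k ket (k + 1) l + c4 *\<^sub>k ket (k - 1) l)"
          unfolding c0_def u_def w_def \<theta>q[symmetric] c1_def c3_def c4_def d_def edge_l(2) using j_int
          by (simp only: nonclassical_action.simps half_3 simp_thms if_True if_False mult_ac)
        have "c4 = 0 \<or> (Suc m, n) \<in> H" using mJ' mn edge_l(1) by (auto simp: H_def)
        then show ?thesis unfolding act using Fk' F2 gS by (intro four) auto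
      qed
    qed
    have wts: "\<i> * \<tau> * qnum_plus s r = wt q (\<tau> * qpow s r)" if "\<tau> * \<tau> = - 1" "half_int r" for \<tau> r
    proof -
      have "1 / (\<tau> * qpow s r) = 1 / \<tau> * (1 / qpow s r)" by simp
      also have "\<dots> = - \<tau> * (1 / qpow s r)" unfolding inv_i[OF that(1)] ..
      finally have "\<tau> * qpow s r - 1 / (\<tau> * qpow s r) = \<tau> * up (qpow s r)" by (simp add: up_def algebra_simps)
      then show ?thesis unfolding wt_def qnum_plus_up[OF that(2)] by simp
    qed
    have AC: "ketmap sc I F (nonclassical_action s j j' (\<i> * \<iota>) (\<i> * \<iota>') \<epsilon> I21 k l) = \<rho> (cls q (gen I21)) (F (k, l))"
      "ketmap sc I F (nonclassical_action s j j' (\<i> * \<iota>) (\<i> * \<iota>') \<epsilon> I43 k l) = \<rho> (cls q (gen I43)) (F (k, l))"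
      using ev[OF mJ nK] mn unfolding op_A[OF FV] op_C[OF FV] nonclassical_action.simps
      by (simp_all add: ketmap_scale ketmap_F wts[OF \<iota>(1)] wts[OF \<iota>(2)] k l Fg del: qpow_add qpow_diff)
    show "nonclassical_action s j j' (\<i> * \<iota>) (\<i> * \<iota>') \<epsilon> h k l \<in> ket_span I"
    proof (cases h)
      case I32
      then show ?thesis using \<open>nonclassical_action s j j' (\<i> * \<iota>) (\<i> * \<iota>') \<epsilon> I32 k l \<in> ket_span I \<and> _\<close> by (simp only:)
    qed (simp_all only: nonclassical_action.simps ket_in_span kl simp_thms)
    have "B (g m n) = \<rho> (cls q (gen I32)) (F (k, l))" using op_B[OF FV] mn by (simp add: k l Fg)
    then show "ketmap sc I F (nonclassical_action s j j' (\<i> * \<iota>) (\<i> * \<iota>') \<epsilon> h k l) = \<rho> (cls q (gen h)) (F (k, l))"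
      using AC I32 by (cases h) (simp_all only:)
  qed
  then show ?thesis unfolding nonclassical_rep_def s_sq I_def .
qed

end

lemma half_integral_half_nat: "half_integral (of_nat J / 2) \<longleftrightarrow> odd J"
proof
  assume "half_integral (of_nat J / 2)"
  then obtain z where z: "of_nat J / 2 - 1 / 2 = (of_int z :: rat)"
    unfolding half_integral_def using Ints_cases by metis
  then have "(of_int (int J) :: rat) = of_int (2 * z + 1)" by simp
  then have "int J = 2 * z + 1" by (simp only: of_int_eq_iff)
  then show "odd J" by presburger
next
  assume "odd J"
  then obtain n where "J = 2 * n + 1" by (rule oddE)
  then have "of_nat J / 2 - 1 / 2 = (of_nat n :: rat)" by (simp add: field_simps)
  then show "half_integral (of_nat J / 2)" unfolding half_integral_def by simp
qed

theorem theorem4: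
  fixes q s :: complex
    and scale :: "complex \<Rightarrow> 'v::ab_group_add \<Rightarrow> 'v"
    and V :: "'v set"
    and \<rho> :: "free_alg set \<Rightarrow> 'v \<Rightarrow> 'v"
  assumes "q \<noteq> 0"
    and "s ^ 2 = q"
    and "\<And>n::nat. n > 0 \<Longrightarrow> q ^ n \<noteq> 1"
    and "irreducible_so4_rep scale q V \<rho>"
    and "finite_dim_space scale V"
  shows
    "(\<exists>j j' R.
        j \<ge> 0 \<and> j' \<ge> 0 \<and> (j \<in> \<int> \<or> half_integral j) \<and> (j' \<in> \<int> \<or> half_integral j') \<and>
        classical_rep s j j' R \<and>
        irreducible_so4_rep ket_scale q (ket_span (classical_index j j')) R \<and>
        equivalent_so4_rep q scale V \<rho> ket_scale (ket_span (classical_index j j')) R) \<or>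
     (\<exists>j j' \<epsilon>1 \<epsilon>2 \<epsilon>3 R.
        \<epsilon>1 \<in> {1, - 1} \<and> \<epsilon>2 \<in> {1, - 1} \<and> \<epsilon>3 \<in> {1, - 1} \<and>
        j \<ge> j' \<and> j' \<ge> 0 \<and>
        (half_integral j \<and> j' \<in> \<int> \<or> j \<in> \<int> \<and> half_integral j') \<and>
        nonclassical_rep s j j' \<epsilon>1 \<epsilon>2 \<epsilon>3 R \<and>
        irreducible_so4_rep ket_scale q (ket_span (nonclassical_index j j')) R \<and>
        equivalent_so4_rep q scale V \<rho> ket_scale (ket_span (nonclassical_index j j')) R)"
proof -
  obtain A B C S where irr: "so4_irr scale q A B C V S s"
    and ops: "\<And>v. v \<in> V \<Longrightarrow> \<rho> (cls q (gen I21)) v = A v" "\<And>v. v \<in> V \<Longrightarrow> \<rho> (cls q (gen I32)) v = B v"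
      "\<And>v. v \<in> V \<Longrightarrow> \<rho> (cls q (gen I43)) v = C v"
    using irreducible_gives_operators[OF assms(1,3,2,4,5)] by blast
  interpret N: so4_irr scale q A B C V S s by (rule irr)
  interpret operator_rep scale q s V \<rho> A B C
    by (intro operator_rep.intro operator_rep_axioms.intro generic_root.intro generic_root_axioms.intro
        N.cvs_axioms N.generic_q_axioms assms(2,4) so3_pair.lin_A[OF N.pair_AB] so3_pair.lin_A[OF N.pair_CB] ops)
  from N.classification show ?thesis
  proof (elim disjE exE conjE)
    fix J K g assume "lattice_basis scale q A B C V (s ^ (J + K)) (s ^ J / s ^ K) 1 J K g"
    from classical_case[OF this] obtain R
      where R: "classical_rep s (of_nat J / 2) (of_nat K / 2) R \<and>
        irreducible_so4_rep ket_scale q (ket_span (classical_index (of_nat J / 2) (of_nat K / 2))) R \<and>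
        equivalent_so4_rep q scale V \<rho> ket_scale (ket_span (classical_index (of_nat J / 2) (of_nat K / 2))) R"
      by (elim exE)
    have half: "(of_nat n / 2 :: rat) \<in> \<int> \<or> half_integral (of_nat n / 2)" for n
      unfolding half_nat_Ints half_integral_half_nat by blast
    have nonneg: "(of_nat n / 2 :: rat) \<ge> 0" for n by simp
    show ?thesis
      by (rule disjI1, rule exI[of _ "of_nat J / 2"], rule exI[of _ "of_nat K / 2"], rule exI[of _ R])
        (intro conjI half nonneg R[THEN conjunct1] R[THEN conjunct2, THEN conjunct1] R[THEN conjunct2, THEN conjunct2])
  next
    fix J K g \<iota> \<iota>' c
    assume \<iota>: "\<iota> * \<iota> = - 1" "\<iota>' * \<iota>' = - 1" and c: "c * c = - 1" and odd: "odd (J + K)" and "K \<le> J"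
      and lb: "lattice_basis scale q A B C V (\<iota> * s ^ (J + K)) (\<iota>' * (s ^ J / s ^ K)) (\<i> * \<iota>) J K g"
      and mirror: "\<forall>m n. m \<le> J \<longrightarrow> n \<le> K \<longrightarrow> g (J - m) (K - n) = scale (c * (- 1) ^ (m + n)) (g m n)"
    define \<epsilon> where "\<epsilon> = \<i> * c * (- 1) ^ ((J + K - 1) div 2)"
    \<comment> \<open>\<iota>, \<iota>' and c are square roots of -1, so multiplication by i makes
      each of them a sign.\<close>
    have sign: "\<i> * \<tau> * (- 1) ^ n \<in> {1, - 1}" if "\<tau> * \<tau> = - 1" for \<tau> :: complex and n :: nat
    proof -
      have "(\<i> * \<tau> * (- 1) ^ n) * (\<i> * \<tau> * (- 1) ^ n) = (\<i> * \<i>) * (\<tau> * \<tau>) * ((- 1) ^ n * (- 1) ^ n)"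
        by (simp only: mult_ac)
      also have "\<dots> = 1" unfolding that by (simp flip: power_mult_distrib)
      finally show ?thesis unfolding square_eq_1_iff by simp
    qed
    have "\<exists>R. nonclassical_rep s (of_nat J / 2) (of_nat K / 2) (\<i> * \<iota>) (\<i> * \<iota>') \<epsilon> R \<and>
        irreducible_so4_rep ket_scale q (ket_span (nonclassical_index (of_nat J / 2) (of_nat K / 2))) R \<and>
        equivalent_so4_rep q scale V \<rho> ket_scale (ket_span (nonclassical_index (of_nat J / 2) (of_nat K / 2))) R"
      unfolding \<epsilon>_def by (rule nonclassical_case[OF lb \<iota> c odd]) (use mirror in blast)
    then obtain R where R: "nonclassical_rep s (of_nat J / 2) (of_nat K / 2) (\<i> * \<iota>) (\<i> * \<iota>') \<epsilon> R \<and>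
        irreducible_so4_rep ket_scale q (ket_span (nonclassical_index (of_nat J / 2) (of_nat K / 2))) R \<and>
        equivalent_so4_rep q scale V \<rho> ket_scale (ket_span (nonclassical_index (of_nat J / 2) (of_nat K / 2))) R" ..
    have signs: "\<i> * \<iota> \<in> {1, - 1}" "\<i> * \<iota>' \<in> {1, - 1}" "\<epsilon> \<in> {1, - 1}"
      using sign[OF \<iota>(1), of 0] sign[OF \<iota>(2), of 0] sign[OF c, of "(J + K - 1) div 2"]
      by (simp_all only: \<epsilon>_def power_0 mult_1_right)
    have order: "(of_nat J / 2 :: rat) \<ge> of_nat K / 2" "(of_nat K / 2 :: rat) \<ge> 0" using \<open>K \<le> J\<close> by simp_all
    have parity: "half_integral (of_nat J / 2) \<and> (of_nat K / 2 :: rat) \<in> \<int>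
        \<or> (of_nat J / 2 :: rat) \<in> \<int> \<and> half_integral (of_nat K / 2)"
      unfolding half_nat_Ints half_integral_half_nat using odd by simp
    show ?thesis
      by (rule disjI2, rule exI[of _ "of_nat J / 2"], rule exI[of _ "of_nat K / 2"], rule exI[of _ "\<i> * \<iota>"],
          rule exI[of _ "\<i> * \<iota>'"], rule exI[of _ \<epsilon>], rule exI[of _ R])
        (intro conjI signs order parity R[THEN conjunct1] R[THEN conjunct2, THEN conjunct1] R[THEN conjunct2, THEN conjunct2])
  qed
qed

end
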